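(* Let $Q$ be one of the quadratic spline quasi-interpolants $S_2$, $W_2^*$ on $\Omega$. (i) There exists a constant $\overline C_2>0$, with $\overline C_2\le 122$ for $Q=S_2$ and $\overline C_2\le 65$ for $Q=W_2^*$, such that, for every $f\in C^2(\Omega)$ and $|\alpha|=1$, $$\|D^\alpha f-D^\alpha Qf\|_\Omega\le\left[1+\overline C_2\left(\frac h\delta\right)\right]h\,\omega(D^2f,h/2).$$ (ii) There exists a constant $\overline C_3>0$, with $\overline C_3\le\frac{269}{12}$ for $Q=S_2$ and $\overline C_3\le\frac{65}{6}$ for $Q=W_2^*$, such that, for every $f\in C^3(\Omega)$ and $|\alpha|=1$, $$\|D^\alpha f-D^\alpha Qf\|_\Omega\le\overline C_3\left(\frac h\delta\right)h^2\,\|D^3f\|.$$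
   Context: Partition. Let $m,n\ge 1$ be integers, $\Omega=[a,b]\times[c,d]$, $a=x_0<x_1<\dots<x_m=b$ and $c=y_0<y_1<\dots<y_n=d$, with the conventions $x_{-1}=x_0$, $x_{m+1}=x_m$, $y_{-1}=y_0$, $y_{n+1}=y_n$. Put $h_i=x_i-x_{i-1}$, $k_j=y_j-y_{j-1}$ (so $h_0=h_{m+1}=k_0=k_{n+1}=0$), $s_i=\frac12(x_{i-1}+x_i)$, $t_j=\frac12(y_{j-1}+y_j)$ for $0\le i\le m+1$, $0\le j\le n+1$. Put $M_{i,j}=(s_i,t_j)$ for these indices and $A_{i,j}=(x_i,y_j)$ for $-1\le i\le m+1$, $-1\le j\le n+1$. The criss-cross triangulation $\mathcal T_{mn}$ of $\Omega$ is obtained by drawing both diagonals in each subrectangle $\Omega_{ij}=[x_{i-1},x_i]\times[y_{j-1},y_j]$, $1\le i\le m$, $1\le j\le n$. B-splines. Choose extended knots $u_{-2}<u_{-1}<u_0<\dots<u_m<u_{m+1}<u_{m+2}$ with $u_i=x_i$ for $0\le i\le m$, and $v_{-2}<v_{-1}<v_0<\dots<v_n<v_{n+1}<v_{n+2}$ with $v_j=y_j$ for $0\le j\le n$. For $0\le i\le m+1$, $0\le j\le n+1$, the classical B-spline $\overline B_{ij}$ is the unique $C^1$ function on $\mathbb R^2$ that is a polynomial of total degree at most 2 on each triangle of the criss-cross triangulation (both diagonals in each subrectangle) of the grid $\{u_p\}\times\{v_q\}$, vanishes outside the octagon with vertices $(u_{i-2},v_{j-1}),(u_{i-2},v_j),(u_{i-1},v_{j+1}),(u_i,v_{j+1}),(u_{i+1},v_j),(u_{i+1},v_{j-1}),(u_i,v_{j-2}),(u_{i-1},v_{j-2})$,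 and is normalized by $\overline B_{ij}(u_i,v_j)=\frac{u_{i+1}-u_i}{u_{i+1}-u_{i-1}}\cdot\frac{v_{j+1}-v_j}{v_{j+1}-v_{j-1}}$. Let $\bar h_0=u_0-u_{-1}$, $\bar h_{m+1}=u_{m+1}-u_m$, $\bar k_0=v_0-v_{-1}$, $\bar k_{n+1}=v_{n+1}-v_n$. Define $\alpha_{00}=\frac{\bar h_0+h_1}{h_1}$, $\alpha_{m+1,m+1}=\frac{h_m+\bar h_{m+1}}{h_m}$, $\alpha_{ii}=1$ for $1\le i\le m$, $\alpha_{1,0}=-\frac{\bar h_0}{h_1}$, $\alpha_{m,m+1}=-\frac{\bar h_{m+1}}{h_m}$, all other $\alpha_{ip}=0$; and define $\beta_{jq}$ in the same way with $n,k,\bar k$ in place of $m,h,\bar h$. The B-spline $B_{ij}$ is the restriction to $\Omega$ of $\sum_{p=0}^{m+1}\sum_{q=0}^{n+1}\alpha_{ip}\beta_{jq}\overline B_{pq}$. The functions $B_{ij}$ are nonnegative, have supports in $\Omega$, and sum to 1. Quasi-interpolants. For $2\le i\le m$ put $\sigma_i=\frac{h_i}{h_{i-1}+h_i}$, $\sigma_i'=1-\sigma_i$; for $2\le j\le n$ put $\tau_j=\frac{k_j}{k_{j-1}+k_j}$, $\tau_j'=1-\tau_j$; and $\sigma_1=\sigma'_{m+1}=\tau_1=\tau'_{n+1}=1$, $\sigma_1'=\sigma_{m+1}=\tau_1'=\tau_{n+1}=0$. For $1\le i\le m$, $1\le j\le n$, $$a_i=-\frac{\sigma_i^2\sigma_{i+1}'}{\sigma_i+\sigma_{i+1}'},\quad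 c_i=-\frac{\sigma_i(\sigma_{i+1}')^2}{\sigma_i+\sigma_{i+1}'},\quad \bar a_j=-\frac{\tau_j^2\tau_{j+1}'}{\tau_j+\tau_{j+1}'},\quad \bar c_j=-\frac{\tau_j(\tau_{j+1}')^2}{\tau_j+\tau_{j+1}'},$$ and $a_0=c_0=a_{m+1}=c_{m+1}=\bar a_0=\bar c_0=\bar a_{n+1}=\bar c_{n+1}=0$; $b_{ij}=1-(a_i+c_i+\bar a_j+\bar c_j)$. Then $S_2f=\sum_{i=0}^{m+1}\sum_{j=0}^{n+1}\mu_{ij}(f)B_{ij}$ with $\mu_{ij}(f)=b_{ij}f(M_{i,j})+a_if(M_{i-1,j})+c_if(M_{i+1,j})+\bar a_jf(M_{i,j-1})+\bar c_jf(M_{i,j+1})$ (terms with zero coefficient are omitted), and $W_2^*f=\sum_{i=0}^{m+1}\sum_{j=0}^{n+1}\mu^*_{ij}(f)B_{ij}$ with $\mu^*_{ij}(f)=2f(M_{i,j})-\frac14[f(A_{i-1,j-1})+f(A_{i-1,j})+f(A_{i,j-1})+f(A_{i,j})]$. Notation. $h=\max\{h_i,k_j: 1\le i\le m,\,1\le j\le n\}$, $\delta=\min\{h_i,k_j: 1\le i\le m,\,1\le j\le n\}$; $\|\cdot\|_\Omega$ is the supremum norm over $\Omega$; for $\psi\in C(\Omega)$, $\omega(\psi,t)=\max\{|\psi(M)-\psi(P)|: M,P\in\Omega,\ \|MP\|\le t\}$, where $\|MP\|$ is the Euclidean distance; for a multi-index $\alpha=(\alpha_1,\alpha_2)$ of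 nonnegative integers, $D^\alpha=\frac{\partial^{|\alpha|}}{\partial x^{\alpha_1}\partial y^{\alpha_2}}$ with $|\alpha|=\alpha_1+\alpha_2$; $\omega(D^sf,t)=\max\{\omega(D^\alpha f,t):|\alpha|=s\}$; $\|D^3f\|=\max\{\|D^\alpha f\|_\Omega:|\alpha|=3\}$. *)

theory Defs
  imports "HOL-Analysis.Analysis"
begin

section \<open>Smooth functions on plane sets\<close>

text \<open>Partial derivatives are taken within the set \<open>X\<close>; on a closed rectangle they are one-sided
  at the boundary.\<close>

definition Dx :: "(real \<times> real) set \<Rightarrow> (real \<times> real \<Rightarrow> real) \<Rightarrow> real \<times> real \<Rightarrow> real" where
  "Dx X f = (\<lambda>(x, y). vector_derivative (\<lambda>s. f (s, y)) (at x within {s. (s, y) \<in> X}))"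

definition Dy :: "(real \<times> real) set \<Rightarrow> (real \<times> real \<Rightarrow> real) \<Rightarrow> real \<times> real \<Rightarrow> real" where
  "Dy X f = (\<lambda>(x, y). vector_derivative (\<lambda>t. f (x, t)) (at y within {t. (x, t) \<in> X}))"

definition D :: "(real \<times> real) set \<Rightarrow> nat \<times> nat \<Rightarrow> (real \<times> real \<Rightarrow> real) \<Rightarrow> real \<times> real \<Rightarrow> real" where
  "D X \<alpha> f = (Dx X ^^ fst \<alpha>) ((Dy X ^^ snd \<alpha>) f)"

text \<open>Class \<open>C^k\<close>: all iterated partial derivatives of order at most \<open>k\<close>, in any order, exist and
  are continuous on \<open>X\<close>.\<close>

primrec Ck :: "nat \<Rightarrow> (real \<times> real) set \<Rightarrow> (real \<times> real \<Rightarrow> real) \<Rightarrow> bool" where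
  "Ck 0 X f \<longleftrightarrow> continuous_on X f"
| "Ck (Suc k) X f \<longleftrightarrow> continuous_on X f \<and>
     (\<forall>(x, y)\<in>X. (\<lambda>s. f (s, y)) differentiable (at x within {s. (s, y) \<in> X}) \<and>
                 (\<lambda>t. f (x, t)) differentiable (at y within {t. (x, t) \<in> X})) \<and>
     Ck k X (Dx X f) \<and> Ck k X (Dy X f)"

definition sup_norm :: "(real \<times> real) set \<Rightarrow> (real \<times> real \<Rightarrow> real) \<Rightarrow> real" where
  "sup_norm X g = (SUP z\<in>X. \<bar>g z\<bar>)"

text \<open>\<open>dist\<close> on the product type is the Euclidean distance. For continuous \<open>\<psi>\<close>, compact nonempty
  \<open>X\<close> and \<open>t \<ge> 0\<close> the supremum is attained.\<close>

definition modulus :: "(real \<times> real) set \<Rightarrow> (real \<times> real \<Rightarrow> real) \<Rightarrow> real \<Rightarrow> real" where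
  "modulus X \<psi> t = Sup {\<bar>\<psi> M - \<psi> P\<bar> | M P. M \<in> X \<and> P \<in> X \<and> dist M P \<le> t}"

definition modulus_D :: "(real \<times> real) set \<Rightarrow> nat \<Rightarrow> (real \<times> real \<Rightarrow> real) \<Rightarrow> real \<Rightarrow> real" where
  "modulus_D X s f t = Max ((\<lambda>\<alpha>. modulus X (D X \<alpha> f) t) ` {\<alpha>. fst \<alpha> + snd \<alpha> = s})"

definition norm_D :: "(real \<times> real) set \<Rightarrow> nat \<Rightarrow> (real \<times> real \<Rightarrow> real) \<Rightarrow> real" where
  "norm_D X s f = Max ((\<lambda>\<alpha>. sup_norm X (D X \<alpha> f)) ` {\<alpha>. fst \<alpha> + snd \<alpha> = s})"

section \<open>Partitions\<close>

text \<open>A partition of an interval is given together with its extended knots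
  \<open>u (-2) < \<dots> < u (m + 2)\<close>. The partition points themselves are \<open>pt m u i = u i\<close> for
  \<open>0 \<le> i \<le> m\<close>, repeated at both ends: \<open>x_{-1} = x_0\<close> and \<open>x_{m+1} = x_m\<close>.\<close>

definition knots :: "int \<Rightarrow> (int \<Rightarrow> real) \<Rightarrow> bool" where
  "knots m u \<longleftrightarrow> 1 \<le> m \<and> strict_mono_on {-2..m + 2} u"

definition pt :: "int \<Rightarrow> (int \<Rightarrow> real) \<Rightarrow> int \<Rightarrow> real" where
  "pt m u i = u (max 0 (min m i))"

definition step :: "int \<Rightarrow> (int \<Rightarrow> real) \<Rightarrow> int \<Rightarrow> real" where
  "step m u i = pt m u i - pt m u (i - 1)"

definition mid :: "int \<Rightarrow> (int \<Rightarrow> real) \<Rightarrow> int \<Rightarrow> real" where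
  "mid m u i = (pt m u (i - 1) + pt m u i) / 2"

definition domain :: "int \<Rightarrow> (int \<Rightarrow> real) \<Rightarrow> int \<Rightarrow> (int \<Rightarrow> real) \<Rightarrow> (real \<times> real) set" where
  "domain m u n v = {u 0..u m} \<times> {v 0..v n}"

definition mesh_max :: "int \<Rightarrow> (int \<Rightarrow> real) \<Rightarrow> int \<Rightarrow> (int \<Rightarrow> real) \<Rightarrow> real" where
  "mesh_max m u n v = Max (step m u ` {1..m} \<union> step n v ` {1..n})"

definition mesh_min :: "int \<Rightarrow> (int \<Rightarrow> real) \<Rightarrow> int \<Rightarrow> (int \<Rightarrow> real) \<Rightarrow> real" where
  "mesh_min m u n v = Min (step m u ` {1..m} \<union> step n v ` {1..n})"

section \<open>B-splines on the criss-cross triangulation\<close>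

text \<open>The four triangles cut by the two diagonals from the cell
  \<open>[u p, u (p + 1)] \<times> [v q, v (q + 1)]\<close>.\<close>

definition cell_triangles ::
  "(int \<Rightarrow> real) \<Rightarrow> (int \<Rightarrow> real) \<Rightarrow> int \<Rightarrow> int \<Rightarrow> (real \<times> real) set set" where
  "cell_triangles u v p q =
    (let Z = ((u p + u (p + 1)) / 2, (v q + v (q + 1)) / 2);
         SW = (u p, v q); SE = (u (p + 1), v q);
         NW = (u p, v (q + 1)); NE = (u (p + 1), v (q + 1))
     in {convex hull {SW, SE, Z}, convex hull {SE, NE, Z},
         convex hull {NE, NW, Z}, convex hull {NW, SW, Z}})"

definition quadratic_on :: "(real \<times> real) set \<Rightarrow> (real \<times> real \<Rightarrow> real) \<Rightarrow> bool" where
  "quadratic_on T f \<longleftrightarrow>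
    (\<exists>c :: nat \<Rightarrow> nat \<Rightarrow> real. \<forall>(x, y)\<in>T. f (x, y) = (\<Sum>p\<le>2. \<Sum>q\<le>2 - p. c p q * x ^ p * y ^ q))"

definition octagon :: "(int \<Rightarrow> real) \<Rightarrow> (int \<Rightarrow> real) \<Rightarrow> int \<Rightarrow> int \<Rightarrow> (real \<times> real) set" where
  "octagon u v i j = convex hull
    {(u (i - 2), v (j - 1)), (u (i - 2), v j), (u (i - 1), v (j + 1)), (u i, v (j + 1)),
     (u (i + 1), v j), (u (i + 1), v (j - 1)), (u i, v (j - 2)), (u (i - 1), v (j - 2))}"

definition is_classical_bspline ::
  "int \<Rightarrow> (int \<Rightarrow> real) \<Rightarrow> int \<Rightarrow> (int \<Rightarrow> real) \<Rightarrow> int \<Rightarrow> int \<Rightarrow> (real \<times> real \<Rightarrow> real) \<Rightarrow> bool" where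
  "is_classical_bspline m u n v i j B \<longleftrightarrow>
     Ck 1 UNIV B \<and>
     (\<forall>p\<in>{-2..m + 1}. \<forall>q\<in>{-2..n + 1}. \<forall>T\<in>cell_triangles u v p q. quadratic_on T B) \<and>
     (\<forall>z. z \<notin> octagon u v i j \<longrightarrow> B z = 0) \<and>
     B (u i, v j) = (u (i + 1) - u i) / (u (i + 1) - u (i - 1)) *
                    ((v (j + 1) - v j) / (v (j + 1) - v (j - 1)))"

definition classical_bspline ::
  "int \<Rightarrow> (int \<Rightarrow> real) \<Rightarrow> int \<Rightarrow> (int \<Rightarrow> real) \<Rightarrow> int \<Rightarrow> int \<Rightarrow> real \<times> real \<Rightarrow> real" where
  "classical_bspline m u n v i j = (THE B. is_classical_bspline m u n v i j B)"

text \<open>The coefficients \<open>\<alpha>_{ip}\<close>; the \<open>\<beta>_{jq}\<close> are \<open>bcoef n v j q\<close>.\<close>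

definition bcoef :: "int \<Rightarrow> (int \<Rightarrow> real) \<Rightarrow> int \<Rightarrow> int \<Rightarrow> real" where
  "bcoef m u i p =
    (let h0 = u 0 - u (-1); hm1 = u (m + 1) - u m in
     if i = 0 \<and> p = 0 then (h0 + step m u 1) / step m u 1
     else if i = m + 1 \<and> p = m + 1 then (step m u m + hm1) / step m u m
     else if i = p \<and> 1 \<le> i \<and> i \<le> m then 1
     else if i = 1 \<and> p = 0 then - (h0 / step m u 1)
     else if i = m \<and> p = m + 1 then - (hm1 / step m u m)
     else 0)"

definition bspline ::
  "int \<Rightarrow> (int \<Rightarrow> real) \<Rightarrow> int \<Rightarrow> (int \<Rightarrow> real) \<Rightarrow> int \<Rightarrow> int \<Rightarrow> real \<times> real \<Rightarrow> real" where
  "bspline m u n v i j z =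
    (\<Sum>p = 0..m + 1. \<Sum>q = 0..n + 1. bcoef m u i p * bcoef n v j q * classical_bspline m u n v p q z)"

section \<open>Quasi-interpolants\<close>

definition sigma :: "int \<Rightarrow> (int \<Rightarrow> real) \<Rightarrow> int \<Rightarrow> real" where
  "sigma m u i =
    (if i = 1 then 1 else if i = m + 1 then 0 else step m u i / (step m u (i - 1) + step m u i))"

definition sigma' :: "int \<Rightarrow> (int \<Rightarrow> real) \<Rightarrow> int \<Rightarrow> real" where
  "sigma' m u i = 1 - sigma m u i"

definition acoef :: "int \<Rightarrow> (int \<Rightarrow> real) \<Rightarrow> int \<Rightarrow> real" where
  "acoef m u i =
    (if 1 \<le> i \<and> i \<le> m
     then - ((sigma m u i)\<^sup>2 * sigma' m u (i + 1) / (sigma m u i + sigma' m u (i + 1))) else 0)"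

definition ccoef :: "int \<Rightarrow> (int \<Rightarrow> real) \<Rightarrow> int \<Rightarrow> real" where
  "ccoef m u i =
    (if 1 \<le> i \<and> i \<le> m
     then - (sigma m u i * (sigma' m u (i + 1))\<^sup>2 / (sigma m u i + sigma' m u (i + 1))) else 0)"

type_synonym quasi_interpolant =
  "int \<Rightarrow> (int \<Rightarrow> real) \<Rightarrow> int \<Rightarrow> (int \<Rightarrow> real) \<Rightarrow> (real \<times> real \<Rightarrow> real) \<Rightarrow> real \<times> real \<Rightarrow> real"

definition mu ::
  "int \<Rightarrow> (int \<Rightarrow> real) \<Rightarrow> int \<Rightarrow> (int \<Rightarrow> real) \<Rightarrow> (real \<times> real \<Rightarrow> real) \<Rightarrow> int \<Rightarrow> int \<Rightarrow> real" where
  "mu m u n v f i j =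
    (let M = (\<lambda>i j. (mid m u i, mid n v j));
         a = acoef m u i; c = ccoef m u i; a' = acoef n v j; c' = ccoef n v j;
         b = 1 - (a + c + a' + c')
     in b * f (M i j) + a * f (M (i - 1) j) + c * f (M (i + 1) j)
          + a' * f (M i (j - 1)) + c' * f (M i (j + 1)))"

definition mu_star ::
  "int \<Rightarrow> (int \<Rightarrow> real) \<Rightarrow> int \<Rightarrow> (int \<Rightarrow> real) \<Rightarrow> (real \<times> real \<Rightarrow> real) \<Rightarrow> int \<Rightarrow> int \<Rightarrow> real" where
  "mu_star m u n v f i j =
    (let A = (\<lambda>i j. (pt m u i, pt n v j))
     in 2 * f (mid m u i, mid n v j)
        - 1 / 4 * (f (A (i - 1) (j - 1)) + f (A (i - 1) j) + f (A i (j - 1)) + f (A i j)))"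

definition S2 :: quasi_interpolant where
  "S2 m u n v f z = (\<Sum>i = 0..m + 1. \<Sum>j = 0..n + 1. mu m u n v f i j * bspline m u n v i j z)"

definition W2_star :: quasi_interpolant where
  "W2_star m u n v f z =
    (\<Sum>i = 0..m + 1. \<Sum>j = 0..n + 1. mu_star m u n v f i j * bspline m u n v i j z)"

end

theory Submission
  imports Defs
begin

text \<open>Each classical B-spline is the \<open>C\<^sup>1\<close> piecewise quadratic Hermite interpolant, at the vertices of
  the grid, of a tensor product of univariate quadratic B-splines. Hence on a cell the \<open>x\<close>-derivative of a spline
  \<open>\<Sum> c\<^sub>i\<^sub>j B\<^sub>i\<^sub>j\<close> interpolates its values at the four corners and at the centre linearly on each
  triangle, and these five values are convex combinations of the slopes
  \<open>2 (c\<^sub>k\<^sub>+\<^sub>1\<^sub>,\<^sub>j - c\<^sub>k\<^sub>,\<^sub>j) / (h\<^sub>k + h\<^sub>k\<^sub>+\<^sub>1)\<close>. So it suffices to bound the slopes of the coefficient functionals.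
  If \<open>\<ell>\<close> is the affine Taylor polynomial of \<open>f\<^sub>x\<close> at the centre of the cell, both families of functionals
  reproduce the slopes of a quadratic \<open>q\<close> with \<open>q\<^sub>x = \<ell>\<close>. Their slopes at \<open>g = f - q\<close> are combinations
  of difference quotients of \<open>g\<close> along horizontal segments, with total weight 4 for \<open>S\<^sub>2\<close> and 3 for
  \<open>W\<^sub>2\<^sup>*\<close>, hence are bounded by a multiple of \<open>sup \<bar>f\<^sub>x - \<ell>\<bar>\<close> on nearby cells. The weights do not
  involve \<open>h/\<delta>\<close>, so the stated constants follow with room to spare. The \<open>y\<close>-derivative is
  handled by exchanging the coordinates.\<close>

section \<open>The cell formula of a B-spline\<close>

text \<open>The classical B-splines are given only by a definite description, so nothing can be
  computed before existence and uniqueness are settled. Uniqueness is a rigidity: the value at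
  \<open>(u i, v j)\<close> controls all first-order data at the vertices. The combinations with
  \<open>bcoef\<close> make the extended knots cancel, so that only steps of the partition enter,
  those outside it being zero. Differentiating B-splines one at a time would cost a factor
  1/\<delta>, since each gradient has size of order 1/step. Passing to differences of coefficients
  avoids this: such a difference regroups into increments whose lengths, weighted by their
  coefficients, are compensated by the divisor of the slope. The slope with indices
  \<open>k\<close>, \<open>j\<close> belongs to the point \<open>(pt m u k, mid n v j)\<close>, and
  this placement makes the mean of slopes reproduce affine functions. The final factors are 37 = 1 +
  4 * 9 and 18 = 1 + 2 * 4 + 1 * 9: the leading 1 is the affine error at the point itself, and 4 and
  9 are the growth of the remainder at distance 2h and 3h from the centre of the cell.\<close>

text \<open>On the cell between the knots \<open>p\<close> and \<open>p + 1\<close>, the univariate B-spline number \<open>i\<close> has the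
  Bernstein coefficients \<open>kval u i p\<close>, \<open>cmid i p\<close>, \<open>kval u i (p + 1)\<close>; \<open>cdif\<close> and \<open>ccur\<close> are its
  coefficients of \<open>\<xi>\<close> and \<open>\<xi>\<^sup>2\<close> in the local variable \<open>\<xi> \<in> [-1, 1]\<close>.\<close>

definition kval :: "(int \<Rightarrow> real) \<Rightarrow> int \<Rightarrow> int \<Rightarrow> real" where
  "kval u i p =
    (if p = i then (u (i + 1) - u i) / (u (i + 1) - u (i - 1))
     else if p = i - 1 then (u (i - 1) - u (i - 2)) / (u i - u (i - 2)) else 0)"

definition cmid :: "int \<Rightarrow> int \<Rightarrow> real" where
  "cmid i p = (if p = i - 1 then 1 else 0)"

definition cdif :: "(int \<Rightarrow> real) \<Rightarrow> int \<Rightarrow> int \<Rightarrow> real" where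
  "cdif u i p = (kval u i (p + 1) - kval u i p) / 2"

definition ccur :: "(int \<Rightarrow> real) \<Rightarrow> int \<Rightarrow> int \<Rightarrow> real" where
  "ccur u i p = (kval u i p - 2 * cmid i p + kval u i (p + 1)) / 4"

text \<open>The Hermite interpolant of a product of two quadratics on \<open>[-1, 1]\<^sup>2\<close>: it replaces \<open>\<xi>\<^sup>2\<eta>\<close>,
  \<open>\<xi>\<eta>\<^sup>2\<close>, \<open>\<xi>\<^sup>2\<eta>\<^sup>2\<close> by \<open>C\<^sup>1\<close> functions that are quadratic between the diagonals \<open>\<xi> = \<eta>\<close>, \<open>\<xi> = -\<eta>\<close>.
  Writing it with \<open>r \<bar>r\<bar>\<close> makes it \<open>C\<^sup>1\<close> without a case distinction.\<close>

definition cell_val :: "real \<Rightarrow> real \<Rightarrow> real \<Rightarrow> real \<Rightarrow> real \<Rightarrow> real \<Rightarrow> real \<Rightarrow> real \<Rightarrow> real" where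
  "cell_val m d e m' d' e' \<xi> \<eta> =
     m * m' + e * m' + m * e' + d * m' * \<xi> + m * d' * \<eta> + d * d' * (\<xi> * \<eta>)
     + e * (m' + 2 * e') * (\<xi> * \<xi>) + (m + 2 * e) * e' * (\<eta> * \<eta>)
     + e * d' * (((\<xi> + \<eta>) * \<bar>\<xi> + \<eta>\<bar> - (\<xi> - \<eta>) * \<bar>\<xi> - \<eta>\<bar>) / 2)
     + d * e' * (((\<xi> + \<eta>) * \<bar>\<xi> + \<eta>\<bar> + (\<xi> - \<eta>) * \<bar>\<xi> - \<eta>\<bar>) / 2)"

definition cell_dx :: "real \<Rightarrow> real \<Rightarrow> real \<Rightarrow> real \<Rightarrow> real \<Rightarrow> real \<Rightarrow> real \<Rightarrow> real \<Rightarrow> real" where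
  "cell_dx m d e m' d' e' \<xi> \<eta> =
     d * m' + d * d' * \<eta> + 2 * e * (m' + 2 * e') * \<xi>
     + e * d' * (\<bar>\<xi> + \<eta>\<bar> - \<bar>\<xi> - \<eta>\<bar>) + d * e' * (\<bar>\<xi> + \<eta>\<bar> + \<bar>\<xi> - \<eta>\<bar>)"

lemma cell_val_swap: "cell_val m d e m' d' e' \<xi> \<eta> = cell_val m' d' e' m d e \<eta> \<xi>"
proof -
  have "\<bar>\<eta> - \<xi>\<bar> = \<bar>\<xi> - \<eta>\<bar>" "\<eta> + \<xi> = \<xi> + \<eta>" by auto
  then show ?thesis unfolding cell_val_def by (simp add: field_simps)
qed

lemma has_field_derivative_mult_abs:
  "((\<lambda>r::real. r * \<bar>r\<bar>) has_field_derivative 2 * \<bar>x\<bar>) (at x within S)"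
proof (cases "x = 0")
  case True
  have "((\<lambda>r::real. \<bar>r\<bar>) \<longlongrightarrow> \<bar>0\<bar>) (at 0 within S)" by (intro tendsto_intros)
  moreover have "\<forall>\<^sub>F r in at 0 within S. (r * \<bar>r\<bar> - 0 * \<bar>0\<bar>) / (r - 0) = \<bar>r::real\<bar>"
    by (auto simp: eventually_at_filter)
  ultimately have "((\<lambda>r::real. (r * \<bar>r\<bar> - 0 * \<bar>0\<bar>) / (r - 0)) \<longlongrightarrow> \<bar>0\<bar>) (at 0 within S)"
    by (simp only: tendsto_cong)
  then show ?thesis using True by (simp add: has_field_derivative_iff)
next
  case False
  then consider "x > 0" | "x < 0" by linarith
  then have "((\<lambda>r::real. r * \<bar>r\<bar>) has_field_derivative 2 * \<bar>x\<bar>) (at x)"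
  proof cases
    case 1
    have "((\<lambda>r::real. r * r) has_field_derivative 2 * \<bar>x\<bar>) (at x)"
      using 1 by (auto intro!: derivative_eq_intros)
    then show ?thesis
      by (rule has_field_derivative_transform_within_open[where S = "{0<..}"]) (use 1 in auto)
  next
    case 2
    have "((\<lambda>r::real. - (r * r)) has_field_derivative 2 * \<bar>x\<bar>) (at x)"
      using 2 by (auto intro!: derivative_eq_intros)
    then show ?thesis
      by (rule has_field_derivative_transform_within_open[where S = "{..<0}"]) (use 2 in auto)
  qed
  then show ?thesis by (rule has_field_derivative_at_within)
qed

lemma has_field_derivative_mult_abs_affine:
  fixes \<xi> :: "real \<Rightarrow> real"
  assumes "(\<xi> has_field_derivative c) (at x within S)"
  shows "((\<lambda>r. \<xi> r * \<bar>\<xi> r\<bar>) has_field_derivative 2 * \<bar>\<xi> x\<bar> * c) (at x within S)"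
  using DERIV_chain2[OF has_field_derivative_mult_abs[of "\<xi> x" UNIV] assms] by simp

lemma has_field_derivative_cell_val:
  fixes \<xi> :: "real \<Rightarrow> real"
  assumes "(\<xi> has_field_derivative c) (at x within S)"
  shows "((\<lambda>r. cell_val m d e m' d' e' (\<xi> r) \<eta>) has_field_derivative
           c * cell_dx m d e m' d' e' (\<xi> x) \<eta>) (at x within S)"
proof -
  have p: "((\<lambda>r. (\<xi> r + \<eta>) * \<bar>\<xi> r + \<eta>\<bar>) has_field_derivative 2 * \<bar>\<xi> x + \<eta>\<bar> * c) (at x within S)"
    by (rule has_field_derivative_mult_abs_affine) (auto intro!: derivative_eq_intros assms)
  have q: "((\<lambda>r. (\<xi> r - \<eta>) * \<bar>\<xi> r - \<eta>\<bar>) has_field_derivative 2 * \<bar>\<xi> x - \<eta>\<bar> * c) (at x within S)"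
    by (rule has_field_derivative_mult_abs_affine) (auto intro!: derivative_eq_intros assms)
  show ?thesis unfolding cell_val_def cell_dx_def
    by (rule derivative_eq_intros p q assms refl | simp)+ (simp add: field_simps)
qed

section \<open>Gluing of C1 functions along closed rectangles\<close>

text \<open>A jet is a function together with its two partial derivatives.\<close>

definition jet_on :: "real set \<Rightarrow> real set \<Rightarrow> (real \<times> real \<Rightarrow> real \<times> real \<times> real) \<Rightarrow> bool" where
  "jet_on A B J \<longleftrightarrow> continuous_on (A \<times> B) J \<and>
     (\<forall>x\<in>A. \<forall>y\<in>B.
        ((\<lambda>s. fst (J (s, y))) has_field_derivative fst (snd (J (x, y)))) (at x within A) \<and>
        ((\<lambda>t. fst (J (x, t))) has_field_derivative snd (snd (J (x, y)))) (at y within B))"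

text \<open>At a point outside a closed piece the filter \<open>at x within\<close> that piece is
  trivial, so the derivative within it holds vacuously. The filter of the union is the supremum of
  the two filters.\<close>

lemma has_field_derivative_within_Un:
  fixes f :: "real \<Rightarrow> real"
  assumes "closed S" "closed T" "x \<in> S \<union> T"
    and "x \<in> S \<Longrightarrow> (f has_field_derivative c) (at x within S)"
    and "x \<in> T \<Longrightarrow> (f has_field_derivative c) (at x within T)"
  shows "(f has_field_derivative c) (at x within S \<union> T)"
proof -
  have "(f has_field_derivative c) (at x within A)" if "closed A" "x \<notin> A" for A
  proof -
    have "at x within A = bot"
      using that by (metis at_within_eq_bot_iff closed_limpt islimpt_in_closure)
    then show ?thesis by (simp add: has_field_derivative_iff)
  qed
  then have "(f has_field_derivative c) (at x within S)" "(f has_field_derivative c) (at x within T)"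
    using assms by blast+
  then show ?thesis
    by (metis (no_types, lifting) has_field_derivative_iff at_within_union filterlim_sup)
qed

text \<open>Both hypotheses concern the same jet \<open>J\<close>, so agreement on a common edge is
  built in: the derivatives from the two sides are given by the same component of
  \<open>J\<close>.\<close>

lemma jet_on_Un_left:
  assumes "closed A" "closed A'" "closed B" "jet_on A B J" "jet_on A' B J"
  shows "jet_on (A \<union> A') B J"
proof -
  have "continuous_on (A \<times> B \<union> A' \<times> B) J"
    using assms by (intro continuous_on_closed_Un) (auto simp: jet_on_def closed_Times)
  then have "continuous_on ((A \<union> A') \<times> B) J" by (simp add: Sigma_Un_distrib1)
  then show ?thesis using assms unfolding jet_on_def
    by (auto intro!: has_field_derivative_within_Un)
qed

lemma jet_on_Un_right:
  assumes "closed A" "closed B" "closed B'" "jet_on A B J" "jet_on A B' J"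
  shows "jet_on A (B \<union> B') J"
proof -
  have "continuous_on (A \<times> B \<union> A \<times> B') J"
    using assms by (intro continuous_on_closed_Un) (auto simp: jet_on_def closed_Times)
  then have "continuous_on (A \<times> (B \<union> B')) J" by (simp add: Sigma_Un_distrib2)
  then show ?thesis using assms unfolding jet_on_def
    by (auto intro!: has_field_derivative_within_Un)
qed

lemma jet_on_cong:
  assumes "jet_on A B J" "\<And>x y. x \<in> A \<Longrightarrow> y \<in> B \<Longrightarrow> J' (x, y) = J (x, y)"
  shows "jet_on A B J'"
proof -
  have c: "continuous_on (A \<times> B) J'"
    by (rule continuous_on_eq[of _ J]) (use assms in \<open>auto simp: jet_on_def\<close>)
  have "((\<lambda>s. fst (J' (s, y))) has_field_derivative fst (snd (J' (x, y)))) (at x within A)"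
    "((\<lambda>t. fst (J' (x, t))) has_field_derivative snd (snd (J' (x, y)))) (at y within B)"
    if xy: "x \<in> A" "y \<in> B" for x y
  proof -
    have x: "((\<lambda>s. fst (J (s, y))) has_field_derivative fst (snd (J (x, y)))) (at x within A)"
      and y: "((\<lambda>t. fst (J (x, t))) has_field_derivative snd (snd (J (x, y)))) (at y within B)"
      using assms(1) xy by (simp_all add: jet_on_def)
    show "((\<lambda>s. fst (J' (s, y))) has_field_derivative fst (snd (J' (x, y)))) (at x within A)"
      unfolding assms(2)[OF xy]
      by (rule has_field_derivative_transform_within[OF x zero_less_one xy(1)]) (simp add: assms(2) xy)
    show "((\<lambda>t. fst (J' (x, t))) has_field_derivative snd (snd (J' (x, y)))) (at y within B)"
      unfolding assms(2)[OF xy]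
      by (rule has_field_derivative_transform_within[OF y zero_less_one xy(2)]) (simp add: assms(2) xy)
  qed
  then show ?thesis using c by (simp add: jet_on_def)
qed

section \<open>The local formula and its traces on the edges of a cell\<close>

definition loc :: "(int \<Rightarrow> real) \<Rightarrow> int \<Rightarrow> real \<Rightarrow> real" where
  "loc u p x = (2 * x - u p - u (p + 1)) / (u (p + 1) - u p)"

text \<open>The factor \<open>2 / (u (p + 1) - u p)\<close> is the derivative of
  \<open>loc u p\<close>. The last component is the first partial with the two univariate factors
  exchanged, as \<open>cell_val_swap\<close> permits.\<close>

definition cell_jet ::
  "(int \<Rightarrow> real) \<Rightarrow> (int \<Rightarrow> real) \<Rightarrow> int \<Rightarrow> int \<Rightarrow> int \<Rightarrow> int \<Rightarrow> real \<times> real \<Rightarrow> real \<times> real \<times> real" where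
  "cell_jet u v i j p q = (\<lambda>(x, y).
     (cell_val (cmid i p) (cdif u i p) (ccur u i p) (cmid j q) (cdif v j q) (ccur v j q) (loc u p x) (loc v q y),
      2 / (u (p + 1) - u p) *
        cell_dx (cmid i p) (cdif u i p) (ccur u i p) (cmid j q) (cdif v j q) (ccur v j q) (loc u p x) (loc v q y),
      2 / (v (q + 1) - v q) *
        cell_dx (cmid j q) (cdif v j q) (ccur v j q) (cmid i p) (cdif u i p) (ccur u i p) (loc v q y) (loc u p x)))"

lemma has_field_derivative_loc:
  "(loc u p has_field_derivative 2 / (u (p + 1) - u p)) (at x within S)"
  unfolding loc_def by (rule DERIV_cdivide) (auto intro!: derivative_eq_intros)

lemma continuous_on_loc:
  assumes "continuous_on S f"
  shows "continuous_on S (\<lambda>z. loc u p (f z))"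
proof -
  have "continuous_on S (\<lambda>z. (2 * f z - a - b) * c)" for a b c
    by (intro continuous_intros assms)
  then show ?thesis by (simp only: loc_def divide_inverse)
qed

lemma jet_on_cell_jet: "jet_on A B (cell_jet u v i j p q)"
  unfolding jet_on_def
proof (intro conjI ballI)
  show "continuous_on (A \<times> B) (cell_jet u v i j p q)"
    unfolding cell_jet_def cell_val_def cell_dx_def case_prod_beta
    by (intro continuous_intros continuous_on_loc) auto
  fix x y
  show "((\<lambda>s. fst (cell_jet u v i j p q (s, y))) has_field_derivative
       fst (snd (cell_jet u v i j p q (x, y)))) (at x within A)"
    unfolding cell_jet_def prod.case fst_conv snd_conv
    by (rule has_field_derivative_cell_val[OF has_field_derivative_loc])
  show "((\<lambda>s. fst (cell_jet u v i j p q (x, s))) has_field_derivative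
       snd (snd (cell_jet u v i j p q (x, y)))) (at y within B)"
    unfolding cell_jet_def prod.case fst_conv snd_conv
    by (subst cell_val_swap) (rule has_field_derivative_cell_val[OF has_field_derivative_loc])
qed

text \<open>This is the C1 condition of the univariate B-spline at the knot \<open>p + 1\<close>, in
  Bernstein form: both sides are half of a one-sided derivative there.\<close>

lemma kval_slope:
  assumes "u (i - 2) < u (i - 1)" "u (i - 1) < u i" "u i < u (i + 1)"
  shows "(kval u i (p + 1) - cmid i p) / (u (p + 1) - u p) =
         (cmid i (p + 1) - kval u i (p + 1)) / (u (p + 2) - u (p + 1))"
proof -
  have a: "A / (A + B) / A = (1 - A / (A + B)) / B" if "A > 0" "B > 0" for A B :: real
    using that by (simp add: divide_simps)
  have a': "(A / (A + B) - 1) / B = (0 - A / (A + B)) / A" if "A > 0" "B > 0" for A B :: real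
    using that by (simp add: divide_simps)
  consider "p = i - 2" | "p = i - 1" | "p \<noteq> i - 2" "p \<noteq> i - 1" by blast
  then show ?thesis
  proof cases
    case 1
    then show ?thesis
      using a[of "u (i - 1) - u (i - 2)" "u i - u (i - 1)"] assms by (simp add: kval_def cmid_def)
  next
    case 2
    then show ?thesis
      using a'[of "u (i + 1) - u i" "u i - u (i - 1)"] assms
      by (simp add: kval_def cmid_def add.commute)
  next
    case 3
    then show ?thesis by (auto simp: kval_def cmid_def)
  qed
qed

text \<open>On an edge the value is that of the tensor product itself, while the normal derivative
  is linear and interpolates the tensor product derivative at the two ends. Both split into one
  factor per variable, which reduces matching across an edge to a univariate question.\<close>

lemma cell_right:
  assumes "\<bar>\<eta>\<bar> \<le> 1"
  shows "cell_val m d e m' d' e' 1 \<eta> = (m + 2 * e + d) * (m' + e' + d' * \<eta> + e' * (\<eta> * \<eta>))"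
    and "cell_dx m d e m' d' e' 1 \<eta> = (d + 2 * e) * (m' + d' * \<eta> + 2 * e')"
    and "cell_dx m' d' e' m d e \<eta> 1 = (m + 2 * e + d) * (d' + 2 * e' * \<eta>)"
proof -
  have a: "\<bar>1 + \<eta>\<bar> = 1 + \<eta>" "\<bar>1 - \<eta>\<bar> = 1 - \<eta>" "\<bar>\<eta> + 1\<bar> = 1 + \<eta>" "\<bar>\<eta> - 1\<bar> = 1 - \<eta>"
    using assms by auto
  show "cell_val m d e m' d' e' 1 \<eta> = (m + 2 * e + d) * (m' + e' + d' * \<eta> + e' * (\<eta> * \<eta>))"
    unfolding cell_val_def a by (simp add: field_simps)
  show "cell_dx m d e m' d' e' 1 \<eta> = (d + 2 * e) * (m' + d' * \<eta> + 2 * e')"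
    unfolding cell_dx_def a by (simp add: field_simps)
  show "cell_dx m' d' e' m d e \<eta> 1 = (m + 2 * e + d) * (d' + 2 * e' * \<eta>)"
    unfolding cell_dx_def a by (simp add: field_simps)
qed

lemma cell_left:
  assumes "\<bar>\<eta>\<bar> \<le> 1"
  shows "cell_val m d e m' d' e' (-1) \<eta> = (m + 2 * e - d) * (m' + e' + d' * \<eta> + e' * (\<eta> * \<eta>))"
    and "cell_dx m d e m' d' e' (-1) \<eta> = (d - 2 * e) * (m' + d' * \<eta> + 2 * e')"
    and "cell_dx m' d' e' m d e \<eta> (-1) = (m + 2 * e - d) * (d' + 2 * e' * \<eta>)"
proof -
  have a: "\<bar>-1 + \<eta>\<bar> = 1 - \<eta>" "\<bar>-1 - \<eta>\<bar> = 1 + \<eta>" "\<bar>\<eta> + -1\<bar> = 1 - \<eta>" "\<bar>\<eta> - -1\<bar> = 1 + \<eta>"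
    using assms by auto
  show "cell_val m d e m' d' e' (-1) \<eta> = (m + 2 * e - d) * (m' + e' + d' * \<eta> + e' * (\<eta> * \<eta>))"
    unfolding cell_val_def a by (simp add: field_simps)
  show "cell_dx m d e m' d' e' (-1) \<eta> = (d - 2 * e) * (m' + d' * \<eta> + 2 * e')"
    unfolding cell_dx_def a by (simp add: field_simps)
  show "cell_dx m' d' e' m d e \<eta> (-1) = (m + 2 * e - d) * (d' + 2 * e' * \<eta>)"
    unfolding cell_dx_def a by (simp add: field_simps)
qed

text \<open>The end values and end derivatives, with respect to \<xi>, of the univariate quadratic,
  read off from its Bernstein coefficients.\<close>

lemma coef_ends:
  "cmid i p + 2 * ccur u i p + cdif u i p = kval u i (p + 1)"
  "cmid i p + 2 * ccur u i p - cdif u i p = kval u i p"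
  "cdif u i p + 2 * ccur u i p = kval u i (p + 1) - cmid i p"
  "cdif u i p - 2 * ccur u i p = cmid i p - kval u i p"
  unfolding cdif_def ccur_def by (simp_all only: add_divide_distrib diff_divide_distrib) simp_all

lemma loc_ends:
  assumes "u p < u (p + 1)"
  shows "loc u p (u p) = -1" "loc u p (u (p + 1)) = 1"
  using assms by (auto simp: loc_def field_simps)

lemma loc_bounds:
  assumes "u p < u (p + 1)" "u p \<le> x" "x \<le> u (p + 1)"
  shows "\<bar>loc u p x\<bar> \<le> 1"
  using assms by (auto simp: loc_def abs_le_iff field_simps)

text \<open>The factors in the second variable are common to both sides of the edge. Value and
  tangential derivative match through the shared end value \<open>kval u i (p + 1)\<close>, the
  normal derivative through \<open>kval_slope\<close>.\<close>

lemma cell_jet_match_x: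
  assumes "u (i - 2) < u (i - 1)" "u (i - 1) < u i" "u i < u (i + 1)"
    and "u p < u (p + 1)" "u (p + 1) < u (p + 2)"
    and "v q < v (q + 1)" "v q \<le> y" "y \<le> v (q + 1)"
  shows "cell_jet u v i j p q (u (p + 1), y) = cell_jet u v i j (p + 1) q (u (p + 1), y)"
proof -
  have b: "\<bar>loc v q y\<bar> \<le> 1" using assms by (intro loc_bounds)
  have l: "loc u p (u (p + 1)) = 1" "loc u (p + 1) (u (p + 1)) = -1"
    using loc_ends[of u p] loc_ends[of u "p + 1"] assms by (auto simp: algebra_simps)
  have scale: "2 / A * (P * c) = 2 / B * (Q * c)" if "P / A = Q / B" for A B P Q c :: real
  proof -
    have "2 / A * (P * c) = P / A * (2 * c)" by simp
    also have "\<dots> = Q / B * (2 * c)" by (simp only: that)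
    finally show ?thesis by simp
  qed
  have "2 / (u (p + 1) - u p) * ((kval u i (p + 1) - cmid i p) * c) =
        2 / (u (p + 2) - u (p + 1)) * ((cmid i (p + 1) - kval u i (p + 1)) * c)" for c
    by (rule scale[OF kval_slope[OF assms(1-3)]])
  moreover have "p + 1 + 1 = p + 2" by simp
  ultimately show ?thesis unfolding cell_jet_def prod.case
    by (simp only: l cell_left[OF b] cell_right[OF b] coef_ends)
qed

lemma coef_zero:
  assumes "p \<notin> {i - 2, i - 1, i}"
  shows "cmid i p = 0" "cdif u i p = 0" "ccur u i p = 0"
  using assms by (auto simp: cmid_def cdif_def ccur_def kval_def)

lemma cell_jet_zero:
  assumes "p \<notin> {i - 2, i - 1, i} \<or> q \<notin> {j - 2, j - 1, j}"
  shows "cell_jet u v i j p q z = 0"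
  using assms
proof
  assume "p \<notin> {i - 2, i - 1, i}"
  then show ?thesis
    unfolding cell_jet_def cell_val_def cell_dx_def coef_zero[OF \<open>p \<notin> _\<close>]
    by (simp add: zero_prod_def split: prod.split)
next
  assume "q \<notin> {j - 2, j - 1, j}"
  then show ?thesis
    unfolding cell_jet_def cell_val_def cell_dx_def coef_zero[OF \<open>q \<notin> _\<close>]
    by (simp add: zero_prod_def split: prod.split)
qed

section \<open>The element on the whole plane\<close>

lemma cell_jet_swap:
  "cell_jet u v i j p q (x, y) = (\<lambda>(a, b, c). (a, c, b)) (cell_jet v u j i q p (y, x))"
  by (simp add: cell_jet_def) (rule cell_val_swap)

definition local_knots :: "(int \<Rightarrow> real) \<Rightarrow> int \<Rightarrow> bool" where
  "local_knots u i \<longleftrightarrow> u (i - 2) < u (i - 1) \<and> u (i - 1) < u i \<and> u i < u (i + 1)"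

definition piece :: "(int \<Rightarrow> real) \<Rightarrow> int \<Rightarrow> real \<Rightarrow> int" where
  "piece u i x = (if x \<le> u (i - 1) then i - 2 else if x \<le> u i then i - 1 else i)"

text \<open>The nonuniform Zwart-Powell element together with its gradient: a block of three by
  three cells, extended by zero. At an inner knot \<open>piece\<close> takes the cell on the left;
  the matching across edges makes this choice immaterial.\<close>

definition zp_jet ::
  "(int \<Rightarrow> real) \<Rightarrow> (int \<Rightarrow> real) \<Rightarrow> int \<Rightarrow> int \<Rightarrow> real \<times> real \<Rightarrow> real \<times> real \<times> real" where
  "zp_jet u v i j = (\<lambda>(x, y).
     if x \<in> {u (i - 2)..u (i + 1)} \<and> y \<in> {v (j - 2)..v (j + 1)}
     then cell_jet u v i j (piece u i x) (piece v j y) (x, y) else 0)"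

lemma local_knots_cell:
  assumes "local_knots u i" "p \<in> {i - 2, i - 1, i}"
  shows "u p < u (p + 1)" "u (i - 2) \<le> u p" "u (p + 1) \<le> u (i + 1)"
  using assms unfolding local_knots_def by auto

lemma piece_cases:
  assumes "local_knots u i" "p \<in> {i - 2, i - 1, i}" "u p \<le> x" "x \<le> u (p + 1)"
  obtains "piece u i x = p" | "x = u p" "piece u i x + 1 = p" "p - 1 \<in> {i - 2, i - 1, i}"
proof (cases "x = u p \<and> p \<noteq> i - 2")
  case True
  then show ?thesis using assms(1,2) that(2) unfolding local_knots_def piece_def by auto
next
  case False
  then have "piece u i x = p" using assms unfolding local_knots_def piece_def by auto
  then show ?thesis by (rule that(1))
qed

lemma piece_mem: "piece u i x \<in> {i - 2, i - 1, i}"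
  by (simp add: piece_def)

lemma piece_bounds:
  assumes "local_knots u i" "x \<in> {u (i - 2)..u (i + 1)}"
  shows "u (piece u i x) \<le> x" "x \<le> u (piece u i x + 1)"
  using assms by (auto simp: piece_def local_knots_def)

lemma zp_jet_swap:
  "zp_jet u v i j (x, y) = (\<lambda>(a, b, c). (a, c, b)) (zp_jet v u j i (y, x))"
  by (auto simp: zp_jet_def cell_jet_swap[of u v] zero_prod_def)

lemma cell_jet_piece:
  assumes k: "local_knots u i" and p: "p \<in> {i - 2, i - 1, i}" and x: "u p \<le> x" "x \<le> u (p + 1)"
    and y: "v q < v (q + 1)" "v q \<le> y" "y \<le> v (q + 1)"
  shows "cell_jet u v i j (piece u i x) q (x, y) = cell_jet u v i j p q (x, y)"
  using piece_cases[OF k p x]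
proof cases
  case 2
  have s: "u (p - 1) < u (p - 1 + 1)" "u (p - 1 + 1) < u (p - 1 + 2)"
    using local_knots_cell[OF k 2(3)] local_knots_cell[OF k p] by (simp_all add: algebra_simps)
  from 2(2) have "piece u i x = p - 1" by simp
  then show ?thesis
    using cell_jet_match_x[OF _ _ _ s y, of i j] k 2(1) by (simp add: local_knots_def)
qed simp

text \<open>The formula is valid on the closed cell, where \<open>piece\<close> may have selected a
  neighbour. The first index is corrected while the second stays with \<open>piece\<close>; an
  exchange of the coordinates then corrects the second.\<close>

lemma zp_jet_cell:
  assumes k: "local_knots u i" "local_knots v j"
    and p: "p \<in> {i - 2, i - 1, i}" and x: "x \<in> {u p..u (p + 1)}"
    and q: "q \<in> {j - 2, j - 1, j}" and y: "y \<in> {v q..v (q + 1)}"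
  shows "zp_jet u v i j (x, y) = cell_jet u v i j p q (x, y)"
proof -
  have xx: "x \<in> {u (i - 2)..u (i + 1)}" and yy: "y \<in> {v (j - 2)..v (j + 1)}"
    using local_knots_cell[OF k(1) p] local_knots_cell[OF k(2) q] x y by auto
  have "zp_jet u v i j (x, y) = cell_jet u v i j (piece u i x) (piece v j y) (x, y)"
    using xx yy by (simp add: zp_jet_def)
  also have "\<dots> = cell_jet u v i j p (piece v j y) (x, y)"
    using x piece_bounds[OF k(2) yy] local_knots_cell[OF k(2) piece_mem]
    by (intro cell_jet_piece k p) auto
  also have "\<dots> = (\<lambda>(a, b, c). (a, c, b)) (cell_jet v u j i (piece v j y) p (y, x))"
    by (rule cell_jet_swap)
  also have "cell_jet v u j i (piece v j y) p (y, x) = cell_jet v u j i q p (y, x)"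
    using x y local_knots_cell[OF k(1) p] by (intro cell_jet_piece k q) auto
  finally show ?thesis by (simp add: cell_jet_swap[of u v])
qed

text \<open>On the outer edges the univariate B-spline has value and slope zero, so the whole jet
  vanishes already on the closed complement. This makes the extension by zero C1.\<close>

lemma zp_jet_outside_x:
  assumes k: "local_knots u i" "local_knots v j" and x: "x \<notin> {u (i - 2)<..<u (i + 1)}"
  shows "zp_jet u v i j (x, y) = 0"
proof (cases "x \<in> {u (i - 2)..u (i + 1)} \<and> y \<in> {v (j - 2)..v (j + 1)}")
  case False
  then show ?thesis by (auto simp: zp_jet_def)
next
  case True
  define q where "q = piece v j y"
  have q: "q \<in> {j - 2, j - 1, j}" "y \<in> {v q..v (q + 1)}"
    using True piece_bounds[OF k(2)] piece_mem unfolding q_def by auto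
  have b: "\<bar>loc v q y\<bar> \<le> 1" using local_knots_cell[OF k(2) q(1)] q(2) by (intro loc_bounds) auto
  have "x = u (i - 2) \<or> x = u (i + 1)" using True x by auto
  then show ?thesis
  proof
    assume x: "x = u (i - 2)"
    have "zp_jet u v i j (x, y) = cell_jet u v i j (i - 2) q (x, y)"
      using k x by (intro zp_jet_cell q) (auto simp: local_knots_def algebra_simps)
    moreover have "loc u (i - 2) x = -1"
      using loc_ends[of u "i - 2"] k x by (auto simp: local_knots_def algebra_simps)
    moreover have "cmid i (i - 2) + 2 * ccur u i (i - 2) - cdif u i (i - 2) = 0"
      "cdif u i (i - 2) - 2 * ccur u i (i - 2) = 0"
      by (simp_all only: coef_ends) (simp_all add: kval_def cmid_def)
    ultimately show ?thesis
      unfolding cell_jet_def prod.case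
      by (simp only: cell_left[OF b] mult_zero_left mult_zero_right zero_prod_def)
  next
    assume x: "x = u (i + 1)"
    have "zp_jet u v i j (x, y) = cell_jet u v i j i q (x, y)"
      using k x by (intro zp_jet_cell q) (auto simp: local_knots_def algebra_simps)
    moreover have "loc u i x = 1"
      using loc_ends[of u "i"] k x by (auto simp: local_knots_def algebra_simps)
    moreover have "cmid i i + 2 * ccur u i i + cdif u i i = 0" "cdif u i i + 2 * ccur u i i = 0"
      by (simp_all only: coef_ends) (simp_all add: kval_def cmid_def)
    ultimately show ?thesis
      unfolding cell_jet_def prod.case
      by (simp only: cell_right[OF b] mult_zero_left mult_zero_right zero_prod_def)
  qed
qed

lemma zp_jet_outside:
  assumes k: "local_knots u i" "local_knots v j"
    and "x \<notin> {u (i - 2)<..<u (i + 1)} \<or> y \<notin> {v (j - 2)<..<v (j + 1)}"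
  shows "zp_jet u v i j (x, y) = 0"
  using assms(3)
proof
  assume "y \<notin> {v (j - 2)<..<v (j + 1)}"
  then show ?thesis using zp_jet_outside_x[OF k(2,1)] by (simp add: zp_jet_swap[of u v] zero_prod_def)
qed (rule zp_jet_outside_x[OF k])

text \<open>Each axis is the union of five closed pieces, two rays and three cells. On each of the
  25 products the jet is either zero or a single cell formula; these are glued along the second axis
  and then along the first.\<close>

lemma jet_on_zp_jet:
  assumes k: "local_knots u i" "local_knots v j"
  shows "jet_on UNIV UNIV (zp_jet u v i j)"
proof -
  let ?J = "zp_jet u v i j"
  let ?P = "\<lambda>u i A. A \<in> {{..u (i - 2)}, {u (i + 1)..}} \<union> (\<lambda>p. {u p..u (p + 1)}) ` {i - 2, i - 1, i :: int}"
  have zero: "jet_on A B (\<lambda>_. 0)" for A B by (simp add: jet_on_def)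
  have 1: "jet_on A B ?J" if A: "?P u i A" and B: "?P v j B" for A B
  proof (cases "A \<in> {{..u (i - 2)}, {u (i + 1)..}} \<or> B \<in> {{..v (j - 2)}, {v (j + 1)..}}")
    case True
    then show ?thesis
      by (intro jet_on_cong[OF zero] zp_jet_outside[OF k]) auto
  next
    case False
    then obtain p q where p: "p \<in> {i - 2, i - 1, i}" "A = {u p..u (p + 1)}"
      and q: "q \<in> {j - 2, j - 1, j}" "B = {v q..v (q + 1)}"
      using A B by blast
    show ?thesis unfolding p(2) q(2)
      by (intro jet_on_cong[OF jet_on_cell_jet[of _ _ u v i j p q]] zp_jet_cell[OF k p(1) _ q(1)])
  qed
  have cl: "closed A" if "?P w l A" for w :: "int \<Rightarrow> real" and l A using that by auto
  have cover: "({..w (l - 2)} \<union> ({w (l - 2)..w (l - 2 + 1)} \<union> ({w (l - 1)..w (l - 1 + 1)} \<union>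
        ({w l..w (l + 1)} \<union> {w (l + 1)..})))) = UNIV" if "local_knots w l" for w :: "int \<Rightarrow> real" and l
    using that by (auto simp: local_knots_def algebra_simps)
  have 2: "jet_on A UNIV ?J" if A: "?P u i A" for A
  proof -
    have "jet_on A ({..v (j - 2)} \<union> ({v (j - 2)..v (j - 2 + 1)} \<union> ({v (j - 1)..v (j - 1 + 1)} \<union>
        ({v j..v (j + 1)} \<union> {v (j + 1)..})))) ?J"
      by (intro jet_on_Un_right closed_Un cl[OF A] 1[OF A]) auto
    then show ?thesis by (simp only: cover[OF k(2)])
  qed
  have "jet_on ({..u (i - 2)} \<union> ({u (i - 2)..u (i - 2 + 1)} \<union> ({u (i - 1)..u (i - 1 + 1)} \<union>
        ({u i..u (i + 1)} \<union> {u (i + 1)..})))) UNIV ?J"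
    by (intro jet_on_Un_left closed_Un closed_UNIV 2) auto
  then show ?thesis by (simp only: cover[OF k(1)])
qed

definition zp :: "(int \<Rightarrow> real) \<Rightarrow> (int \<Rightarrow> real) \<Rightarrow> int \<Rightarrow> int \<Rightarrow> real \<times> real \<Rightarrow> real" where
  "zp u v i j z = fst (zp_jet u v i j z)"

lemma jet_on_imp_Ck1:
  assumes "jet_on UNIV UNIV J"
  shows "Dx UNIV (\<lambda>z. fst (J z)) = (\<lambda>z. fst (snd (J z)))"
    and "Dy UNIV (\<lambda>z. fst (J z)) = (\<lambda>z. snd (snd (J z)))"
    and "Ck 1 UNIV (\<lambda>z. fst (J z))"
proof -
  have x: "((\<lambda>s. fst (J (s, y))) has_field_derivative fst (snd (J (x, y)))) (at x)"
    and y: "((\<lambda>t. fst (J (x, t))) has_field_derivative snd (snd (J (x, y)))) (at y)" for x y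
    using assms by (auto simp: jet_on_def)
  show dx: "Dx UNIV (\<lambda>z. fst (J z)) = (\<lambda>z. fst (snd (J z)))"
    unfolding Dx_def using x
    by (auto intro!: ext vector_derivative_at simp: has_real_derivative_iff_has_vector_derivative)
  show dy: "Dy UNIV (\<lambda>z. fst (J z)) = (\<lambda>z. snd (snd (J z)))"
    unfolding Dy_def using y
    by (auto intro!: ext vector_derivative_at simp: has_real_derivative_iff_has_vector_derivative)
  have x': "(\<lambda>s. fst (J (s, y))) differentiable (at x)"
    and y': "(\<lambda>t. fst (J (x, t))) differentiable (at y)" for x y
    unfolding real_differentiable_def using x y by blast+
  have c: "continuous_on UNIV J" using assms by (simp add: jet_on_def)
  show "Ck 1 UNIV (\<lambda>z. fst (J z))"
    using c x' y' unfolding One_nat_def Ck.simps dx dy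
    by (auto intro!: continuous_intros)
qed

lemma zp_center_value:
  assumes k: "local_knots u i" "local_knots v j"
  shows "zp u v i j (u i, v j) = (u (i + 1) - u i) / (u (i + 1) - u (i - 1)) *
                    ((v (j + 1) - v j) / (v (j + 1) - v (j - 1)))"
proof -
  have "zp_jet u v i j (u i, v j) = cell_jet u v i j i j (u i, v j)"
    using k by (intro zp_jet_cell k) (auto simp: local_knots_def)
  moreover have "loc u i (u i) = -1" "loc v j (v j) = -1"
    using k by (auto simp: local_knots_def intro: loc_ends)
  moreover have "cell_val m d e m' d' e' (-1) (-1) = (m + 2 * e - d) * (m' + 2 * e' - d')" for m d e m' d' e'
    by (subst cell_left) (auto simp: algebra_simps)
  ultimately show ?thesis unfolding zp_def
    by (simp add: cell_jet_def coef_ends) (simp add: kval_def)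
qed

section \<open>Existence and uniqueness of the classical B-splines\<close>

lemma quadratic_on_iff:
  "quadratic_on T f \<longleftrightarrow> (\<exists>a0 a1 a2 a3 a4 a5. \<forall>(x, y)\<in>T.
     f (x, y) = a0 + a1 * x + a2 * y + a3 * (x * x) + a4 * (x * y) + a5 * (y * y))"
proof
  assume "quadratic_on T f"
  then obtain c :: "nat \<Rightarrow> nat \<Rightarrow> real"
    where c: "\<forall>(x, y)\<in>T. f (x, y) = (\<Sum>p\<le>2. \<Sum>q\<le>2 - p. c p q * x ^ p * y ^ q)"
    unfolding quadratic_on_def by blast
  have "\<forall>(x, y)\<in>T. f (x, y) = c 0 0 + c 1 0 * x + c 0 1 * y + c 2 0 * (x * x) + c 1 1 * (x * y) + c 0 2 * (y * y)"
    using c by (auto simp: numeral_2_eq_2 algebra_simps)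
  then show "\<exists>a0 a1 a2 a3 a4 a5. \<forall>(x, y)\<in>T.
     f (x, y) = a0 + a1 * x + a2 * y + a3 * (x * x) + a4 * (x * y) + a5 * (y * y)" by blast
next
  assume "\<exists>a0 a1 a2 a3 a4 a5. \<forall>(x, y)\<in>T.
     f (x, y) = a0 + a1 * x + a2 * y + a3 * (x * x) + a4 * (x * y) + a5 * (y * y)"
  then obtain a0 a1 a2 a3 a4 a5 where a: "\<forall>(x, y)\<in>T.
     f (x, y) = a0 + a1 * x + a2 * y + a3 * (x * x) + a4 * (x * y) + a5 * (y * y)" by blast
  define c where "c p q = (if p = 0 then if q = 0 then a0 else if q = 1 then a2 else a5
     else if p = 1 then if q = 0 then a1 else a4 else a3)" for p q :: nat
  have "\<forall>(x, y)\<in>T. f (x, y) = (\<Sum>p\<le>2. \<Sum>q\<le>2 - p. c p q * x ^ p * y ^ q)"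
    using a by (auto simp: numeral_2_eq_2 c_def algebra_simps)
  then show "quadratic_on T f" unfolding quadratic_on_def by blast
qed

lemma quadratic_on_diff:
  assumes "quadratic_on T f" "quadratic_on T g"
  shows "quadratic_on T (\<lambda>z. f z - g z)"
proof -
  obtain a0 a1 a2 a3 a4 a5 where a: "\<forall>(x, y)\<in>T.
     f (x, y) = a0 + a1 * x + a2 * y + a3 * (x * x) + a4 * (x * y) + a5 * (y * y)"
    using assms(1) unfolding quadratic_on_iff by blast
  obtain b0 b1 b2 b3 b4 b5 where b: "\<forall>(x, y)\<in>T.
     g (x, y) = b0 + b1 * x + b2 * y + b3 * (x * x) + b4 * (x * y) + b5 * (y * y)"
    using assms(2) unfolding quadratic_on_iff by blast
  show ?thesis unfolding quadratic_on_iff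
    apply (rule exI[of _ "a0 - b0"], rule exI[of _ "a1 - b1"], rule exI[of _ "a2 - b2"])
    apply (rule exI[of _ "a3 - b3"], rule exI[of _ "a4 - b4"], rule exI[of _ "a5 - b5"])
    using a b by (force simp: left_diff_distrib)
qed

lemma quadratic_on_affine:
  assumes "\<And>x y. (x, y) \<in> T \<Longrightarrow> f (x, y) = q0 + q1 * (\<alpha> + \<beta> * x) + q2 * (\<gamma> + \<delta> * y)
     + q3 * ((\<alpha> + \<beta> * x) * (\<alpha> + \<beta> * x)) + q4 * ((\<alpha> + \<beta> * x) * (\<gamma> + \<delta> * y)) + q5 * ((\<gamma> + \<delta> * y) * (\<gamma> + \<delta> * y))"
  shows "quadratic_on T f"
  unfolding quadratic_on_iff
  apply (rule exI[of _ "q0 + q1 * \<alpha> + q2 * \<gamma> + q3 * \<alpha> * \<alpha> + q4 * \<alpha> * \<gamma> + q5 * \<gamma> * \<gamma>"])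
  apply (rule exI[of _ "q1 * \<beta> + 2 * q3 * \<alpha> * \<beta> + q4 * \<beta> * \<gamma>"])
  apply (rule exI[of _ "q2 * \<delta> + 2 * q5 * \<gamma> * \<delta> + q4 * \<alpha> * \<delta>"])
  apply (rule exI[of _ "q3 * \<beta> * \<beta>"], rule exI[of _ "q4 * \<beta> * \<delta>"], rule exI[of _ "q5 * \<delta> * \<delta>"])
  using assms by (auto simp: algebra_simps)

lemma affine_nonneg_on_triangle:
  fixes f :: "real \<times> real \<Rightarrow> real"
  assumes f: "\<And>z. f z = a + b * fst z + c * snd z"
    and "z \<in> convex hull {P, Q, R}" "f P \<ge> 0" "f Q \<ge> 0" "f R \<ge> 0"
  shows "f z \<ge> 0"
proof -
  obtain r s t where z: "z = r *\<^sub>R P + s *\<^sub>R Q + t *\<^sub>R R" "0 \<le> r" "0 \<le> s" "0 \<le> t" "r + s + t = 1"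
    using assms(2) unfolding convex_hull_3 by blast
  have "f z = r * f P + s * f Q + t * f R + a * (1 - (r + s + t))"
    unfolding f z(1) by (simp add: algebra_simps)
  then show ?thesis using z assms(3-5) by simp
qed

lemma loc_affine: "loc u p x = loc u p 0 + 2 / (u (p + 1) - u p) * x"
  by (simp add: loc_def diff_divide_distrib add_divide_distrib)

lemma loc_center: "loc u p ((u p + u (p + 1)) / 2) = 0"
proof -
  have "2 * ((a + b) / 2) - a - b = 0" for a b :: real by (simp add: field_simps)
  then show ?thesis by (simp add: loc_def)
qed

text \<open>In local coordinates the diagonals are the zero sets of \<xi> + \<eta> and \<xi> -
  \<eta>, so each triangle lies on one side of both. The absolute values in the cell formula
  therefore resolve with constant signs \<open>s\<close> and \<open>t\<close>.\<close>

lemma triangle_cases: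
  assumes "T \<in> cell_triangles u v p q" "u p < u (p + 1)" "v q < v (q + 1)"
  obtains s t :: real where "s \<in> {1, -1}" "t \<in> {1, -1}"
    "\<And>x y. (x, y) \<in> T \<Longrightarrow> \<bar>loc u p x + loc v q y\<bar> = s * (loc u p x + loc v q y)"
    "\<And>x y. (x, y) \<in> T \<Longrightarrow> \<bar>loc u p x - loc v q y\<bar> = t * (loc u p x - loc v q y)"
    "T \<subseteq> {u p..u (p + 1)} \<times> {v q..v (q + 1)}"
proof -
  define Z where "Z = ((u p + u (p + 1)) / 2, (v q + v (q + 1)) / 2)"
  have lZ: "loc u p (fst Z) = 0" "loc v q (snd Z) = 0" by (simp_all only: Z_def fst_conv snd_conv loc_center)
  note l = lZ loc_ends[OF assms(2)] loc_ends[OF assms(3)]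
  define L where "L = (\<lambda>(s, t) z. s * loc u p (fst z) + t * loc v q (snd z))"
  have aff: "L st z = (fst st * loc u p 0 + snd st * loc v q 0) + (fst st * (2 / (u (p + 1) - u p))) * fst z
      + (snd st * (2 / (v (q + 1) - v q))) * snd z" for st z
    unfolding L_def case_prod_beta 
    by (subst loc_affine[of _ _ "fst z"], subst loc_affine[of _ _ "snd z"]) (simp add: algebra_simps)
  have pos: "L st z \<ge> 0" if "z \<in> convex hull {P, Q, R}" "L st P \<ge> 0" "L st Q \<ge> 0" "L st R \<ge> 0" for z P Q R st
    by (rule affine_nonneg_on_triangle[OF aff that])
  let ?K = "{u p..u (p + 1)} \<times> {v q..v (q + 1)}"
  have K: "convex hull {P, Q, R} \<subseteq> ?K" if "P \<in> ?K" "Q \<in> ?K" "R \<in> ?K" for P Q R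
    by (rule hull_minimal) (use that in \<open>auto intro!: convex_Times\<close>)
  have "Z \<in> ?K" using assms by (auto simp: Z_def)
  then have "S \<subseteq> ?K" if "S \<in> cell_triangles u v p q" for S
    using assms(2,3) that unfolding cell_triangles_def Let_def Z_def[symmetric]
    by (elim insertE emptyE; hypsubst; intro K) auto
  then have KT: "T \<subseteq> ?K" using assms(1) by blast
  consider "T = convex hull {(u p, v q), (u (p + 1), v q), Z}"
    | "T = convex hull {(u (p + 1), v q), (u (p + 1), v (q + 1)), Z}"
    | "T = convex hull {(u (p + 1), v (q + 1)), (u p, v (q + 1)), Z}"
    | "T = convex hull {(u p, v (q + 1)), (u p, v q), Z}"
    using assms(1) unfolding cell_triangles_def Let_def Z_def[symmetric] by blast
  \<comment> \<open>An affine function nonnegative at the three vertices is nonnegative on the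
    triangle. \<open>s\<close> is the sign of \<xi> + \<eta> and \<open>t\<close> the sign of \<xi>
    - \<eta>.\<close>
  then have "\<exists>s\<in>{1,-1}. \<exists>t\<in>{1,-1}. \<forall>z\<in>T. L (s, s) z \<ge> 0 \<and> L (t, -t) z \<ge> 0"
  proof cases
    case 1
    have "\<forall>z\<in>T. L (-1, -1) z \<ge> 0 \<and> L (1, -1) z \<ge> 0"
      unfolding 1 by (intro ballI conjI; erule pos) (simp_all add: L_def l)
    then show ?thesis by force
  next
    case 2
    have "\<forall>z\<in>T. L (1, 1) z \<ge> 0 \<and> L (1, -1) z \<ge> 0"
      unfolding 2 by (intro ballI conjI; erule pos) (simp_all add: L_def l)
    then show ?thesis by force
  next
    case 3
    have "\<forall>z\<in>T. L (1, 1) z \<ge> 0 \<and> L (-1, 1) z \<ge> 0"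
      unfolding 3 by (intro ballI conjI; erule pos) (simp_all add: L_def l)
    then show ?thesis by force
  next
    case 4
    have "\<forall>z\<in>T. L (-1, -1) z \<ge> 0 \<and> L (-1, 1) z \<ge> 0"
      unfolding 4 by (intro ballI conjI; erule pos) (simp_all add: L_def l)
    then show ?thesis by force
  qed
  then obtain s t where st: "s \<in> {1, -1}" "t \<in> {1, -1}"
    "\<forall>z\<in>T. L (s, s) z \<ge> 0 \<and> L (t, -t) z \<ge> 0" by blast
  show ?thesis
  proof (rule that[OF st(1,2) _ _ KT])
    fix x y assume "(x, y) \<in> T"
    then have "L (s, s) (x, y) \<ge> 0" "L (t, -t) (x, y) \<ge> 0" using st by auto
    then show "\<bar>loc u p x + loc v q y\<bar> = s * (loc u p x + loc v q y)"
      "\<bar>loc u p x - loc v q y\<bar> = t * (loc u p x - loc v q y)"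
      using st(1,2) by (auto simp: L_def)
  qed
qed

lemma quadratic_on_cell_val:
  assumes "T \<in> cell_triangles u v p q" "u p < u (p + 1)" "v q < v (q + 1)"
  shows "quadratic_on T (\<lambda>(x, y). cell_val m d e m' d' e' (loc u p x) (loc v q y))"
proof -
  obtain s t where st:
    "\<And>x y. (x, y) \<in> T \<Longrightarrow> \<bar>loc u p x + loc v q y\<bar> = s * (loc u p x + loc v q y)"
    "\<And>x y. (x, y) \<in> T \<Longrightarrow> \<bar>loc u p x - loc v q y\<bar> = t * (loc u p x - loc v q y)"
    using triangle_cases[OF assms] by metis
  have lx: "loc u p 0 + 2 / (u (p + 1) - u p) * x = loc u p x" for x by (rule loc_affine[symmetric])
  have ly: "loc v q 0 + 2 / (v (q + 1) - v q) * x = loc v q x" for x by (rule loc_affine[symmetric])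
  show ?thesis
  \<comment> \<open>With resolved signs the products with absolute values become \<open>s\<close>
    times the square of \<xi> + \<eta> and \<open>t\<close> times the square of \<xi> - \<eta>. The
    arguments are the resulting coefficients in \<xi> and \<eta>, mixed with the affine data of the
    two maps \<open>loc\<close>.\<close>
  proof (rule quadratic_on_affine[of _ _ "m * m' + e * m' + m * e'" "d * m'" "loc u p 0"
          "2 / (u (p + 1) - u p)" "m * d'" "loc v q 0" "2 / (v (q + 1) - v q)"
          "e * (m' + 2 * e') + e * d' * (s - t) / 2 + d * e' * (s + t) / 2"
          "d * d' + e * d' * (s + t) + d * e' * (s - t)"
          "(m + 2 * e) * e' + e * d' * (s - t) / 2 + d * e' * (s + t) / 2"], unfold prod.case lx ly)
    fix x y assume "(x, y) \<in> T"
    note st' = st[OF this]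
    show "cell_val m d e m' d' e' (loc u p x) (loc v q y) =
      m * m' + e * m' + m * e' + d * m' * loc u p x + m * d' * loc v q y
      + (e * (m' + 2 * e') + e * d' * (s - t) / 2 + d * e' * (s + t) / 2) * (loc u p x * loc u p x)
      + (d * d' + e * d' * (s + t) + d * e' * (s - t)) * (loc u p x * loc v q y)
      + ((m + 2 * e) * e' + e * d' * (s - t) / 2 + d * e' * (s + t) / 2) * (loc v q y * loc v q y)"
      unfolding cell_val_def st' by (simp add: field_simps)
  qed
qed

section \<open>The octagonal support\<close>

lemma rectangle_subset_convex:
  fixes a b c d :: real
  assumes K: "convex K" and "(a, c) \<in> K" "(b, c) \<in> K" "(a, d) \<in> K" "(b, d) \<in> K"
  shows "{a..b} \<times> {c..d} \<subseteq> K"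
proof clarify
  fix x y assume x: "x \<in> {a..b}" and y: "y \<in> {c..d}"
  have between: "\<exists>r\<in>{0..1}. t = p + r * (q - p)" if "t \<in> {p..q}" for t p q :: real
  proof (cases "p = q")
    case False
    then show ?thesis using that by (intro bexI[of _ "(t - p) / (q - p)"]) auto
  qed (use that in \<open>auto intro!: bexI[of _ 0]\<close>)
  obtain r where r: "r \<in> {0..1}" "x = a + r * (b - a)" using between[OF x] by blast
  obtain s where s: "s \<in> {0..1}" "y = c + s * (d - c)" using between[OF y] by blast
  have h: "(x, w) \<in> K" if "(a, w) \<in> K" "(b, w) \<in> K" for w
  proof -
    have "(1 - r) *\<^sub>R (a, w) + r *\<^sub>R (b, w) \<in> K"
      using r(1) by (intro convexD[OF K that]) auto
    moreover have "(1 - r) * a + r * b = x" "(1 - r) * w + r * w = w"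
      using r(2) by (simp_all add: algebra_simps)
    ultimately show ?thesis by simp
  qed
  have "(1 - s) *\<^sub>R (x, c) + s *\<^sub>R (x, d) \<in> K"
    using s(1) h assms by (intro convexD[OF K]) auto
  moreover have "(1 - s) * c + s * d = y" "(1 - s) * x + s * x = x"
    using s(2) by (simp_all add: algebra_simps)
  ultimately show "(x, y) \<in> K" by simp
qed

text \<open>The numbers \<open>1 - s\<close>, \<open>1 - t\<close>, \<open>s + t - 1\<close> are
  barycentric coordinates of the point with respect to three corners of a cell;
  \<open>s + t \<ge> 1\<close> selects the half cut off by a diagonal.\<close>

lemma corner_subset_convex:
  fixes a c a' c' :: real
  assumes K: "convex K" and "(a, c') \<in> K" "(a', c) \<in> K" "(a', c') \<in> K"
    and "s \<le> 1" "t \<le> 1" "s + t \<ge> 1"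
    and "x = a + s * (a' - a)" "y = c + t * (c' - c)"
  shows "(x, y) \<in> K"
proof -
  have "(1 - s) *\<^sub>R (a, c') + (1 - t) *\<^sub>R (a', c) + (s + t - 1) *\<^sub>R (a', c') \<in> convex hull {(a, c'), (a', c), (a', c')}"
    unfolding convex_hull_3 using assms(5-7) by force
  also have "\<dots> \<subseteq> K" using assms(2-4) by (intro hull_minimal K) auto
  also have "(1 - s) *\<^sub>R (a, c') + (1 - t) *\<^sub>R (a', c) + (s + t - 1) *\<^sub>R (a', c') = (x, y)"
    using assms(8,9) by (simp add: algebra_simps)
  finally show ?thesis .
qed

lemma loc_inverse:
  assumes "u p < u (p + 1)"
  shows "x = u p + (1 + loc u p x) / 2 * (u (p + 1) - u p)"
    and "x = u (p + 1) + (1 - loc u p x) / 2 * (u p - u (p + 1))"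
proof -
  have general: "x = a + (1 + l) / 2 * (b - a) \<and> x = b + (1 - l) / 2 * (a - b)"
    if "l * (b - a) = 2 * x - a - b" for a b l :: real
  proof -
    have "(1 + l) / 2 * (b - a) = ((b - a) + l * (b - a)) / 2"
      "(1 - l) / 2 * (a - b) = ((a - b) + l * (b - a)) / 2" by (simp_all add: field_simps)
    then show ?thesis unfolding that by (simp add: diff_divide_distrib)
  qed
  have "loc u p x * (u (p + 1) - u p) = 2 * x - u p - u (p + 1)" using assms by (simp add: loc_def)
  from general[OF this] show "x = u p + (1 + loc u p x) / 2 * (u (p + 1) - u p)"
    "x = u (p + 1) + (1 - loc u p x) / 2 * (u p - u (p + 1))" by blast+
qed

text \<open>These are the coefficient patterns of the four corner cells of the block. Each
  expression is a one-sided square that vanishes on the outer side of a diagonal, which trims the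
  block to an octagon.\<close>

lemma cell_val_corner:
  "cell_val 0 (2 * e) e 0 (2 * e') e' \<xi> \<eta> = 2 * e * e' * ((\<xi> + \<eta>) * (\<xi> + \<eta> + \<bar>\<xi> + \<eta>\<bar>))"
  "cell_val 0 (- (2 * e)) e 0 (- (2 * e')) e' \<xi> \<eta> = 2 * e * e' * ((\<xi> + \<eta>) * (\<xi> + \<eta> - \<bar>\<xi> + \<eta>\<bar>))"
  "cell_val 0 (2 * e) e 0 (- (2 * e')) e' \<xi> \<eta> = 2 * e * e' * ((\<xi> - \<eta>) * (\<xi> - \<eta> + \<bar>\<xi> - \<eta>\<bar>))"
  "cell_val 0 (- (2 * e)) e 0 (2 * e') e' \<xi> \<eta> = 2 * e * e' * ((\<xi> - \<eta>) * (\<xi> - \<eta> - \<bar>\<xi> - \<eta>\<bar>))"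
  unfolding cell_val_def by (simp_all add: field_simps)

lemma coef_outer:
  "cmid i (i - 2) = 0" "cdif u i (i - 2) = 2 * ccur u i (i - 2)"
  "cmid i i = 0" "cdif u i i = - (2 * ccur u i i)"
proof -
  have "kval u i (i - 2) = 0" "kval u i (i + 1) = 0" by (simp_all add: kval_def)
  then show "cmid i (i - 2) = 0" "cdif u i (i - 2) = 2 * ccur u i (i - 2)"
    "cmid i i = 0" "cdif u i i = - (2 * ccur u i i)"
    by (simp_all add: cmid_def cdif_def ccur_def)
qed

lemma octagon_subsets:
  shows "convex (octagon u v i j)"
    and "{u (i - 1)..u i} \<times> {v (j - 2)..v (j + 1)} \<subseteq> octagon u v i j"
    and "{u (i - 2)..u (i + 1)} \<times> {v (j - 1)..v j} \<subseteq> octagon u v i j"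
proof -
  show c: "convex (octagon u v i j)" by (simp add: octagon_def)
  show "{u (i - 1)..u i} \<times> {v (j - 2)..v (j + 1)} \<subseteq> octagon u v i j"
    by (rule rectangle_subset_convex[OF c]; unfold octagon_def; rule hull_inc; blast)
  show "{u (i - 2)..u (i + 1)} \<times> {v (j - 1)..v j} \<subseteq> octagon u v i j"
    by (rule rectangle_subset_convex[OF c]; unfold octagon_def; rule hull_inc; blast)
qed

text \<open>The middle row and the middle column of the block lie in the octagon. In a corner cell a
  nonzero value forces the point beyond the diagonal, into the triangle spanned by three corners
  that belong to the octagon.\<close>

lemma zp_outside_octagon:
  assumes k: "local_knots u i" "local_knots v j" and z: "(x, y) \<notin> octagon u v i j"
  shows "zp u v i j (x, y) = 0"
proof (rule ccontr)
  assume nz: "zp u v i j (x, y) \<noteq> 0"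
  let ?K = "octagon u v i j"
  define p where "p = piece u i x"
  define q where "q = piece v j y"
  have x: "x \<in> {u (i - 2)..u (i + 1)}" and y: "y \<in> {v (j - 2)..v (j + 1)}"
    using nz zp_jet_outside[OF k, of x y] unfolding zp_def by force+
  have p: "p \<in> {i - 2, i - 1, i}" and q: "q \<in> {j - 2, j - 1, j}"
    unfolding p_def q_def by (rule piece_mem)+
  have xp: "u p \<le> x" "x \<le> u (p + 1)" and yq: "v q \<le> y" "y \<le> v (q + 1)"
    unfolding p_def q_def using piece_bounds[OF k(1) x] piece_bounds[OF k(2) y] by auto
  have up: "u p < u (p + 1)" and vq: "v q < v (q + 1)"
    using local_knots_cell[OF k(1) p] local_knots_cell[OF k(2) q] by auto
  have "(x, y) \<notin> {u (i - 1)..u i} \<times> {v (j - 2)..v (j + 1)}"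
    "(x, y) \<notin> {u (i - 2)..u (i + 1)} \<times> {v (j - 1)..v j}"
    using octagon_subsets(2,3) z by blast+
  then have "p \<noteq> i - 1" "q \<noteq> j - 1" using xp yq x y by auto
  then have pq: "p = i - 2 \<or> p = i" "q = j - 2 \<or> q = j" using p q by auto
  define \<xi> where "\<xi> = loc u p x"
  define \<eta> where "\<eta> = loc v q y"
  have b: "\<bar>\<xi>\<bar> \<le> 1" "\<bar>\<eta>\<bar> \<le> 1"
    unfolding \<xi>_def \<eta>_def using up vq xp yq by (auto intro!: loc_bounds)
  have val: "cell_val (cmid i p) (cdif u i p) (ccur u i p) (cmid j q) (cdif v j q) (ccur v j q) \<xi> \<eta> \<noteq> 0"
    using nz zp_jet_cell[OF k p _ q, of x y] xp yq
    unfolding zp_def \<xi>_def \<eta>_def by (simp add: cell_jet_def)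
  have inner: "(a, c) \<in> ?K" if "a = u (i - 1) \<or> a = u i" "c \<in> {v (j - 2), v (j - 1), v j, v (j + 1)}" for a c
    by (rule octagon_subsets(2)[THEN subsetD]) (use that k in \<open>auto simp: local_knots_def\<close>)
  have inner': "(a, c) \<in> ?K" if "a \<in> {u (i - 2), u (i + 1)}" "c = v (j - 1) \<or> c = v j" for a c
    by (rule octagon_subsets(3)[THEN subsetD]) (use that k in \<open>auto simp: local_knots_def\<close>)
  note lx = loc_inverse[of u p x, OF up, folded \<xi>_def]
  note ly = loc_inverse[of v q y, OF vq, folded \<eta>_def]
  have "(x, y) \<in> ?K"
    using pq
  proof (elim disjE)
    assume pq: "p = i - 2" "q = j - 2"
    then have "\<xi> + \<eta> > 0" using val by (auto simp: coef_outer cell_val_corner)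
    then show ?thesis
      using b pq
      by (intro corner_subset_convex[OF octagon_subsets(1) _ _ _ _ _ _ lx(1) ly(1)] inner inner')
         (auto simp: add_divide_distrib diff_divide_distrib)
  next
    assume pq: "p = i" "q = j"
    then have "\<xi> + \<eta> < 0" using val by (auto simp: coef_outer cell_val_corner)
    then show ?thesis
      using b pq
      by (intro corner_subset_convex[OF octagon_subsets(1) _ _ _ _ _ _ lx(2) ly(2)] inner inner')
         (auto simp: add_divide_distrib diff_divide_distrib)
  next
    assume pq: "p = i - 2" "q = j"
    then have "\<xi> - \<eta> > 0" using val by (auto simp: coef_outer cell_val_corner)
    then show ?thesis
      using b pq
      by (intro corner_subset_convex[OF octagon_subsets(1) _ _ _ _ _ _ lx(1) ly(2)] inner inner')
         (auto simp: add_divide_distrib diff_divide_distrib)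
  next
    assume pq: "p = i" "q = j - 2"
    then have "\<xi> - \<eta> < 0" using val by (auto simp: coef_outer cell_val_corner)
    then show ?thesis
      using b pq
      by (intro corner_subset_convex[OF octagon_subsets(1) _ _ _ _ _ _ lx(2) ly(1)] inner inner')
         (auto simp: add_divide_distrib diff_divide_distrib)
  qed
  then show False using z by simp
qed

lemma knots_local:
  assumes "knots m u" "i \<in> {0..m + 1}"
  shows "local_knots u i"
  using assms unfolding knots_def local_knots_def strict_mono_on_def by auto

lemma knots_less:
  assumes "knots m u" "p \<in> {-2..m + 1}"
  shows "u p < u (p + 1)"
  using assms unfolding knots_def strict_mono_on_def by auto

lemma knots_le:
  assumes "knots m u" "p \<in> {-2..m + 2}" "q \<in> {-2..m + 2}" "p \<le> q"
  shows "u p \<le> u q"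
  using assms unfolding knots_def strict_mono_on_def by (cases "p = q") (auto intro: less_imp_le)

lemma zp_jet_any_cell:
  assumes K: "knots m u" "knots n v" and ij: "i \<in> {0..m + 1}" "j \<in> {0..n + 1}"
    and pq: "p \<in> {-2..m + 1}" "q \<in> {-2..n + 1}"
    and xy: "x \<in> {u p..u (p + 1)}" "y \<in> {v q..v (q + 1)}"
  shows "zp_jet u v i j (x, y) = cell_jet u v i j p q (x, y)"
proof (cases "p \<in> {i - 2, i - 1, i} \<and> q \<in> {j - 2, j - 1, j}")
  case True
  then show ?thesis
    using xy by (intro zp_jet_cell knots_local[OF K(1) ij(1)] knots_local[OF K(2) ij(2)]) auto
next
  case False
  have "zp_jet u v i j (x, y) = 0"
  proof (rule zp_jet_outside[OF knots_local[OF K(1) ij(1)] knots_local[OF K(2) ij(2)]])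
    consider "p + 1 \<le> i - 2" | "p \<ge> i + 1" | "q + 1 \<le> j - 2" | "q \<ge> j + 1" using False by force
    then show "x \<notin> {u (i - 2)<..<u (i + 1)} \<or> y \<notin> {v (j - 2)<..<v (j + 1)}"
    proof cases
      case 1
      then have "u (p + 1) \<le> u (i - 2)" using ij pq by (intro knots_le[OF K(1)]) auto
      then show ?thesis using xy by auto
    next
      case 2
      then have "u (i + 1) \<le> u p" using ij pq by (intro knots_le[OF K(1)]) auto
      then show ?thesis using xy by auto
    next
      case 3
      then have "v (q + 1) \<le> v (j - 2)" using ij pq by (intro knots_le[OF K(2)]) auto
      then show ?thesis using xy by auto
    next
      case 4
      then have "v (j + 1) \<le> v q" using ij pq by (intro knots_le[OF K(2)]) auto
      then show ?thesis using xy by auto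
    qed
  qed
  moreover have "cell_jet u v i j p q (x, y) = 0" using False by (intro cell_jet_zero) auto
  ultimately show ?thesis by simp
qed

lemma zp_cell_triangle:
  assumes K: "knots m u" "knots n v" and ij: "i \<in> {0..m + 1}" "j \<in> {0..n + 1}"
    and pq: "p \<in> {-2..m + 1}" "q \<in> {-2..n + 1}" and T: "T \<in> cell_triangles u v p q"
  shows "quadratic_on T (zp u v i j)"
proof -
  note c = knots_less[OF K(1) pq(1)] knots_less[OF K(2) pq(2)]
  have "zp u v i j (x, y) = cell_val (cmid i p) (cdif u i p) (ccur u i p) (cmid j q) (cdif v j q) (ccur v j q)
      (loc u p x) (loc v q y)" if "(x, y) \<in> T" for x y
  proof -
    have "T \<subseteq> {u p..u (p + 1)} \<times> {v q..v (q + 1)}"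
      using triangle_cases[OF T c] by metis
    then have "zp_jet u v i j (x, y) = cell_jet u v i j p q (x, y)"
      using that by (intro zp_jet_any_cell[OF K ij pq]) auto
    then show ?thesis by (simp add: zp_def cell_jet_def)
  qed
  then show ?thesis
    using quadratic_on_cell_val[OF T c, of "cmid i p" "cdif u i p" "ccur u i p" "cmid j q" "cdif v j q" "ccur v j q"]
    unfolding quadratic_on_def by fastforce
qed

lemma is_classical_bspline_zp:
  assumes K: "knots m u" "knots n v" and ij: "i \<in> {0..m + 1}" "j \<in> {0..n + 1}"
  shows "is_classical_bspline m u n v i j (zp u v i j)"
proof -
  note k = knots_local[OF K(1) ij(1)] knots_local[OF K(2) ij(2)]
  have "Ck 1 UNIV (zp u v i j)"
    using jet_on_imp_Ck1(3)[OF jet_on_zp_jet[OF k]] by (simp add: zp_def[abs_def])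
  then show ?thesis
    unfolding is_classical_bspline_def
    using zp_cell_triangle[OF K ij] zp_outside_octagon[OF k] zp_center_value[OF k] by auto
qed

section \<open>Uniqueness by propagation of zeros\<close>

lemma Ck_1_UNIV:
  assumes "Ck 1 UNIV E"
  shows "continuous_on UNIV E" "continuous_on UNIV (Dx UNIV E)" "continuous_on UNIV (Dy UNIV E)"
    and "((\<lambda>s. E (s, y)) has_field_derivative Dx UNIV E (x, y)) (at x)"
    and "((\<lambda>t. E (x, t)) has_field_derivative Dy UNIV E (x, y)) (at y)"
proof -
  show "continuous_on UNIV E" "continuous_on UNIV (Dx UNIV E)" "continuous_on UNIV (Dy UNIV E)"
    using assms by simp_all
  have "(\<lambda>s. E (s, y)) differentiable (at x)" "(\<lambda>t. E (x, t)) differentiable (at y)"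
    using assms by simp_all
  then show "((\<lambda>s. E (s, y)) has_field_derivative Dx UNIV E (x, y)) (at x)"
    "((\<lambda>t. E (x, t)) has_field_derivative Dy UNIV E (x, y)) (at y)"
    by (simp_all add: Dx_def Dy_def has_real_derivative_iff_has_vector_derivative
        vector_derivative_works)
qed

lemma Ck_1_UNIV_diff:
  assumes f: "Ck 1 UNIV f" and g: "Ck 1 UNIV g"
  shows "Ck 1 UNIV (\<lambda>z. f z - g z)"
proof -
  have x: "((\<lambda>s. f (s, y) - g (s, y)) has_field_derivative Dx UNIV f (x, y) - Dx UNIV g (x, y)) (at x)"
    and y: "((\<lambda>t. f (x, t) - g (x, t)) has_field_derivative Dy UNIV f (x, y) - Dy UNIV g (x, y)) (at y)" for x y
    by (intro DERIV_diff Ck_1_UNIV f g)+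
  have dx: "Dx UNIV (\<lambda>z. f z - g z) = (\<lambda>z. Dx UNIV f z - Dx UNIV g z)"
    by (rule ext, simp add: Dx_def[of _ "\<lambda>z. f z - g z"] split: prod.split)
       (auto intro!: vector_derivative_at x[unfolded has_real_derivative_iff_has_vector_derivative])
  have dy: "Dy UNIV (\<lambda>z. f z - g z) = (\<lambda>z. Dy UNIV f z - Dy UNIV g z)"
    by (rule ext, simp add: Dy_def[of _ "\<lambda>z. f z - g z"] split: prod.split)
       (auto intro!: vector_derivative_at y[unfolded has_real_derivative_iff_has_vector_derivative])
  have x': "(\<lambda>s. f (s, y) - g (s, y)) differentiable (at x)"
    and y': "(\<lambda>t. f (x, t) - g (x, t)) differentiable (at y)" for x y
    unfolding real_differentiable_def using x y by blast+
  show ?thesis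
    using x' y' Ck_1_UNIV(1-3)[OF f] Ck_1_UNIV(1-3)[OF g]
    unfolding One_nat_def Ck.simps dx dy by (auto intro!: continuous_intros)
qed

text \<open>At interior points uniqueness of derivatives applies. At a boundary point a coordinate
  line may leave \<open>T\<close> at once, so there the formula comes from continuity of the partial
  derivatives and density of the interior.\<close>

lemma gradient_of_quadratic:
  assumes E: "Ck 1 UNIV E" and T: "convex T" "interior T \<noteq> {}"
    and p: "\<And>x y. (x, y) \<in> T \<Longrightarrow> E (x, y) = a0 + a1 * x + a2 * y + a3 * (x * x) + a4 * (x * y) + a5 * (y * y)"
    and z: "(x, y) \<in> T"
  shows "Dx UNIV E (x, y) = a1 + 2 * a3 * x + a4 * y" "Dy UNIV E (x, y) = a2 + a4 * x + 2 * a5 * y"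
proof -
  define dx where "dx = (\<lambda>z. Dx UNIV E z - (a1 + 2 * a3 * fst z + a4 * snd z))"
  define dy where "dy = (\<lambda>z. Dy UNIV E z - (a2 + a4 * fst z + 2 * a5 * snd z))"
  have int: "dx (x, y) = 0 \<and> dy (x, y) = 0" if xy: "(x, y) \<in> interior T" for x y
  proof -
    have o: "open {s. (s, y) \<in> interior T}" "open {t. (x, t) \<in> interior T}"
      using open_vimage[OF open_interior, of "\<lambda>s. (s, y)" T] open_vimage[OF open_interior, of "\<lambda>t. (x, t)" T]
      by (simp_all add: vimage_def continuous_on_Pair)
    have "((\<lambda>s. a0 + a1 * s + a2 * y + a3 * (s * s) + a4 * (s * y) + a5 * (y * y)) has_field_derivative Dx UNIV E (x, y)) (at x)"
      by (rule has_field_derivative_transform_within_open[OF Ck_1_UNIV(4)[OF E] o(1)])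
         (use xy p interior_subset in auto)
    moreover have "((\<lambda>s. a0 + a1 * s + a2 * y + a3 * (s * s) + a4 * (s * y) + a5 * (y * y)) has_field_derivative
        a1 + 2 * a3 * x + a4 * y) (at x)"
      by (auto intro!: derivative_eq_intros)
    ultimately have "dx (x, y) = 0" using DERIV_unique by (fastforce simp: dx_def)
    have "((\<lambda>t. a0 + a1 * x + a2 * t + a3 * (x * x) + a4 * (x * t) + a5 * (t * t)) has_field_derivative Dy UNIV E (x, y)) (at y)"
      by (rule has_field_derivative_transform_within_open[OF Ck_1_UNIV(5)[OF E] o(2)])
         (use xy p interior_subset in auto)
    moreover have "((\<lambda>t. a0 + a1 * x + a2 * t + a3 * (x * x) + a4 * (x * t) + a5 * (t * t)) has_field_derivative
        a2 + a4 * x + 2 * a5 * y) (at y)"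
      by (auto intro!: derivative_eq_intros)
    ultimately have "dy (x, y) = 0" using DERIV_unique by (fastforce simp: dy_def)
    with \<open>dx (x, y) = 0\<close> show ?thesis by simp
  qed
  have c: "continuous_on UNIV dx" "continuous_on UNIV dy"
    unfolding dx_def dy_def by (intro continuous_intros Ck_1_UNIV E)+
  have zc: "(x, y) \<in> closure (interior T)"
    using convex_closure_interior[OF T] z closure_subset by blast
  have "dx (x, y) = 0" "dy (x, y) = 0"
    by (rule continuous_constant_on_closure[OF _ _ zc];
        use int c continuous_on_subset in \<open>force split: prod.splits\<close>)+
  then show "Dx UNIV E (x, y) = a1 + 2 * a3 * x + a4 * y" "Dy UNIV E (x, y) = a2 + a4 * x + 2 * a5 * y"
    by (simp_all add: dx_def dy_def)
qed

lemma triangle_interior_nonempty: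
  fixes P Q R :: "real \<times> real"
  assumes "(fst Q - fst P) * (snd R - snd P) \<noteq> (snd Q - snd P) * (fst R - fst P)"
  shows "interior (convex hull {P, Q, R}) \<noteq> {}"
proof -
  have "\<not> collinear {P, Q, R}"
  proof
    assume "collinear {P, Q, R}"
    then obtain w where w: "\<forall>x\<in>{P, Q, R}. \<forall>y\<in>{P, Q, R}. \<exists>c. x - y = c *\<^sub>R w"
      unfolding collinear_def by blast
    then obtain c d where "Q - P = c *\<^sub>R w" "R - P = d *\<^sub>R w" by blast
    then have "fst Q - fst P = c * fst w" "snd Q - snd P = c * snd w"
      "fst R - fst P = d * fst w" "snd R - snd P = d * snd w"
      by (metis fst_diff fst_scaleR real_scaleR_def, metis snd_diff snd_scaleR real_scaleR_def,
          metis fst_diff fst_scaleR real_scaleR_def, metis snd_diff snd_scaleR real_scaleR_def)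
    then show False using assms by simp
  qed
  from interior_convex_hull_3_minimal[OF this]
  have "(1/3) *\<^sub>R P + (1/3) *\<^sub>R Q + (1/3) *\<^sub>R R \<in> interior (convex hull {P, Q, R})"
    by simp (rule exI[of _ "1/3"], simp, rule exI[of _ "1/3"], simp, rule exI[of _ "1/3"], simp)
  then show ?thesis by blast
qed

lemma quadratic_triangle_jet:
  assumes E: "Ck 1 UNIV E" and q: "quadratic_on (convex hull {P, Q, R}) E"
    and nd: "(fst Q - fst P) * (snd R - snd P) \<noteq> (snd Q - snd P) * (fst R - fst P)"
  obtains a0 a1 a2 a3 a4 a5 where
    "\<And>x y. (x, y) \<in> convex hull {P, Q, R} \<Longrightarrow>
       E (x, y) = a0 + a1 * x + a2 * y + a3 * (x * x) + a4 * (x * y) + a5 * (y * y) \<and>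
       Dx UNIV E (x, y) = a1 + 2 * a3 * x + a4 * y \<and> Dy UNIV E (x, y) = a2 + a4 * x + 2 * a5 * y"
proof -
  obtain a0 a1 a2 a3 a4 a5 where a: "\<forall>(x, y)\<in>convex hull {P, Q, R}.
     E (x, y) = a0 + a1 * x + a2 * y + a3 * (x * x) + a4 * (x * y) + a5 * (y * y)"
    using q unfolding quadratic_on_iff by blast
  then have a': "E (x, y) = a0 + a1 * x + a2 * y + a3 * (x * x) + a4 * (x * y) + a5 * (y * y)"
    if "(x, y) \<in> convex hull {P, Q, R}" for x y using that by blast
  show ?thesis
    using a' gradient_of_quadratic[OF E convex_convex_hull triangle_interior_nonempty[OF nd] a']
    by (intro that[of a0 a1 a2 a3 a4 a5]) blast
qed

text \<open>Along the edge the derivative is linear, so the trapezoidal rule integrates it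
  exactly.\<close>

lemma edge_identity_x:
  assumes E: "Ck 1 UNIV E" and q: "quadratic_on (convex hull {(x0, y0), (x1, y0), R}) E"
    and nd: "x0 \<noteq> x1" "snd R \<noteq> y0"
  shows "2 * (E (x1, y0) - E (x0, y0)) = (x1 - x0) * (Dx UNIV E (x0, y0) + Dx UNIV E (x1, y0))"
proof -
  obtain a0 a1 a2 a3 a4 a5 where a:
    "\<And>x y. (x, y) \<in> convex hull {(x0, y0), (x1, y0), R} \<Longrightarrow>
       E (x, y) = a0 + a1 * x + a2 * y + a3 * (x * x) + a4 * (x * y) + a5 * (y * y) \<and>
       Dx UNIV E (x, y) = a1 + 2 * a3 * x + a4 * y \<and> Dy UNIV E (x, y) = a2 + a4 * x + 2 * a5 * y"
    by (rule quadratic_triangle_jet[OF E q]) (use nd in auto)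
  have "(x0, y0) \<in> convex hull {(x0, y0), (x1, y0), R}" "(x1, y0) \<in> convex hull {(x0, y0), (x1, y0), R}"
    by (simp_all add: hull_inc)
  from this[THEN a] show ?thesis by (simp add: algebra_simps)
qed

lemma edge_identity_y:
  assumes E: "Ck 1 UNIV E" and q: "quadratic_on (convex hull {(x0, y0), (x0, y1), R}) E"
    and nd: "y0 \<noteq> y1" "fst R \<noteq> x0"
  shows "2 * (E (x0, y1) - E (x0, y0)) = (y1 - y0) * (Dy UNIV E (x0, y0) + Dy UNIV E (x0, y1))"
proof -
  obtain a0 a1 a2 a3 a4 a5 where a:
    "\<And>x y. (x, y) \<in> convex hull {(x0, y0), (x0, y1), R} \<Longrightarrow>
       E (x, y) = a0 + a1 * x + a2 * y + a3 * (x * x) + a4 * (x * y) + a5 * (y * y) \<and>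
       Dx UNIV E (x, y) = a1 + 2 * a3 * x + a4 * y \<and> Dy UNIV E (x, y) = a2 + a4 * x + 2 * a5 * y"
    by (rule quadratic_triangle_jet[OF E q]) (use nd in auto)
  have "(x0, y0) \<in> convex hull {(x0, y0), (x0, y1), R}" "(x0, y1) \<in> convex hull {(x0, y0), (x0, y1), R}"
    by (simp_all add: hull_inc)
  from this[THEN a] show ?thesis by (simp add: algebra_simps)
qed

definition flat :: "(real \<times> real \<Rightarrow> real) \<Rightarrow> real \<times> real \<Rightarrow> bool" where
  "flat E z \<longleftrightarrow> E z = 0 \<and> Dx UNIV E z = 0 \<and> Dy UNIV E z = 0"

text \<open>The gradient is affine and vanishes at both ends, hence on the whole line of the edge.
  Of a quadratic only a multiple of the squared distance to that line survives.\<close>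

lemma flat_base_x:
  assumes E: "Ck 1 UNIV E" and q: "quadratic_on (convex hull {(x0, y0), (x1, y0), R}) E"
    and nd: "x0 \<noteq> x1" "snd R \<noteq> y0" and f: "flat E (x0, y0)" "flat E (x1, y0)"
  obtains a where "\<And>x y. (x, y) \<in> convex hull {(x0, y0), (x1, y0), R} \<Longrightarrow>
      E (x, y) = a * ((y - y0) * (y - y0)) \<and> Dx UNIV E (x, y) = 0 \<and> Dy UNIV E (x, y) = 2 * a * (y - y0)"
proof -
  obtain a0 a1 a2 a3 a4 a5 where a:
    "\<And>x y. (x, y) \<in> convex hull {(x0, y0), (x1, y0), R} \<Longrightarrow>
       E (x, y) = a0 + a1 * x + a2 * y + a3 * (x * x) + a4 * (x * y) + a5 * (y * y) \<and>
       Dx UNIV E (x, y) = a1 + 2 * a3 * x + a4 * y \<and> Dy UNIV E (x, y) = a2 + a4 * x + 2 * a5 * y"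
    by (rule quadratic_triangle_jet[OF E q]) (use nd in auto)
  have "(x0, y0) \<in> convex hull {(x0, y0), (x1, y0), R}" "(x1, y0) \<in> convex hull {(x0, y0), (x1, y0), R}"
    by (simp_all add: hull_inc)
  from this[THEN a] f have e: "a0 + a1 * x0 + a2 * y0 + a3 * (x0 * x0) + a4 * (x0 * y0) + a5 * (y0 * y0) = 0"
    "a1 + 2 * a3 * x0 + a4 * y0 = 0" "a1 + 2 * a3 * x1 + a4 * y0 = 0"
    "a2 + a4 * x0 + 2 * a5 * y0 = 0" "a2 + a4 * x1 + 2 * a5 * y0 = 0"
    by (auto simp: flat_def)
  have "a3 * x1 = a3 * x0" "a4 * x1 = a4 * x0" using e by linarith+
  then have 34: "a3 = 0" "a4 = 0" using nd by auto
  then have 1: "a1 = 0" "a2 = - 2 * a5 * y0" using e by auto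
  have 0: "a0 = a5 * (y0 * y0)" using e(1) unfolding 34 1 by simp
  show ?thesis
    by (rule that[of a5]) (use a in \<open>simp add: 0 1 34 algebra_simps\<close>)
qed

lemma flat_base_y:
  assumes E: "Ck 1 UNIV E" and q: "quadratic_on (convex hull {(x0, y0), (x0, y1), R}) E"
    and nd: "y0 \<noteq> y1" "fst R \<noteq> x0" and f: "flat E (x0, y0)" "flat E (x0, y1)"
  obtains a where "\<And>x y. (x, y) \<in> convex hull {(x0, y0), (x0, y1), R} \<Longrightarrow>
      E (x, y) = a * ((x - x0) * (x - x0)) \<and> Dx UNIV E (x, y) = 2 * a * (x - x0) \<and> Dy UNIV E (x, y) = 0"
proof -
  obtain a0 a1 a2 a3 a4 a5 where a:
    "\<And>x y. (x, y) \<in> convex hull {(x0, y0), (x0, y1), R} \<Longrightarrow>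
       E (x, y) = a0 + a1 * x + a2 * y + a3 * (x * x) + a4 * (x * y) + a5 * (y * y) \<and>
       Dx UNIV E (x, y) = a1 + 2 * a3 * x + a4 * y \<and> Dy UNIV E (x, y) = a2 + a4 * x + 2 * a5 * y"
    by (rule quadratic_triangle_jet[OF E q]) (use nd in auto)
  have "(x0, y0) \<in> convex hull {(x0, y0), (x0, y1), R}" "(x0, y1) \<in> convex hull {(x0, y0), (x0, y1), R}"
    by (simp_all add: hull_inc)
  from this[THEN a] f have e: "a0 + a1 * x0 + a2 * y0 + a3 * (x0 * x0) + a4 * (x0 * y0) + a5 * (y0 * y0) = 0"
    "a1 + 2 * a3 * x0 + a4 * y0 = 0" "a1 + 2 * a3 * x0 + a4 * y1 = 0"
    "a2 + a4 * x0 + 2 * a5 * y0 = 0" "a2 + a4 * x0 + 2 * a5 * y1 = 0"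
    by (auto simp: flat_def)
  have "a5 * y1 = a5 * y0" "a4 * y1 = a4 * y0" using e by linarith+
  then have 34: "a5 = 0" "a4 = 0" using nd by auto
  then have 1: "a2 = 0" "a1 = - 2 * a3 * x0" using e by auto
  have 0: "a0 = a3 * (x0 * x0)" using e(1) unfolding 34 1 by simp
  show ?thesis
    by (rule that[of a3]) (use a in \<open>simp add: 0 1 34 algebra_simps\<close>)
qed

lemma cell_covered:
  assumes "u p < u (p + 1)" "v q < v (q + 1)" "x \<in> {u p..u (p + 1)}" "y \<in> {v q..v (q + 1)}"
  shows "\<exists>T\<in>cell_triangles u v p q. (x, y) \<in> T"
proof -
  define \<xi> where "\<xi> = loc u p x"
  define \<eta> where "\<eta> = loc v q y"
  have b: "\<bar>\<xi>\<bar> \<le> 1" "\<bar>\<eta>\<bar> \<le> 1" unfolding \<xi>_def \<eta>_def using assms by (auto intro: loc_bounds)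
  define Z where "Z = ((u p + u (p + 1)) / 2, (v q + v (q + 1)) / 2)"
  have x: "x = u p + (1 + \<xi>) / 2 * (u (p + 1) - u p)" and y: "y = v q + (1 + \<eta>) / 2 * (v (q + 1) - v q)"
    unfolding \<xi>_def \<eta>_def by (rule loc_inverse(1)[OF assms(1)], rule loc_inverse(1)[OF assms(2)])
  have hull: "(x, y) \<in> convex hull {P, Q, Z}"
    if "(x, y) = r *\<^sub>R P + s *\<^sub>R Q + (1 - r - s) *\<^sub>R Z" "0 \<le> r" "0 \<le> s" "r + s \<le> 1" for r s P Q
    unfolding convex_hull_3 using that by force
  \<comment> \<open>The sign of the coordinate of larger modulus decides the triangle. In each case
    the weights of the two outer vertices are half sums and half differences of \<xi> and \<eta>,
    and the centre takes the rest.\<close>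
  consider "\<bar>\<xi>\<bar> \<le> - \<eta>" | "\<bar>\<eta>\<bar> \<le> \<xi>" | "\<bar>\<xi>\<bar> \<le> \<eta>" | "\<bar>\<eta>\<bar> \<le> - \<xi>" by linarith
  then show ?thesis
  proof cases
    case 1
    have "(x, y) \<in> convex hull {(u p, v q), (u (p + 1), v q), Z}"
      by (rule hull[of "(- \<xi> - \<eta>) / 2" _ "(\<xi> - \<eta>) / 2"])
         (use 1 b in \<open>auto simp: x y Z_def field_simps\<close>)
    then show ?thesis by (auto simp: cell_triangles_def Let_def Z_def)
  next
    case 2
    have "(x, y) \<in> convex hull {(u (p + 1), v q), (u (p + 1), v (q + 1)), Z}"
      by (rule hull[of "(\<xi> - \<eta>) / 2" _ "(\<xi> + \<eta>) / 2"])
         (use 2 b in \<open>auto simp: x y Z_def field_simps\<close>)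
    then show ?thesis by (auto simp: cell_triangles_def Let_def Z_def)
  next
    case 3
    have "(x, y) \<in> convex hull {(u (p + 1), v (q + 1)), (u p, v (q + 1)), Z}"
      by (rule hull[of "(\<xi> + \<eta>) / 2" _ "(\<eta> - \<xi>) / 2"])
         (use 3 b in \<open>auto simp: x y Z_def field_simps\<close>)
    then show ?thesis by (auto simp: cell_triangles_def Let_def Z_def)
  next
    case 4
    have "(x, y) \<in> convex hull {(u p, v (q + 1)), (u p, v q), Z}"
      by (rule hull[of "(\<eta> - \<xi>) / 2" _ "(- \<xi> - \<eta>) / 2"])
         (use 4 b in \<open>auto simp: x y Z_def field_simps\<close>)
    then show ?thesis by (auto simp: cell_triangles_def Let_def Z_def)
  qed
qed

text \<open>On each triangle a multiple of the squared distance to the outer edge remains. All four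
  triangles contain the centre: the lower and upper ones force the first partial to vanish there,
  the left and right ones the second. Since the centre is off every outer edge, all four multiples
  are zero.\<close>

lemma flat_corners_imp_zero:
  assumes E: "Ck 1 UNIV E" and q: "\<forall>T\<in>cell_triangles u v p q. quadratic_on T E"
    and lt: "u p < u (p + 1)" "v q < v (q + 1)"
    and f: "flat E (u p, v q)" "flat E (u (p + 1), v q)" "flat E (u p, v (q + 1))" "flat E (u (p + 1), v (q + 1))"
    and xy: "x \<in> {u p..u (p + 1)}" "y \<in> {v q..v (q + 1)}"
  shows "E (x, y) = 0"
proof -
  define Zx where "Zx = (u p + u (p + 1)) / 2"
  define Zy where "Zy = (v q + v (q + 1)) / 2"
  have Z: "Zx \<noteq> u p" "Zx \<noteq> u (p + 1)" "Zy \<noteq> v q" "Zy \<noteq> v (q + 1)" using lt by (auto simp: Zx_def Zy_def)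
  have T: "cell_triangles u v p q = {convex hull {(u p, v q), (u (p + 1), v q), (Zx, Zy)},
      convex hull {(u (p + 1), v q), (u (p + 1), v (q + 1)), (Zx, Zy)},
      convex hull {(u (p + 1), v (q + 1)), (u p, v (q + 1)), (Zx, Zy)},
      convex hull {(u p, v (q + 1)), (u p, v q), (Zx, Zy)}}"
    by (simp add: cell_triangles_def Let_def Zx_def Zy_def)
  note q' = q[unfolded T]
  obtain a where a: "\<And>x y. (x, y) \<in> convex hull {(u p, v q), (u (p + 1), v q), (Zx, Zy)} \<Longrightarrow>
      E (x, y) = a * ((y - v q) * (y - v q)) \<and> Dx UNIV E (x, y) = 0 \<and> Dy UNIV E (x, y) = 2 * a * (y - v q)"
    by (rule flat_base_x[OF E, of "u p" "v q" "u (p + 1)" "(Zx, Zy)"]) (use q' f Z lt in auto)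
  obtain b where b: "\<And>x y. (x, y) \<in> convex hull {(u (p + 1), v q), (u (p + 1), v (q + 1)), (Zx, Zy)} \<Longrightarrow>
      E (x, y) = b * ((x - u (p + 1)) * (x - u (p + 1))) \<and> Dx UNIV E (x, y) = 2 * b * (x - u (p + 1)) \<and> Dy UNIV E (x, y) = 0"
    by (rule flat_base_y[OF E, of "u (p + 1)" "v q" "v (q + 1)" "(Zx, Zy)"]) (use q' f Z lt in auto)
  obtain c where c: "\<And>x y. (x, y) \<in> convex hull {(u (p + 1), v (q + 1)), (u p, v (q + 1)), (Zx, Zy)} \<Longrightarrow>
      E (x, y) = c * ((y - v (q + 1)) * (y - v (q + 1))) \<and> Dx UNIV E (x, y) = 0 \<and> Dy UNIV E (x, y) = 2 * c * (y - v (q + 1))"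
    by (rule flat_base_x[OF E, of "u (p + 1)" "v (q + 1)" "u p" "(Zx, Zy)"]) (use q' f Z lt in auto)
  obtain d where d: "\<And>x y. (x, y) \<in> convex hull {(u p, v (q + 1)), (u p, v q), (Zx, Zy)} \<Longrightarrow>
      E (x, y) = d * ((x - u p) * (x - u p)) \<and> Dx UNIV E (x, y) = 2 * d * (x - u p) \<and> Dy UNIV E (x, y) = 0"
    by (rule flat_base_y[OF E, of "u p" "v (q + 1)" "v q" "(Zx, Zy)"]) (use q' f Z lt in auto)
  have "(Zx, Zy) \<in> convex hull {P, Q, (Zx, Zy)}" for P Q by (simp add: hull_inc)
  note z = a[OF this] b[OF this] c[OF this] d[OF this]
  have "a = 0" "b = 0" "c = 0" "d = 0" using z Z by auto
  then show ?thesis using cell_covered[OF lt xy] a b c d unfolding T by auto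
qed

text \<open>Continuity extends the zero to the boundary line. The gradient there follows by treating
  the closed half-plane as the set on which \<open>E\<close> is the zero quadratic.\<close>

lemma flat_halfplane:
  assumes E: "Ck 1 UNIV E" and w: "w \<noteq> 0" and zero: "\<And>z. w \<bullet> z < b \<Longrightarrow> E z = 0"
    and z: "w \<bullet> z \<le> b"
  shows "flat E z"
proof -
  have E0: "E z = 0" if "w \<bullet> z \<le> b" for z
    using continuous_constant_on_closure[of "{z. w \<bullet> z < b}" E 0 z] zero w that
      continuous_on_subset[OF Ck_1_UNIV(1)[OF E]] by auto
  have ne: "interior {z. w \<bullet> z \<le> b} \<noteq> {}"
  proof -
    have "w \<bullet> (((b - 1) / (w \<bullet> w)) *\<^sub>R w) < b" using w by simp
    then show ?thesis unfolding interior_halfspace_le[OF w] by blast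
  qed
  show ?thesis
  proof (cases z)
    case (Pair x y)
    have "Dx UNIV E (x, y) = 0 + 2 * 0 * x + 0 * y" "Dy UNIV E (x, y) = 0 + 0 * x + 2 * 0 * y"
      using gradient_of_quadratic[OF E convex_halfspace_le ne, of 0 0 0 0 0 0 x y] E0 z Pair by auto
    then show ?thesis using Pair E0 z by (simp add: flat_def)
  qed
qed

text \<open>Along a grid line through three cells, a \<open>C\<^sup>1\<close> quadratic spline that vanishes to first order at
  both ends and takes the value zero at one inner knot vanishes to first order at both inner knots.\<close>

lemma three_edges:
  fixes h1 h2 h3 :: real
  assumes "h1 > 0" "h2 > 0" "h3 > 0"
    and "2 * (z1 - 0) = h1 * (0 + d1)" "2 * (z2 - z1) = h2 * (d1 + d2)" "2 * (0 - z2) = h3 * (d2 + 0)"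
    and "z1 = 0 \<or> z2 = 0"
  shows "z1 = 0 \<and> z2 = 0 \<and> d1 = 0 \<and> d2 = 0"
  using assms(7)
proof
  assume z: "z1 = 0"
  then have "d1 = 0" using assms by simp
  then have "2 * z2 = h2 * d2" "2 * z2 = - h3 * d2" using z assms by auto
  then have "(h2 + h3) * d2 = 0" by (simp add: algebra_simps)
  then have "d2 = 0" using assms by auto
  then show ?thesis using z \<open>d1 = 0\<close> \<open>2 * z2 = h2 * d2\<close> by simp
next
  assume z: "z2 = 0"
  then have "d2 = 0" using assms by simp
  then have "2 * z1 = h1 * d1" "2 * z1 = - h2 * d1" using z assms by auto
  then have "(h1 + h2) * d1 = 0" by (simp add: algebra_simps)
  then have "d1 = 0" using assms by auto
  then show ?thesis using z \<open>d2 = 0\<close> \<open>2 * z1 = h1 * d1\<close> by simp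
qed

lemma octagon_halfplane:
  assumes "local_knots u i" "local_knots v j" "(x, y) \<in> octagon u v i j"
  shows "x \<in> {u (i - 2)..u (i + 1)}" "y \<in> {v (j - 2)..v (j + 1)}"
proof -
  have "octagon u v i j \<subseteq> {u (i - 2)..u (i + 1)} \<times> {v (j - 2)..v (j + 1)}"
    unfolding octagon_def
    by (rule hull_minimal) (use assms in \<open>auto simp: local_knots_def intro!: convex_Times\<close>)
  then show "x \<in> {u (i - 2)..u (i + 1)}" "y \<in> {v (j - 2)..v (j + 1)}" using assms(3) by auto
qed

text \<open>The vertices on the rim of the block are flat because of the support. The zero at
  \<open>(u i, v j)\<close> spreads along grid lines to the four inner vertices, and a cell with
  four flat corners carries only the zero spline.\<close>

lemma compact_spline_unique:
  assumes k: "local_knots u i" "local_knots v j" and E: "Ck 1 UNIV E"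
    and q: "\<And>p q T. p \<in> {i - 2, i - 1, i} \<Longrightarrow> q \<in> {j - 2, j - 1, j} \<Longrightarrow> T \<in> cell_triangles u v p q \<Longrightarrow> quadratic_on T E"
    and out: "\<And>z. z \<notin> octagon u v i j \<Longrightarrow> E z = 0" and center: "E (u i, v j) = 0"
  shows "E z = 0"
proof -
  have out': "flat E (x, y)" if xy: "x \<notin> {u (i - 2)<..<u (i + 1)} \<or> y \<notin> {v (j - 2)<..<v (j + 1)}" for x y
  proof -
    have 0: "E (x, y) = 0" if "x \<notin> {u (i - 2)..u (i + 1)} \<or> y \<notin> {v (j - 2)..v (j + 1)}" for x y
      using out octagon_halfplane[OF k] that by blast
    consider "x \<le> u (i - 2)" | "x \<ge> u (i + 1)" | "y \<le> v (j - 2)" | "y \<ge> v (j + 1)"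
      using xy by force
    then show ?thesis
    proof cases
      case 1
      show ?thesis by (rule flat_halfplane[OF E, of "(1, 0)" "u (i - 2)"]) (use 1 0 in \<open>auto simp: zero_prod_def\<close>)
    next
      case 2
      show ?thesis by (rule flat_halfplane[OF E, of "(-1, 0)" "- u (i + 1)"]) (use 2 0 in \<open>auto simp: zero_prod_def\<close>)
    next
      case 3
      show ?thesis by (rule flat_halfplane[OF E, of "(0, 1)" "v (j - 2)"]) (use 3 0 in \<open>auto simp: zero_prod_def\<close>)
    next
      case 4
      show ?thesis by (rule flat_halfplane[OF E, of "(0, -1)" "- v (j + 1)"]) (use 4 0 in \<open>auto simp: zero_prod_def\<close>)
    qed
  qed
  have lt: "u (i - 2) < u (i - 1)" "u (i - 1) < u i" "u i < u (i + 1)"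
    "v (j - 2) < v (j - 1)" "v (j - 1) < v j" "v j < v (j + 1)"
    using k by (auto simp: local_knots_def)
  have ex: "2 * (E (u (p + 1), v q) - E (u p, v q)) =
      (u (p + 1) - u p) * (Dx UNIV E (u p, v q) + Dx UNIV E (u (p + 1), v q))"
    if p: "p \<in> {i - 2, i - 1, i}" "q \<in> {j - 2, j - 1, j}" for p q
  proof (rule edge_identity_x[OF E])
    show "quadratic_on (convex hull {(u p, v q), (u (p + 1), v q), ((u p + u (p + 1)) / 2, (v q + v (q + 1)) / 2)}) E"
      by (rule q[OF p]) (simp add: cell_triangles_def Let_def)
    show "u p \<noteq> u (p + 1)" using local_knots_cell[OF k(1) p(1)] by simp
    show "snd ((u p + u (p + 1)) / 2, (v q + v (q + 1)) / 2) \<noteq> v q"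
      using local_knots_cell[OF k(2) p(2)] by simp
  qed
  have ey: "2 * (E (u p, v (q + 1)) - E (u p, v q)) =
      (v (q + 1) - v q) * (Dy UNIV E (u p, v q) + Dy UNIV E (u p, v (q + 1)))"
    if p: "p \<in> {i - 2, i - 1, i}" "q \<in> {j - 2, j - 1, j}" for p q
  proof (rule edge_identity_y[OF E])
    have "convex hull {(u p, v q), (u p, v (q + 1)), ((u p + u (p + 1)) / 2, (v q + v (q + 1)) / 2)} \<in> cell_triangles u v p q"
      by (simp add: cell_triangles_def Let_def insert_commute)
    then show "quadratic_on (convex hull {(u p, v q), (u p, v (q + 1)), ((u p + u (p + 1)) / 2, (v q + v (q + 1)) / 2)}) E"
      by (rule q[OF p])
    show "v q \<noteq> v (q + 1)" using local_knots_cell[OF k(2) p(2)] by simp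
    show "fst ((u p + u (p + 1)) / 2, (v q + v (q + 1)) / 2) \<noteq> u p"
      using local_knots_cell[OF k(1) p(1)] by simp
  qed
  have row: "E (u (i - 1), v q) = 0 \<and> E (u i, v q) = 0 \<and> Dx UNIV E (u (i - 1), v q) = 0 \<and> Dx UNIV E (u i, v q) = 0"
    if q: "q = j - 1 \<or> q = j" and 0: "E (u (i - 1), v q) = 0 \<or> E (u i, v q) = 0" for q
  proof (rule three_edges[OF _ _ _ _ _ _ 0])
    have "flat E (u (i - 2), v q)" "flat E (u (i + 1), v q)" by (rule out'; simp)+
    then show "2 * (E (u (i - 1), v q) - 0) = (u (i - 1) - u (i - 2)) * (0 + Dx UNIV E (u (i - 1), v q))"
      "2 * (E (u i, v q) - E (u (i - 1), v q)) = (u i - u (i - 1)) * (Dx UNIV E (u (i - 1), v q) + Dx UNIV E (u i, v q))"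
      "2 * (0 - E (u i, v q)) = (u (i + 1) - u i) * (Dx UNIV E (u i, v q) + 0)"
      using ex[of "i - 2" q] ex[of "i - 1" q] ex[of i q] q by (auto simp: flat_def)
  qed (use lt in auto)
  have col: "E (u p, v (j - 1)) = 0 \<and> E (u p, v j) = 0 \<and> Dy UNIV E (u p, v (j - 1)) = 0 \<and> Dy UNIV E (u p, v j) = 0"
    if p: "p = i - 1 \<or> p = i" and 0: "E (u p, v (j - 1)) = 0 \<or> E (u p, v j) = 0" for p
  proof (rule three_edges[OF _ _ _ _ _ _ 0])
    have "flat E (u p, v (j - 2))" "flat E (u p, v (j + 1))" by (rule out'; simp)+
    then show "2 * (E (u p, v (j - 1)) - 0) = (v (j - 1) - v (j - 2)) * (0 + Dy UNIV E (u p, v (j - 1)))"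
      "2 * (E (u p, v j) - E (u p, v (j - 1))) = (v j - v (j - 1)) * (Dy UNIV E (u p, v (j - 1)) + Dy UNIV E (u p, v j))"
      "2 * (0 - E (u p, v j)) = (v (j + 1) - v j) * (Dy UNIV E (u p, v j) + 0)"
      using ey[of p "j - 2"] ey[of p "j - 1"] ey[of p j] p by (auto simp: flat_def)
  qed (use lt in auto)
  have inner: "flat E (u p, v q)" if "p = i - 1 \<or> p = i" "q = j - 1 \<or> q = j" for p q
  proof -
    \<comment> \<open>Row \<open>j\<close> and column \<open>i\<close> pass through the centre. They
      supply one zero each on column \<open>i - 1\<close> and row \<open>j - 1\<close>, which starts
      \<open>three_edges\<close> on these two lines as well.\<close>
    have r: "E (u (i - 1), v j) = 0" "Dx UNIV E (u (i - 1), v j) = 0" "Dx UNIV E (u i, v j) = 0"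
      using row[of j] center by blast+
    have c: "E (u i, v (j - 1)) = 0" "Dy UNIV E (u i, v (j - 1)) = 0" "Dy UNIV E (u i, v j) = 0"
      using col[of i] center by blast+
    have c': "E (u (i - 1), v (j - 1)) = 0" "Dy UNIV E (u (i - 1), v (j - 1)) = 0" "Dy UNIV E (u (i - 1), v j) = 0"
      using col[of "i - 1"] r(1) by blast+
    have r': "Dx UNIV E (u (i - 1), v (j - 1)) = 0" "Dx UNIV E (u i, v (j - 1)) = 0"
      using row[of "j - 1"] c(1) by blast+
    show ?thesis using that r c c' r' center unfolding flat_def by blast
  qed
  have vert: "flat E (u p, v q)" if p: "p \<in> {i - 2, i - 1, i, i + 1}" and q: "q \<in> {j - 2, j - 1, j, j + 1}" for p q
  proof (cases "(p = i - 1 \<or> p = i) \<and> (q = j - 1 \<or> q = j)")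
    case False
    then show ?thesis using p q by - (rule out', auto)
  qed (use inner in auto)
  show ?thesis
  proof (cases z)
    case (Pair x y)
    show ?thesis
    proof (cases "x \<in> {u (i - 2)..u (i + 1)} \<and> y \<in> {v (j - 2)..v (j + 1)}")
      case True
      note p = piece_mem[of u i x] and q' = piece_mem[of v j y]
      define p q where "p = piece u i x" and "q = piece v j y"
      have p: "p \<in> {i - 2, i - 1, i}" and q': "q \<in> {j - 2, j - 1, j}"
        unfolding p_def q_def by (rule piece_mem)+
      have x: "x \<in> {u p..u (p + 1)}" and y: "y \<in> {v q..v (q + 1)}"
        unfolding p_def q_def using piece_bounds[OF k(1)] piece_bounds[OF k(2)] True by auto
      have v: "flat E (u p, v q)" "flat E (u (p + 1), v q)" "flat E (u p, v (q + 1))" "flat E (u (p + 1), v (q + 1))"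
        by (rule vert; use p q' in force)+
      have "E (x, y) = 0"
        using flat_corners_imp_zero[OF E _ local_knots_cell(1)[OF k(1) p] local_knots_cell(1)[OF k(2) q'] v x y]
          q[OF p q'] by blast
      then show ?thesis using Pair by simp
    next
      case False
      then show ?thesis using out'[of x y] Pair by (auto simp: flat_def)
    qed
  qed
qed

text \<open>Two candidates have the same normalization, so their difference vanishes at
  \<open>(u i, v j)\<close> and falls under \<open>compact_spline_unique\<close>.\<close>

theorem classical_bspline_eq:
  assumes K: "knots m u" "knots n v" and ij: "i \<in> {0..m + 1}" "j \<in> {0..n + 1}"
  shows "classical_bspline m u n v i j = zp u v i j"
  unfolding classical_bspline_def
proof (rule the_equality)
  show "is_classical_bspline m u n v i j (zp u v i j)" by (rule is_classical_bspline_zp[OF K ij])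
  fix B assume B: "is_classical_bspline m u n v i j B"
  note Z = is_classical_bspline_zp[OF K ij]
  show "B = zp u v i j"
  proof
    fix z
    have "B z - zp u v i j z = 0"
    proof (rule compact_spline_unique[OF knots_local[OF K(1) ij(1)] knots_local[OF K(2) ij(2)]])
      show "Ck 1 UNIV (\<lambda>z. B z - zp u v i j z)"
        using B Z by (intro Ck_1_UNIV_diff) (auto simp: is_classical_bspline_def)
      show "quadratic_on T (\<lambda>z. B z - zp u v i j z)"
        if "p \<in> {i - 2, i - 1, i}" "q \<in> {j - 2, j - 1, j}" "T \<in> cell_triangles u v p q" for p q T
      proof -
        have "p \<in> {-2..m + 1}" "q \<in> {-2..n + 1}" using that ij by auto
        then show ?thesis using B Z that(3) unfolding is_classical_bspline_def
          by (intro quadratic_on_diff) blast+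
      qed
    qed (use B Z in \<open>auto simp: is_classical_bspline_def\<close>)
    then show "B z = zp u v i j z" by simp
  qed
qed

section \<open>Derivatives of splines as means of slopes\<close>

lemma zp_swap: "zp u v i j (x, y) = zp v u j i (y, x)"
  unfolding zp_def zp_jet_swap[of u v] by (simp split: prod.split)

lemma bspline_swap:
  assumes "knots m u" "knots n v"
  shows "bspline m u n v i j (x, y) = bspline n v m u j i (y, x)"
  unfolding bspline_def
  by (subst sum.swap, intro sum.cong refl) (simp add: classical_bspline_eq assms zp_swap[of u v])

lemma step_inner:
  assumes "knots m u" "k \<in> {1..m}"
  shows "step m u k = u k - u (k - 1)" "step m u k > 0"
proof -
  show "step m u k = u k - u (k - 1)" using assms by (simp add: step_def pt_def)
  then show "step m u k > 0" using knots_less[OF assms(1), of "k - 1"] assms(2) by simp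
qed

lemma step_outer:
  assumes "knots m u"
  shows "k \<le> 0 \<Longrightarrow> step m u k = 0" "k > m \<Longrightarrow> step m u k = 0"
  using assms by (auto simp: step_def pt_def knots_def)

lemma step_nonneg: "knots m u \<Longrightarrow> step m u k \<ge> 0"
  using step_inner(2)[of m u k] step_outer[of m u k] by (cases "k \<le> 0"; cases "k > m") (auto simp: less_imp_le)

lemma step_sum_pos:
  assumes "knots m u" "k \<in> {0..m}"
  shows "step m u k + step m u (k + 1) > 0"
proof (cases "k = 0")
  case True
  then show ?thesis using step_inner(2)[OF assms(1), of 1] step_nonneg[OF assms(1), of 0] assms
    by (auto simp: knots_def)
next
  case False
  then show ?thesis using step_inner(2)[OF assms(1), of k] step_nonneg[OF assms(1), of "k + 1"] assms by auto
qed

section \<open>Elimination of the extended knots\<close>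

definition knot_weight :: "int \<Rightarrow> (int \<Rightarrow> real) \<Rightarrow> int \<Rightarrow> int \<Rightarrow> real" where
  "knot_weight m u k i =
    (if i = k then step m u (k + 1) / (step m u k + step m u (k + 1))
     else if i = k + 1 then step m u k / (step m u k + step m u (k + 1)) else 0)"

lemma bcoef_inner:
  assumes "1 \<le> p" "p \<le> m"
  shows "bcoef m u i p = (if i = p then 1 else 0)"
  using assms by (auto simp: bcoef_def)

lemma sum_two:
  fixes f :: "int \<Rightarrow> real"
  assumes "\<And>p. p \<in> {0..m + 1} \<Longrightarrow> p \<noteq> k \<Longrightarrow> p \<noteq> k + 1 \<Longrightarrow> f p = 0" "k \<in> {0..m}"
  shows "(\<Sum>p = 0..m + 1. f p) = f k + f (k + 1)"
proof -
  have "(\<Sum>p = 0..m + 1. f p) = (\<Sum>p\<in>{k, k + 1}. f p)"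
    using assms by (intro sum.mono_neutral_right) auto
  then show ?thesis by simp
qed

text \<open>The result is the value at the knot \<open>k\<close> of the combined univariate B-spline
  \<open>i\<close>. At \<open>k = 0\<close> and \<open>k = m\<close> the entries of
  \<open>bcoef\<close> cancel the extended knots and leave the values 1 and 0, which is the interior
  formula with an outer step equal to zero.\<close>

lemma sum_bcoef_kval:
  assumes K: "knots m u" and k: "k \<in> {0..m}"
  shows "(\<Sum>p = 0..m + 1. bcoef m u i p * kval u p k) = knot_weight m u k i"
proof -
  have m: "1 \<le> m" using K by (simp add: knots_def)
  have "(\<Sum>p = 0..m + 1. bcoef m u i p * kval u p k) =
      bcoef m u i k * kval u k k + bcoef m u i (k + 1) * kval u (k + 1) k"
    by (rule sum_two[OF _ k]) (auto simp: kval_def)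
  also have "kval u k k = (u (k + 1) - u k) / (u (k + 1) - u (k - 1))" by (simp add: kval_def)
  also have "kval u (k + 1) k = (u k - u (k - 1)) / (u (k + 1) - u (k - 1))" by (simp add: kval_def)
  finally have S: "(\<Sum>p = 0..m + 1. bcoef m u i p * kval u p k) =
      bcoef m u i k * ((u (k + 1) - u k) / (u (k + 1) - u (k - 1)))
      + bcoef m u i (k + 1) * ((u k - u (k - 1)) / (u (k + 1) - u (k - 1)))" .
  have lt: "u (k - 1) < u k" "u k < u (k + 1)"
    using knots_less[OF K, of "k - 1"] knots_less[OF K, of k] k by auto
  \<comment> \<open>\<open>A\<close> is the artificial step beyond the boundary and \<open>B\<close>
    the adjacent step of the partition.\<close>
  have frac: "(A + B) / B * (B / (B + A)) = 1" "- (A / B) * (B / (B + A)) + A / (B + A) = 0"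
    if "A > 0" "B > 0" for A B :: real
  proof -
    have "B + A \<noteq> 0" "B \<noteq> 0" using that by auto
    then show "(A + B) / B * (B / (B + A)) = 1" "- (A / B) * (B / (B + A)) + A / (B + A) = 0"
      by (simp_all add: add.commute)
  qed
  consider "k = 0" | "k = m" "k \<noteq> 0" | "1 \<le> k" "k < m" using k by force
  then show ?thesis
  proof cases
    case 1
    have b: "bcoef m u i 0 = (if i = 0 then (u 0 - u (-1) + step m u 1) / step m u 1
        else if i = 1 then - ((u 0 - u (-1)) / step m u 1) else 0)"
      using m by (simp add: bcoef_def)
    have s: "step m u 1 = u 1 - u 0" "step m u 0 = 0" using step_inner[OF K, of 1] step_outer[OF K, of 0] m by auto
    show ?thesis
      using frac[of "u 0 - u (-1)" "u 1 - u 0"] lt m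
      unfolding S by (auto simp: 1 knot_weight_def b bcoef_inner s)
  next
    case 2
    have b: "bcoef m u i (m + 1) = (if i = m + 1 then (step m u m + (u (m + 1) - u m)) / step m u m
        else if i = m then - ((u (m + 1) - u m) / step m u m) else 0)"
      using m by (simp add: bcoef_def)
    have s: "step m u m = u m - u (m - 1)" "step m u (m + 1) = 0"
      using step_inner[OF K, of m] step_outer[OF K, of "m + 1"] m by auto
    show ?thesis
      using frac[of "u (m + 1) - u m" "u m - u (m - 1)"] lt m
      unfolding S by (auto simp: 2(1) knot_weight_def b bcoef_inner s)
  next
    case 3
    have s: "step m u k = u k - u (k - 1)" "step m u (k + 1) = u (k + 1) - u k"
      using step_inner[OF K, of k] step_inner[OF K, of "k + 1"] 3 by auto
    show ?thesis
      using 3 unfolding S by (simp add: knot_weight_def bcoef_inner s)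
  qed
qed

lemma sum_bcoef_cmid:
  assumes "k \<in> {1..m}"
  shows "(\<Sum>p = 0..m + 1. bcoef m u i p * cmid p (k - 1)) = (if i = k then 1 else 0)"
proof -
  have "(\<Sum>p = 0..m + 1. bcoef m u i p * cmid p (k - 1)) = (\<Sum>p\<in>{k}. bcoef m u i p * cmid p (k - 1))"
    using assms by (intro sum.mono_neutral_right) (auto simp: cmid_def)
  then show ?thesis using assms by (simp add: cmid_def bcoef_inner)
qed

text \<open>The two weights at a knot add up to 1, so subtracting the middle coefficient leaves a
  multiple of a difference of two indicators. Summed against coefficients, it produces the
  difference \<open>c (k + 1) j - c k j\<close>.\<close>

lemma sum_bcoef_right:
  assumes K: "knots m u" and k: "k \<in> {1..m}"
  shows "(\<Sum>p = 0..m + 1. bcoef m u i p * (kval u p k - cmid p (k - 1))) =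
     step m u k / (step m u k + step m u (k + 1)) * ((if i = k + 1 then 1 else 0) - (if i = k then 1 else 0))"
proof -
  have "step m u k + step m u (k + 1) > 0" using k by (intro step_sum_pos[OF K]) auto
  then have "step m u (k + 1) / (step m u k + step m u (k + 1)) - 1 = - (step m u k / (step m u k + step m u (k + 1)))"
    by (simp add: field_simps)
  moreover have "(\<Sum>p = 0..m + 1. bcoef m u i p * (kval u p k - cmid p (k - 1))) =
     knot_weight m u k i - (if i = k then 1 else 0)"
    using k by (simp only: right_diff_distrib sum_subtractf) (simp add: sum_bcoef_kval[OF K] sum_bcoef_cmid)
  ultimately show ?thesis by (auto simp: knot_weight_def)
qed

lemma sum_bcoef_left:
  assumes K: "knots m u" and k: "k \<in> {1..m}"
  shows "(\<Sum>p = 0..m + 1. bcoef m u i p * (cmid p (k - 1) - kval u p (k - 1))) =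
     step m u k / (step m u (k - 1) + step m u k) * ((if i = k then 1 else 0) - (if i = k - 1 then 1 else 0))"
proof -
  have "step m u (k - 1) + step m u k > 0" using k step_sum_pos[OF K, of "k - 1"] by auto
  then have "1 - step m u (k - 1) / (step m u (k - 1) + step m u k) = step m u k / (step m u (k - 1) + step m u k)"
    by (simp add: field_simps)
  moreover have "(\<Sum>p = 0..m + 1. bcoef m u i p * (cmid p (k - 1) - kval u p (k - 1))) =
     (if i = k then 1 else 0) - knot_weight m u (k - 1) i"
    using k by (simp only: right_diff_distrib sum_subtractf) (simp add: sum_bcoef_kval[OF K] sum_bcoef_cmid)
  ultimately show ?thesis by (auto simp: knot_weight_def)
qed

text \<open>The weights of the four corners in the piecewise linear interpolation on a cell; the centre
  of the cell carries the remaining weight.\<close>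

definition corner_weight :: "real \<Rightarrow> real" where
  "corner_weight r = (\<bar>r\<bar> + r) / 4"

text \<open>The corner values factor into an end slope \<open>d \<plusminus> 2 * e\<close> of the
  first factor and an end value \<open>m' + 2 * e' \<plusminus> d'\<close> of the second; the value
  at the centre is \<open>d * m'\<close>.\<close>

lemma cell_dx_corners:
  "cell_dx m d e m' d' e' \<xi> \<eta> =
     (1 - corner_weight (\<xi> + \<eta>) - corner_weight (- \<xi> - \<eta>) - corner_weight (\<xi> - \<eta>) - corner_weight (\<eta> - \<xi>)) * (d * m')
     + corner_weight (\<xi> + \<eta>) * ((d + 2 * e) * (m' + 2 * e' + d'))
     + corner_weight (\<xi> - \<eta>) * ((d + 2 * e) * (m' + 2 * e' - d'))
     + corner_weight (\<eta> - \<xi>) * ((d - 2 * e) * (m' + 2 * e' + d'))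
     + corner_weight (- \<xi> - \<eta>) * ((d - 2 * e) * (m' + 2 * e' - d'))"
proof -
  define A B where "A = \<bar>\<xi> + \<eta>\<bar>" and "B = \<bar>\<xi> - \<eta>\<bar>"
  have "\<bar>- \<xi> - \<eta>\<bar> = A" "\<bar>\<eta> - \<xi>\<bar> = B" by (auto simp: A_def B_def)
  then show ?thesis
    unfolding cell_dx_def corner_weight_def A_def[symmetric] B_def[symmetric]
    by (simp add: field_simps)
qed

lemma sum_indicator_diff:
  fixes f :: "'a \<Rightarrow> real"
  assumes "finite S" "a \<in> S" "b \<in> S"
  shows "(\<Sum>i\<in>S. ((if i = a then 1 else 0) - (if i = b then 1 else 0)) * f i) = f a - f b"
proof -
  have "((if i = a then 1 else 0) - (if i = b then 1 else 0)) * f i =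
      (if i = a then f i else 0) - (if i = b then f i else 0)" for i by simp
  then show ?thesis using assms by (simp add: sum_subtractf)
qed

lemma sum_knot_weight:
  assumes "l \<in> {0..n}"
  shows "(\<Sum>j = 0..n + 1. knot_weight n v l j * d j) =
     (step n v (l + 1) * d l + step n v l * d (l + 1)) / (step n v l + step n v (l + 1))"
  by (subst sum_two[OF _ assms]) (auto simp: knot_weight_def add_divide_distrib)

text \<open>The divisor is twice the distance of neighbouring midpoints, so this is the divided
  difference of the coefficients as data at the abscissae \<open>mid m u\<close>.\<close>

definition slope :: "int \<Rightarrow> (int \<Rightarrow> real) \<Rightarrow> (int \<Rightarrow> int \<Rightarrow> real) \<Rightarrow> int \<Rightarrow> int \<Rightarrow> real" where
  "slope m u c k j = 2 * (c (k + 1) j - c k j) / (step m u k + step m u (k + 1))"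

text \<open>Linear interpolation at the knot \<open>l\<close> of data located at the midpoints
  \<open>mid n v l\<close> and \<open>mid n v (l + 1)\<close>.\<close>

definition knot_mean :: "int \<Rightarrow> (int \<Rightarrow> real) \<Rightarrow> (int \<Rightarrow> real) \<Rightarrow> int \<Rightarrow> real" where
  "knot_mean n v d l = (step n v (l + 1) * d l + step n v l * d (l + 1)) / (step n v l + step n v (l + 1))"

definition cell_mean ::
  "int \<Rightarrow> (int \<Rightarrow> real) \<Rightarrow> (int \<Rightarrow> int \<Rightarrow> real) \<Rightarrow> int \<Rightarrow> int \<Rightarrow> real \<Rightarrow> real \<Rightarrow> real" where
  "cell_mean n v d k l \<xi> \<eta> =
     (1 - corner_weight (\<xi> + \<eta>) - corner_weight (- \<xi> - \<eta>) - corner_weight (\<xi> - \<eta>) - corner_weight (\<eta> - \<xi>))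
       * ((d k l + d (k - 1) l) / 2)
     + corner_weight (\<xi> + \<eta>) * knot_mean n v (d k) l
     + corner_weight (\<xi> - \<eta>) * knot_mean n v (d k) (l - 1)
     + corner_weight (\<eta> - \<xi>) * knot_mean n v (d (k - 1)) l
     + corner_weight (- \<xi> - \<eta>) * knot_mean n v (d (k - 1)) (l - 1)"

text \<open>A spline with coefficients \<open>c\<close> in which numbers \<open>F p q\<close> stand
  for the classical B-splines. Taking derivatives at a point for \<open>F\<close> makes the
  derivative of the spline linear in the data of one cell.\<close>

definition tensor_sum ::
  "int \<Rightarrow> (int \<Rightarrow> real) \<Rightarrow> int \<Rightarrow> (int \<Rightarrow> real) \<Rightarrow> (int \<Rightarrow> int \<Rightarrow> real) \<Rightarrow> (int \<Rightarrow> int \<Rightarrow> real) \<Rightarrow> real" where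
  "tensor_sum m u n v c F =
     (\<Sum>i = 0..m + 1. \<Sum>j = 0..n + 1. c i j * (\<Sum>p = 0..m + 1. \<Sum>q = 0..n + 1. bcoef m u i p * bcoef n v j q * F p q))"

lemma tensor_sum_add:
  "tensor_sum m u n v c (\<lambda>p q. F p q + G p q) = tensor_sum m u n v c F + tensor_sum m u n v c G"
  by (simp add: tensor_sum_def distrib_left sum.distrib)

lemma tensor_sum_scale:
  "tensor_sum m u n v c (\<lambda>p q. r * F p q) = r * tensor_sum m u n v c F"
  by (simp add: tensor_sum_def sum_distrib_left mult.left_commute)

lemma tensor_sum_product:
  "tensor_sum m u n v c (\<lambda>p q. f p * g q) =
     (\<Sum>j = 0..n + 1. (\<Sum>q = 0..n + 1. bcoef n v j q * g q) *
        (\<Sum>i = 0..m + 1. (\<Sum>p = 0..m + 1. bcoef m u i p * f p) * c i j))"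
proof -
  have "(\<Sum>p = 0..m + 1. \<Sum>q = 0..n + 1. bcoef m u i p * bcoef n v j q * (f p * g q)) =
     (\<Sum>p = 0..m + 1. bcoef m u i p * f p) * (\<Sum>q = 0..n + 1. bcoef n v j q * g q)" for i j
    by (simp add: sum_product mult_ac)
  moreover have "(\<Sum>i = 0..m + 1. \<Sum>j = 0..n + 1. c i j * (A i * B j)) =
     (\<Sum>j = 0..n + 1. B j * (\<Sum>i = 0..m + 1. A i * c i j))" for A B :: "int \<Rightarrow> real"
    by (subst sum.swap) (simp add: sum_distrib_left mult_ac)
  ultimately show ?thesis by (simp only: tensor_sum_def)
qed

lemma tensor_sum_right:
  assumes K: "knots m u" and k: "k \<in> {1..m}"
  shows "tensor_sum m u n v c (\<lambda>p q. (kval u p k - cmid p (k - 1)) * g q) =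
     step m u k / 2 * (\<Sum>j = 0..n + 1. (\<Sum>q = 0..n + 1. bcoef n v j q * g q) * slope m u c k j)"
proof -
  have "(\<Sum>i = 0..m + 1. step m u k / (step m u k + step m u (k + 1)) *
      ((if i = k + 1 then 1 else 0) - (if i = k then 1 else 0)) * c i j) = step m u k / 2 * slope m u c k j" for j
  proof -
    have "(\<Sum>i = 0..m + 1. r * ((if i = k + 1 then 1 else 0) - (if i = k then 1 else 0)) * c i j) =
        r * (c (k + 1) j - c k j)" for r
      using k by (simp only: mult.assoc sum_distrib_left[symmetric]) (subst sum_indicator_diff, auto)
    moreover have "a / t * d = a / 2 * (2 * d / t)" for a t d :: real by simp
    ultimately show ?thesis by (simp only: slope_def)
  qed
  note eq = this
  show ?thesis
    unfolding tensor_sum_product sum_bcoef_right[OF K k] eq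
    by (subst sum_distrib_left) (intro sum.cong refl, simp only: mult.left_commute)
qed

lemma tensor_sum_left:
  assumes K: "knots m u" and k: "k \<in> {1..m}"
  shows "tensor_sum m u n v c (\<lambda>p q. (cmid p (k - 1) - kval u p (k - 1)) * g q) =
     step m u k / 2 * (\<Sum>j = 0..n + 1. (\<Sum>q = 0..n + 1. bcoef n v j q * g q) * slope m u c (k - 1) j)"
proof -
  have "(\<Sum>i = 0..m + 1. step m u k / (step m u (k - 1) + step m u k) *
      ((if i = k then 1 else 0) - (if i = k - 1 then 1 else 0)) * c i j) = step m u k / 2 * slope m u c (k - 1) j" for j
  proof -
    have "(\<Sum>i = 0..m + 1. r * ((if i = k then 1 else 0) - (if i = k - 1 then 1 else 0)) * c i j) =
        r * (c k j - c (k - 1) j)" for r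
      using k by (simp only: mult.assoc sum_distrib_left[symmetric]) (subst sum_indicator_diff, auto)
    moreover have "a / t * d = a / 2 * (2 * d / t)" for a t d :: real by simp
    moreover have "k - 1 + 1 = k" by simp
    ultimately show ?thesis by (simp only: slope_def)
  qed
  note eq = this
  show ?thesis
    unfolding tensor_sum_product sum_bcoef_left[OF K k] eq
    by (subst sum_distrib_left) (intro sum.cong refl, simp only: mult.left_commute)
qed

text \<open>The derivative is two-sided even on cell edges and on the boundary of the domain, since
  the classical B-splines are C1 on the plane.\<close>

lemma quasi_has_derivative:
  assumes K: "knots m u" "knots n v" and k: "k \<in> {1..m}" and l: "l \<in> {1..n}"
    and x: "x \<in> {u (k - 1)..u k}" and y: "y \<in> {v (l - 1)..v l}"
  shows "((\<lambda>s. \<Sum>i = 0..m + 1. \<Sum>j = 0..n + 1. c i j * bspline m u n v i j (s, y)) has_field_derivative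
     cell_mean n v (slope m u c) k l (loc u (k - 1) x) (loc v (l - 1) y)) (at x)"
proof -
  define X where "X p q = fst (snd (zp_jet u v p q (x, y)))" for p q
  have zp: "((\<lambda>s. zp u v p q (s, y)) has_field_derivative X p q) (at x)"
    if "p \<in> {0..m + 1}" "q \<in> {0..n + 1}" for p q
    using jet_on_zp_jet[OF knots_local[OF K(1) that(1)] knots_local[OF K(2) that(2)]]
    by (simp add: jet_on_def zp_def X_def)
  have eq: "(\<Sum>i = 0..m + 1. \<Sum>j = 0..n + 1. c i j * bspline m u n v i j (s, y)) =
      (\<Sum>i = 0..m + 1. \<Sum>j = 0..n + 1. c i j * (\<Sum>p = 0..m + 1. \<Sum>q = 0..n + 1.
        bcoef m u i p * bcoef n v j q * zp u v p q (s, y)))" for s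
    by (intro sum.cong refl) (simp add: bspline_def classical_bspline_eq K)
  have der: "((\<lambda>s. \<Sum>i = 0..m + 1. \<Sum>j = 0..n + 1. c i j * bspline m u n v i j (s, y)) has_field_derivative
      tensor_sum m u n v c X) (at x)"
    unfolding eq tensor_sum_def
    by (intro DERIV_sum DERIV_cmult zp)
  define h where "h = step m u k"
  have h: "h = u k - u (k - 1)" "h > 0" unfolding h_def using step_inner[OF K(1) k] by auto
  define \<xi> \<eta> where "\<xi> = loc u (k - 1) x" and "\<eta> = loc v (l - 1) y"
  define w1 w2 w3 w4 where "w1 = corner_weight (\<xi> + \<eta>)" and "w2 = corner_weight (\<xi> - \<eta>)"
    and "w3 = corner_weight (\<eta> - \<xi>)" and "w4 = corner_weight (- \<xi> - \<eta>)"
  \<comment> \<open>Each term is now a product of a factor in \<open>p\<close> and a factor in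
    \<open>q\<close>, so the double sums separate. Half the sum of the two end slopes is the slope
    at the centre.\<close>
  have X: "X p q = 2 / h * ((1 - w1 - w4 - w2 - w3) * (1 / 2 * ((kval u p k - cmid p (k - 1)) * cmid q (l - 1)
        + (cmid p (k - 1) - kval u p (k - 1)) * cmid q (l - 1)))
      + w1 * ((kval u p k - cmid p (k - 1)) * kval v q l)
      + w2 * ((kval u p k - cmid p (k - 1)) * kval v q (l - 1))
      + w3 * ((cmid p (k - 1) - kval u p (k - 1)) * kval v q l)
      + w4 * ((cmid p (k - 1) - kval u p (k - 1)) * kval v q (l - 1)))"
    if p: "p \<in> {0..m + 1}" "q \<in> {0..n + 1}" for p q
  proof -
    have "zp_jet u v p q (x, y) = cell_jet u v p q (k - 1) (l - 1) (x, y)"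
      using k l x y by (intro zp_jet_any_cell[OF K p]) auto
    then have "X p q = 2 / h * cell_dx (cmid p (k - 1)) (cdif u p (k - 1)) (ccur u p (k - 1))
        (cmid q (l - 1)) (cdif v q (l - 1)) (ccur v q (l - 1)) \<xi> \<eta>"
      by (simp add: X_def cell_jet_def h \<xi>_def \<eta>_def)
    also have "cell_dx (cmid p (k - 1)) (cdif u p (k - 1)) (ccur u p (k - 1))
        (cmid q (l - 1)) (cdif v q (l - 1)) (ccur v q (l - 1)) \<xi> \<eta> =
      (1 - w1 - w4 - w2 - w3) * (cdif u p (k - 1) * cmid q (l - 1))
      + w1 * ((kval u p (k - 1 + 1) - cmid p (k - 1)) * kval v q (l - 1 + 1))
      + w2 * ((kval u p (k - 1 + 1) - cmid p (k - 1)) * kval v q (l - 1))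
      + w3 * ((cmid p (k - 1) - kval u p (k - 1)) * kval v q (l - 1 + 1))
      + w4 * ((cmid p (k - 1) - kval u p (k - 1)) * kval v q (l - 1))"
      unfolding cell_dx_corners coef_ends w1_def w2_def w3_def w4_def ..
    also have "cdif u p (k - 1) * cmid q (l - 1) = 1 / 2 * ((kval u p k - cmid p (k - 1)) * cmid q (l - 1)
        + (cmid p (k - 1) - kval u p (k - 1)) * cmid q (l - 1))"
      by (simp add: cdif_def field_simps)
    finally show ?thesis by simp
  qed
  let ?S = "\<lambda>d g. \<Sum>j = 0..n + 1. (\<Sum>q = 0..n + 1. bcoef n v j q * g q) * d j :: real"
  have "tensor_sum m u n v c X = 2 / h * ((1 - w1 - w4 - w2 - w3) * (1 / 2 * (
        h / 2 * ?S (slope m u c k) (\<lambda>q. cmid q (l - 1)) + h / 2 * ?S (slope m u c (k - 1)) (\<lambda>q. cmid q (l - 1))))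
      + w1 * (h / 2 * ?S (slope m u c k) (\<lambda>q. kval v q l))
      + w2 * (h / 2 * ?S (slope m u c k) (\<lambda>q. kval v q (l - 1)))
      + w3 * (h / 2 * ?S (slope m u c (k - 1)) (\<lambda>q. kval v q l))
      + w4 * (h / 2 * ?S (slope m u c (k - 1)) (\<lambda>q. kval v q (l - 1))))"
  proof -
    have "tensor_sum m u n v c X = tensor_sum m u n v c (\<lambda>p q. 2 / h * ((1 - w1 - w4 - w2 - w3) * (1 / 2 * ((kval u p k - cmid p (k - 1)) * cmid q (l - 1)
        + (cmid p (k - 1) - kval u p (k - 1)) * cmid q (l - 1)))
      + w1 * ((kval u p k - cmid p (k - 1)) * kval v q l)
      + w2 * ((kval u p k - cmid p (k - 1)) * kval v q (l - 1))
      + w3 * ((cmid p (k - 1) - kval u p (k - 1)) * kval v q l)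
      + w4 * ((cmid p (k - 1) - kval u p (k - 1)) * kval v q (l - 1))))"
      unfolding tensor_sum_def by (intro sum.cong refl arg_cong[of _ _ "(*) _"]) (simp only: X)
    then show ?thesis
      by (simp only: tensor_sum_add tensor_sum_scale tensor_sum_right[OF K(1) k] tensor_sum_left[OF K(1) k] h_def)
  qed
  moreover have "?S d (\<lambda>q. cmid q (l - 1)) = d l" for d :: "int \<Rightarrow> real"
  proof -
    have "(if j = l then 1 else 0) * d j = (if j = l then d j else 0)" for j by simp
    then show ?thesis using l by (simp add: sum_bcoef_cmid[OF l])
  qed
  moreover have "?S d (\<lambda>q. kval v q l) = knot_mean n v d l" for d
    using l by (simp add: sum_bcoef_kval[OF K(2)] sum_knot_weight knot_mean_def)
  moreover have "?S d (\<lambda>q. kval v q (l - 1)) = knot_mean n v d (l - 1)" for d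
    using l by (subst sum_bcoef_kval[OF K(2)]) (auto simp: sum_knot_weight knot_mean_def)
  ultimately have "tensor_sum m u n v c X = 2 / h * ((1 - w1 - w4 - w2 - w3) * (1 / 2 * (
        h / 2 * slope m u c k l + h / 2 * slope m u c (k - 1) l))
      + w1 * (h / 2 * knot_mean n v (slope m u c k) l)
      + w2 * (h / 2 * knot_mean n v (slope m u c k) (l - 1))
      + w3 * (h / 2 * knot_mean n v (slope m u c (k - 1)) l)
      + w4 * (h / 2 * knot_mean n v (slope m u c (k - 1)) (l - 1)))"
    by (simp only:)
  also have "\<dots> = cell_mean n v (slope m u c) k l \<xi> \<eta>"
    using h(2) unfolding cell_mean_def w1_def[symmetric] w2_def[symmetric] w3_def[symmetric] w4_def[symmetric]
    by (simp add: field_simps)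
  finally have "tensor_sum m u n v c X = cell_mean n v (slope m u c) k l \<xi> \<eta>" .
  with der show ?thesis by (simp add: \<xi>_def \<eta>_def)
qed

lemma knot_mean_bound:
  assumes K: "knots n v" and l: "l \<in> {0..n}" and "\<bar>d l\<bar> \<le> r" "\<bar>d (l + 1)\<bar> \<le> r"
  shows "\<bar>knot_mean n v d l\<bar> \<le> r"
proof -
  define A B where "A = step n v (l + 1)" and "B = step n v l"
  have AB: "A \<ge> 0" "B \<ge> 0" "B + A > 0"
    unfolding A_def B_def using step_nonneg[OF K] step_sum_pos[OF K l] by auto
  have "\<bar>A * d l + B * d (l + 1)\<bar> \<le> A * \<bar>d l\<bar> + B * \<bar>d (l + 1)\<bar>"
    using AB by (metis abs_mult abs_of_nonneg abs_triangle_ineq)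
  also have "\<dots> \<le> A * r + B * r"
    using AB assms by (intro add_mono mult_left_mono) auto
  finally show ?thesis
    using AB unfolding knot_mean_def A_def[symmetric] B_def[symmetric] by (simp add: field_simps)
qed

lemma corner_weight_nonneg: "corner_weight r \<ge> 0"
  by (simp add: corner_weight_def)

text \<open>The corner weights add up to half of
  \<open>\<bar>\<xi> + \<eta>\<bar> + \<bar>\<xi> - \<eta>\<bar>\<close>, that is, to the larger of
  the moduli of \<xi> and \<eta>.\<close>

lemma corner_weight_sum:
  assumes "\<bar>\<xi>\<bar> \<le> 1" "\<bar>\<eta>\<bar> \<le> 1"
  shows "1 - corner_weight (\<xi> + \<eta>) - corner_weight (- \<xi> - \<eta>) - corner_weight (\<xi> - \<eta>) - corner_weight (\<eta> - \<xi>) \<ge> 0"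
proof -
  define A B where "A = \<bar>\<xi> + \<eta>\<bar>" and "B = \<bar>\<xi> - \<eta>\<bar>"
  have "\<bar>- \<xi> - \<eta>\<bar> = A" "\<bar>\<eta> - \<xi>\<bar> = B" "A + B \<le> 2" using assms by (auto simp: A_def B_def)
  then show ?thesis
    unfolding corner_weight_def A_def[symmetric] B_def[symmetric] by (simp add: field_simps)
qed

lemma cell_mean_bound:
  assumes K: "knots n v" and l: "l \<in> {1..n}" and b: "\<bar>\<xi>\<bar> \<le> 1" "\<bar>\<eta>\<bar> \<le> 1"
    and d: "\<And>i j. i \<in> {k - 1, k} \<Longrightarrow> j \<in> {l - 1, l, l + 1} \<Longrightarrow> \<bar>d i j\<bar> \<le> r"
  shows "\<bar>cell_mean n v d k l \<xi> \<eta>\<bar> \<le> r"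
proof -
  define w1 w2 w3 w4 w0 where "w1 = corner_weight (\<xi> + \<eta>)" and "w2 = corner_weight (\<xi> - \<eta>)"
    and "w3 = corner_weight (\<eta> - \<xi>)" and "w4 = corner_weight (- \<xi> - \<eta>)" and "w0 = 1 - w1 - w4 - w2 - w3"
  have w: "w1 \<ge> 0" "w2 \<ge> 0" "w3 \<ge> 0" "w4 \<ge> 0" "w0 \<ge> 0"
    using corner_weight_sum[OF b] corner_weight_nonneg unfolding w0_def w1_def w2_def w3_def w4_def by auto
  have convex: "\<bar>w * a\<bar> \<le> w * r" if "w \<ge> 0" "\<bar>a\<bar> \<le> r" for w a
    using that by (simp add: abs_mult mult_left_mono)
  have "\<bar>(d k l + d (k - 1) l) / 2\<bar> \<le> r" using d[of k l] d[of "k - 1" l] by auto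
  moreover have "\<bar>knot_mean n v (d k) l\<bar> \<le> r" "\<bar>knot_mean n v (d k) (l - 1)\<bar> \<le> r"
    "\<bar>knot_mean n v (d (k - 1)) l\<bar> \<le> r" "\<bar>knot_mean n v (d (k - 1)) (l - 1)\<bar> \<le> r"
    using l d by (auto intro!: knot_mean_bound[OF K])
  ultimately have "\<bar>w0 * ((d k l + d (k - 1) l) / 2) + w1 * knot_mean n v (d k) l + w2 * knot_mean n v (d k) (l - 1)
      + w3 * knot_mean n v (d (k - 1)) l + w4 * knot_mean n v (d (k - 1)) (l - 1)\<bar>
    \<le> w0 * r + w1 * r + w2 * r + w3 * r + w4 * r"
    using w by (intro abs_triangle_ineq[THEN order_trans] add_mono convex)
  also have "\<dots> = r" by (simp add: w0_def algebra_simps)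
  finally show ?thesis
    by (simp add: cell_mean_def w0_def w1_def w2_def w3_def w4_def)
qed

lemma cell_mean_diff:
  "cell_mean n v (\<lambda>i j. d i j - e i j) k l \<xi> \<eta> = cell_mean n v d k l \<xi> \<eta> - cell_mean n v e k l \<xi> \<eta>"
proof -
  have k: "knot_mean n v (\<lambda>j. d j - e j) l = knot_mean n v d l - knot_mean n v e l" for d e l
    by (simp add: knot_mean_def right_diff_distrib diff_divide_distrib[symmetric])
  have h: "(d k l - e k l + (d (k - 1) l - e (k - 1) l)) / 2 = (d k l + d (k - 1) l) / 2 - (e k l + e (k - 1) l) / 2"
    by (simp add: field_simps)
  show ?thesis unfolding cell_mean_def k h by (simp add: right_diff_distrib)
qed

section \<open>Reproduction of affine functions and quadratic polynomials\<close>

lemma pt_inner: "k \<in> {0..m} \<Longrightarrow> pt m u k = u k"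
  by (simp add: pt_def)

lemma mid_step:
  "mid m u (k + 1) - mid m u k = (step m u k + step m u (k + 1)) / 2"
  "mid m u k = pt m u k - step m u k / 2" "mid m u (k + 1) = pt m u k + step m u (k + 1) / 2"
  by (simp_all add: mid_def step_def field_simps)

lemma knot_mean_affine:
  assumes K: "knots n v" and l: "l \<in> {0..n}"
  shows "knot_mean n v (\<lambda>j. a + b * mid n v j) l = a + b * v l"
proof -
  define A B where "A = step n v (l + 1)" and "B = step n v l"
  have "B + A > 0" unfolding A_def B_def using step_sum_pos[OF K l] .
  moreover have ms: "mid n v l = v l - B / 2" "mid n v (l + 1) = v l + A / 2"
    unfolding A_def B_def using mid_step(2)[of n v l] mid_step(3)[of n v l] pt_inner[OF l] by auto
  ultimately show ?thesis
    unfolding knot_mean_def A_def[symmetric] B_def[symmetric] ms by (simp add: field_simps)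
qed

text \<open>Data sampled at the points \<open>(pt m u i, mid n v j)\<close> are interpolated to the
  exact corner and centre values, and linear interpolation on the triangles is exact for affine
  functions.\<close>

lemma cell_mean_affine:
  assumes K: "knots m u" "knots n v" and k: "k \<in> {1..m}" and l: "l \<in> {1..n}"
  shows "cell_mean n v (\<lambda>i j. a0 + a1 * pt m u i + a2 * mid n v j) k l (loc u (k - 1) x) (loc v (l - 1) y)
    = a0 + a1 * x + a2 * y"
proof -
  define \<xi> \<eta> where "\<xi> = loc u (k - 1) x" and "\<eta> = loc v (l - 1) y"
  define p q where "p = (u k - u (k - 1)) / 2" and "q = (v l - v (l - 1)) / 2"
  define X Y where "X = (u (k - 1) + u k) / 2" and "Y = (v (l - 1) + v l) / 2"
  have pt: "pt m u k = X + p" "pt m u (k - 1) = X - p" "v l = Y + q" "v (l - 1) = Y - q" "mid n v l = Y"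
    using k l by (simp_all add: pt_inner X_def Y_def p_def q_def mid_def field_simps)
  have mean: "knot_mean n v (\<lambda>j. a0 + a1 * c + a2 * mid n v j) l' = a0 + a1 * c + a2 * v l'"
    if "l' \<in> {0..n}" for c l'
    by (rule knot_mean_affine[OF K(2) that])
  have "x = u (k - 1) + (1 + \<xi>) / 2 * (u (k - 1 + 1) - u (k - 1))" "y = v (l - 1) + (1 + \<eta>) / 2 * (v (l - 1 + 1) - v (l - 1))"
    unfolding \<xi>_def \<eta>_def using k l knots_less[OF K(1), of "k - 1"] knots_less[OF K(2), of "l - 1"]
    by (intro loc_inverse; simp)+
  then have xy: "x = X + p * \<xi>" "y = Y + q * \<eta>" by (simp_all add: X_def Y_def p_def q_def field_simps)
  define A B where "A = \<bar>\<xi> + \<eta>\<bar>" and "B = \<bar>\<xi> - \<eta>\<bar>"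
  have AB: "\<bar>- \<xi> - \<eta>\<bar> = A" "\<bar>\<eta> - \<xi>\<bar> = B" by (auto simp: A_def B_def)
  have ll: "l \<in> {0..n}" "l - 1 \<in> {0..n}" using l by auto
  have "cell_mean n v (\<lambda>i j. a0 + a1 * pt m u i + a2 * mid n v j) k l \<xi> \<eta> = a0 + a1 * x + a2 * y"
    unfolding cell_mean_def mean[OF ll(1)] mean[OF ll(2)] pt xy
      corner_weight_def A_def[symmetric] B_def[symmetric] AB
    by (simp add: field_simps)
  then show ?thesis by (simp only: \<xi>_def \<eta>_def)
qed

lemma mid_mono: "knots m u \<Longrightarrow> mid m u k \<le> mid m u (k + 1)"
  using mid_step(1)[of m u k] step_nonneg[of m u k] step_nonneg[of m u "k + 1"] by simp

lemma pt_mem: "knots m u \<Longrightarrow> pt m u k \<in> {u 0..u m}"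
  by (auto simp: pt_def knots_def intro!: knots_le[of m u])

lemma mid_mem: "knots m u \<Longrightarrow> mid m u k \<in> {u 0..u m}"
  using pt_mem[of m u k] pt_mem[of m u "k - 1"] by (auto simp: mid_def)

text \<open>The coefficients are polar form values: \<open>mid m u i\<close> for x and
  \<open>pt m u (i - 1) * pt m u i\<close> for the square of x. In the difference of two consecutive
  products \<open>pt m u k\<close> is a common factor, and the other factor is the divisor of the
  slope.\<close>

lemma slope_of_exact:
  assumes K: "knots m u" and k: "k \<in> {0..m}"
    and c: "\<And>i. i \<in> {k, k + 1} \<Longrightarrow> c i j = a0 * mid m u i + a1 * (pt m u (i - 1) * pt m u i / 2) + a2 * (mid m u i * t)"
  shows "slope m u c k j = a0 + a1 * pt m u k + a2 * t"
proof -
  define d where "d = step m u k + step m u (k + 1)"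
  have d: "d > 0" unfolding d_def by (rule step_sum_pos[OF K k])
  have m: "mid m u (k + 1) - mid m u k = d / 2" unfolding d_def by (rule mid_step)
  have p: "pt m u (k + 1) - pt m u (k - 1) = d" by (simp add: d_def step_def)
  have "c (k + 1) j - c k j = (a0 + a2 * t) * (mid m u (k + 1) - mid m u k)
      + a1 * pt m u k * (pt m u (k + 1) - pt m u (k - 1)) / 2"
    using c[of k] c[of "k + 1"] by (simp add: field_simps)
  also have "\<dots> = (a0 + a1 * pt m u k + a2 * t) * d / 2" unfolding m p by (simp add: field_simps)
  finally have "2 * (c (k + 1) j - c k j) = (a0 + a1 * pt m u k + a2 * t) * d" by simp
  then show ?thesis using d unfolding slope_def d_def[symmetric] by simp
qed

text \<open>\<open>P\<close>, \<open>H\<close>, \<open>N\<close> are the previous, current and next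
  steps, and the two fractions are the negated weights of the outer nodes. Both have the same first
  moment \<kappa>, since \<open>\<sigma> * (P + H)\<close> and \<open>\<tau> * (H + N)\<close> both
  equal \<open>H\<close>. Their sum is \<open>\<sigma> * \<tau>\<close>.\<close>

lemma coefficient_identities:
  fixes P H N :: real
  assumes "P \<ge> 0" "H > 0" "N \<ge> 0"
  defines "\<sigma> \<equiv> H / (P + H)" and "\<tau> \<equiv> H / (H + N)" and "\<kappa> \<equiv> H\<^sup>2 / (2 * (P + 2 * H + N))"
  shows "\<sigma>\<^sup>2 * \<tau> / (\<sigma> + \<tau>) * ((P + H) / 2) = \<kappa>" "\<sigma> * \<tau>\<^sup>2 / (\<sigma> + \<tau>) * ((H + N) / 2) = \<kappa>"
    and "\<sigma>\<^sup>2 * \<tau> / (\<sigma> + \<tau>) \<ge> 0" "\<sigma> * \<tau>\<^sup>2 / (\<sigma> + \<tau>) \<ge> 0"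
    and "\<sigma>\<^sup>2 * \<tau> / (\<sigma> + \<tau>) + \<sigma> * \<tau>\<^sup>2 / (\<sigma> + \<tau>) \<le> 1"
    and "\<kappa> \<le> H / 4" "\<kappa> * (P + 2 * H + N) = H\<^sup>2 / 2"
proof -
  have st: "\<sigma> > 0" "\<tau> > 0" "\<sigma> \<le> 1" "\<tau> \<le> 1" using assms(1-3) by (auto simp: \<sigma>_def \<tau>_def)
  have PH: "P + H > 0" "H + N > 0" "P + 2 * H + N > 0" using assms(1-3) by auto
  have sP: "\<sigma> * (P + H) = H" and tN: "\<tau> * (H + N) = H" using PH by (auto simp: \<sigma>_def \<tau>_def)
  show k: "\<kappa> * (P + 2 * H + N) = H\<^sup>2 / 2" 
  proof -
    have "H\<^sup>2 / (2 * T) * T = H\<^sup>2 / 2" if "T > 0" for T using that by simp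
    from this[OF PH(3)] show ?thesis by (simp only: \<kappa>_def)
  qed
  have "\<sigma> * \<tau> * (P + 2 * H + N) = (\<sigma> * (P + H)) * \<tau> + \<sigma> * (\<tau> * (H + N))" by (simp add: algebra_simps)
  also have "\<dots> = H * (\<sigma> + \<tau>)" unfolding sP tN by (simp add: algebra_simps)
  finally have q: "\<sigma> * \<tau> / (\<sigma> + \<tau>) = H / (P + 2 * H + N)" using PH st by (simp add: field_simps)
  have \<kappa>: "\<kappa> = H / 2 * (\<sigma> * \<tau> / (\<sigma> + \<tau>))" unfolding q \<kappa>_def by (simp add: power2_eq_square)
  have "s\<^sup>2 * t / r * (x / 2) = s * x / 2 * (s * t / r)" for s t r x :: real
    by (simp add: power2_eq_square mult_ac)
  then show "\<sigma>\<^sup>2 * \<tau> / (\<sigma> + \<tau>) * ((P + H) / 2) = \<kappa>" by (simp only: sP \<kappa>)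
  have "s * t\<^sup>2 / r * (x / 2) = t * x / 2 * (s * t / r)" for s t r x :: real
    by (simp add: power2_eq_square mult_ac)
  then show "\<sigma> * \<tau>\<^sup>2 / (\<sigma> + \<tau>) * ((H + N) / 2) = \<kappa>" by (simp only: tN \<kappa>)
  show "\<sigma>\<^sup>2 * \<tau> / (\<sigma> + \<tau>) \<ge> 0" "\<sigma> * \<tau>\<^sup>2 / (\<sigma> + \<tau>) \<ge> 0" using st by auto
  have "\<sigma>\<^sup>2 * \<tau> + \<sigma> * \<tau>\<^sup>2 = \<sigma> * \<tau> * (\<sigma> + \<tau>)" by (simp add: algebra_simps power2_eq_square)
  then have "\<sigma>\<^sup>2 * \<tau> / (\<sigma> + \<tau>) + \<sigma> * \<tau>\<^sup>2 / (\<sigma> + \<tau>) = \<sigma> * \<tau>"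
    using st by (simp add: add_divide_distrib[symmetric])
  also have "\<dots> \<le> 1" using st by (simp add: mult_le_one)
  finally show "\<sigma>\<^sup>2 * \<tau> / (\<sigma> + \<tau>) + \<sigma> * \<tau>\<^sup>2 / (\<sigma> + \<tau>) \<le> 1" .
  have "H\<^sup>2 / 2 \<le> H / 4 * (P + 2 * H + N)"
    using assms(1-3) by (simp add: power2_eq_square algebra_simps)
  then have "\<kappa> * (P + 2 * H + N) \<le> H / 4 * (P + 2 * H + N)" using k by simp
  then show "\<kappa> \<le> H / 4" using PH(3) by (rule mult_right_le_imp_le)
qed

text \<open>The common first moment: the modulus of \<open>acoef\<close> or \<open>ccoef\<close>
  times the distance from the midpoint to the corresponding neighbour.\<close>

definition kappa :: "int \<Rightarrow> (int \<Rightarrow> real) \<Rightarrow> int \<Rightarrow> real" where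
  "kappa m u i = (step m u i)\<^sup>2 / (2 * (step m u (i - 1) + 2 * step m u i + step m u (i + 1)))"

text \<open>With zero steps outside the partition the prescribed end values 1 and 0 become instances
  of the interior quotient.\<close>

lemma sigma_eq:
  assumes K: "knots m u" and i: "i \<in> {1..m + 1}"
  shows "sigma m u i = step m u i / (step m u (i - 1) + step m u i)"
    and "sigma' m u i = step m u (i - 1) / (step m u (i - 1) + step m u i)"
proof -
  have pos: "step m u (i - 1) + step m u i > 0" using step_sum_pos[OF K, of "i - 1"] i by auto
  show s: "sigma m u i = step m u i / (step m u (i - 1) + step m u i)"
    using step_outer[OF K, of "i - 1"] step_outer[OF K, of i] pos by (auto simp: sigma_def)
  show "sigma' m u i = step m u (i - 1) / (step m u (i - 1) + step m u i)"
    unfolding sigma'_def s using pos by (simp add: field_simps)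
qed

lemma acoef_ccoef:
  assumes K: "knots m u"
  shows "acoef m u i * (mid m u i - mid m u (i - 1)) = - kappa m u i" (is ?a)
    and "ccoef m u i * (mid m u (i + 1) - mid m u i) = - kappa m u i" (is ?c)
    and "acoef m u i \<le> 0" "ccoef m u i \<le> 0" "- acoef m u i - ccoef m u i \<le> 1"
    and "0 \<le> kappa m u i" "kappa m u i \<le> step m u i / 4"
    and "kappa m u i * (mid m u (i + 1) - mid m u (i - 1)) = (step m u i)\<^sup>2 / 4" (is ?k)
proof -
  have s: "mid m u i - mid m u (i - 1) = (step m u (i - 1) + step m u i) / 2"
    "mid m u (i + 1) - mid m u i = (step m u i + step m u (i + 1)) / 2"
    using mid_step(1)[of m u "i - 1"] mid_step(1)[of m u i] by simp_all
  have s2: "mid m u (i + 1) - mid m u (i - 1) = (step m u (i - 1) + 2 * step m u i + step m u (i + 1)) / 2"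
    using s by (simp add: field_simps)
  have "?a \<and> ?c \<and> acoef m u i \<le> 0 \<and> ccoef m u i \<le> 0 \<and> - acoef m u i - ccoef m u i \<le> 1
    \<and> 0 \<le> kappa m u i \<and> kappa m u i \<le> step m u i / 4 \<and> ?k"
  proof (cases "1 \<le> i \<and> i \<le> m")
    case True
    then have i: "i \<in> {1..m}" by simp
    note c = coefficient_identities[OF step_nonneg[OF K, of "i - 1"] step_inner(2)[OF K i] step_nonneg[OF K, of "i + 1"]]
    have sg: "sigma m u i = step m u i / (step m u (i - 1) + step m u i)"
      "sigma' m u (i + 1) = step m u i / (step m u i + step m u (i + 1))"
      using sigma_eq[OF K, of i] sigma_eq[OF K, of "i + 1"] True by auto
    note c' = c[folded sg kappa_def]
    have a: "acoef m u i = - ((sigma m u i)\<^sup>2 * sigma' m u (i + 1) / (sigma m u i + sigma' m u (i + 1)))"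
      and b: "ccoef m u i = - (sigma m u i * (sigma' m u (i + 1))\<^sup>2 / (sigma m u i + sigma' m u (i + 1)))"
      using True by (simp_all add: acoef_def ccoef_def)
    have "0 \<le> kappa m u i" using step_nonneg[OF K] by (simp add: kappa_def)
    moreover have "kappa m u i * ((step m u (i - 1) + 2 * step m u i + step m u (i + 1)) / 2) = (step m u i)\<^sup>2 / 4"
      using c'(7) by linarith
    ultimately show ?thesis
      using c'(3-6) unfolding s s2 a b mult_minus_left c'(1,2) by simp
  next
    case False
    then have "step m u i = 0" using step_outer[OF K] by auto
    then show ?thesis using False by (auto simp: acoef_def ccoef_def kappa_def)
  qed
  then show ?a ?c "acoef m u i \<le> 0" "ccoef m u i \<le> 0" "- acoef m u i - ccoef m u i \<le> 1"
    "0 \<le> kappa m u i" "kappa m u i \<le> step m u i / 4" ?k by blast+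
qed

section \<open>Slopes of the quasi-interpolation functionals\<close>

lemma mu_increments:
  "mu m u n v f i j = f (mid m u i, mid n v j)
     + acoef m u i * (f (mid m u (i - 1), mid n v j) - f (mid m u i, mid n v j))
     + ccoef m u i * (f (mid m u (i + 1), mid n v j) - f (mid m u i, mid n v j))
     + acoef n v j * (f (mid m u i, mid n v (j - 1)) - f (mid m u i, mid n v j))
     + ccoef n v j * (f (mid m u i, mid n v (j + 1)) - f (mid m u i, mid n v j))"
  unfolding mu_def Let_def by (simp add: algebra_simps)

lemma mu_add: "mu m u n v (\<lambda>z. f z + g z) i j = mu m u n v f i j + mu m u n v g i j"
  unfolding mu_def Let_def by (simp add: algebra_simps)

lemma mu_star_add: "mu_star m u n v (\<lambda>z. f z + g z) i j = mu_star m u n v f i j + mu_star m u n v g i j"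
  unfolding mu_star_def Let_def by (simp add: algebra_simps)

lemma slope_add: "slope m u (\<lambda>i j. c i j + e i j) k j = slope m u c k j + slope m u e k j"
  by (simp add: slope_def add_divide_distrib[symmetric] algebra_simps)

text \<open>The quadratic polynomials without a pure \<open>y\<close> part; their \<open>x\<close>-derivatives are all affine functions.\<close>

definition quad :: "real \<Rightarrow> real \<Rightarrow> real \<Rightarrow> real \<times> real \<Rightarrow> real" where
  "quad a0 a1 a2 = (\<lambda>(x, y). a0 * x + a1 * (x * x / 2) + a2 * (x * y))"

text \<open>The equal first moments cancel every linear contribution. The quadratic one subtracts a
  quarter of the squared step from the square of the midpoint, which leaves the product of the end
  points of the cell. In the second variable \<open>quad\<close> is affine, so nothing
  remains.\<close>

lemma mu_quad:
  assumes K: "knots m u" "knots n v"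
  shows "mu m u n v (quad a0 a1 a2) i j =
    a0 * mid m u i + a1 * (pt m u (i - 1) * pt m u i / 2) + a2 * (mid m u i * mid n v j)"
proof -
  define s t where "s = mid m u" and "t = mid n v"
  note A = acoef_ccoef[OF K(1), of i, folded s_def] and B = acoef_ccoef[OF K(2), of j, folded t_def]
  have x: "quad a0 a1 a2 (p, t j) - quad a0 a1 a2 (s i, t j) = (p - s i) * (a0 + a1 * (p + s i) / 2 + a2 * t j)" for p
    by (simp add: quad_def field_simps)
  have y: "quad a0 a1 a2 (s i, q) - quad a0 a1 a2 (s i, t j) = (q - t j) * (a2 * s i)" for q
    by (simp add: quad_def field_simps)
  have a: "acoef m u i * ((s (i - 1) - s i) * e) = kappa m u i * e" for e
    using A(1) by (metis minus_diff_eq mult.assoc mult_minus_right minus_minus)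
  have c: "ccoef m u i * ((s (i + 1) - s i) * e) = - kappa m u i * e" for e
    using A(2) by (metis mult.assoc)
  have a': "acoef n v j * ((t (j - 1) - t j) * e) = kappa n v j * e" for e
    using B(1) by (metis minus_diff_eq mult.assoc mult_minus_right minus_minus)
  have c': "ccoef n v j * ((t (j + 1) - t j) * e) = - kappa n v j * e" for e
    using B(2) by (metis mult.assoc)
  have "mu m u n v (quad a0 a1 a2) i j = quad a0 a1 a2 (s i, t j)
      - a1 / 2 * (kappa m u i * (s (i + 1) - s (i - 1)))"
    unfolding mu_increments s_def[symmetric] t_def[symmetric] x y a c a' c' by (simp add: field_simps)
  also have "\<dots> = a0 * s i + a1 / 2 * (s i * s i - (step m u i)\<^sup>2 / 4) + a2 * (s i * t j)"
    unfolding A(8) by (simp add: quad_def field_simps)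
  also have "s i * s i - (step m u i)\<^sup>2 / 4 = pt m u (i - 1) * pt m u i"
    by (simp add: s_def mid_def step_def power2_eq_square field_simps)
  finally show ?thesis by (simp add: s_def t_def)
qed

text \<open>For the square of x, twice the squared midpoint minus the mean of the two squared end
  points is the product of the end points.\<close>

lemma mu_star_quad:
  "mu_star m u n v (quad a0 a1 a2) i j =
    a0 * mid m u i + a1 * (pt m u (i - 1) * pt m u i / 2) + a2 * (mid m u i * mid n v j)"
  unfolding mu_star_def Let_def quad_def prod.case mid_def by (simp add: field_simps)

lemma slope_le:
  assumes K: "knots m u" and k: "k \<in> {0..m}"
    and le: "\<bar>c (k + 1) j - c k j\<bar> \<le> (mid m u (k + 1) - mid m u k) * r"
  shows "\<bar>slope m u c k j\<bar> \<le> r"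
proof -
  define d where "d = step m u k + step m u (k + 1)"
  have d: "d > 0" unfolding d_def by (rule step_sum_pos[OF K k])
  have "\<bar>c (k + 1) j - c k j\<bar> \<le> d / 2 * r" using le unfolding mid_step(1) d_def by simp
  moreover have "\<bar>2 * x / d\<bar> \<le> r" if "\<bar>x\<bar> \<le> d / 2 * r" for x
  proof -
    have "\<bar>2 * x / d\<bar> = 2 * \<bar>x\<bar> / d" using d by (simp add: abs_mult)
    also have "\<dots> \<le> r" using that d by (simp add: divide_le_eq mult.commute)
    finally show ?thesis .
  qed
  ultimately show ?thesis unfolding slope_def d_def[symmetric] by blast
qed

text \<open>The weight is 4 = 1 + 1 + 2: the increment between the two midpoints, the horizontal
  corrections, which together cost at most one more such length because \<open>kappa\<close> is at
  most a quarter of a step, and the vertical corrections, whose total weight is at most 1 and each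
  of which is a difference of two increments.\<close>

lemma slope_mu_bound:
  assumes K: "knots m u" "knots n v" and k: "k \<in> {0..m}" and r: "r \<ge> 0"
    and g1: "\<And>i. i \<in> {k - 1, k, k + 1} \<Longrightarrow>
       \<bar>g (mid m u (i + 1), mid n v j) - g (mid m u i, mid n v j)\<bar> \<le> (mid m u (i + 1) - mid m u i) * r"
    and g2: "\<And>q. q \<in> {j - 1, j + 1} \<Longrightarrow>
       \<bar>g (mid m u (k + 1), mid n v q) - g (mid m u k, mid n v q)\<bar> \<le> (mid m u (k + 1) - mid m u k) * r"
  shows "\<bar>slope m u (mu m u n v g) k j\<bar> \<le> 4 * r"
proof (rule slope_le[OF K(1) k])
  define s t where "s = mid m u" and "t = mid n v"
  define e where "e i q = g (s (i + 1), t q) - g (s i, t q)" for i q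
  define a c where "a = acoef m u" and "c = ccoef m u"
  define a' c' where "a' = acoef n v j" and "c' = ccoef n v j"
  define \<Delta> where "\<Delta> i = s (i + 1) - s i" for i
  have e1: "\<bar>e i j\<bar> \<le> \<Delta> i * r" if "i \<in> {k - 1, k, k + 1}" for i
    using g1[OF that] by (simp add: e_def \<Delta>_def s_def t_def)
  have e2: "\<bar>e k q\<bar> \<le> \<Delta> k * r" if "q \<in> {j - 1, j + 1}" for q
    using g2[OF that] by (simp add: e_def \<Delta>_def s_def t_def)
  \<comment> \<open>The vertical coefficients depend on \<open>j\<close> only and are the same at
    \<open>k\<close> and \<open>k + 1\<close>, so the vertical terms regroup into differences of
    horizontal increments at two heights.\<close>
  have eq: "mu m u n v g (k + 1) j - mu m u n v g k j =
      e k j + (- a (k + 1)) * e k j + c (k + 1) * e (k + 1) j + a k * e (k - 1) j + (- c k) * e k j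
      + a' * (e k (j - 1) - e k j) + c' * (e k (j + 1) - e k j)"
    unfolding mu_increments e_def a_def c_def a'_def c'_def s_def t_def by (simp add: algebra_simps)
  note A0 = acoef_ccoef[OF K(1), of k, folded s_def a_def c_def] and A1 = acoef_ccoef[OF K(1), of "k + 1", folded s_def a_def c_def]
    and B = acoef_ccoef[OF K(2), of j, folded a'_def c'_def]
  \<comment> \<open>A coefficient is measured together with the length of its increment. The product
    is \<open>kappa\<close>, which is controlled by the current step whatever the neighbouring steps
    are.\<close>
  have scale: "\<bar>w * z\<bar> \<le> \<kappa> * r" if "\<bar>w\<bar> * d = \<kappa>" "\<bar>z\<bar> \<le> d * r" for w z d \<kappa>
    using mult_left_mono[OF that(2), of "\<bar>w\<bar>"] unfolding that(1)[symmetric] by (simp add: abs_mult mult.assoc)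
  have t: "\<bar>(- a (k + 1)) * e k j\<bar> \<le> kappa m u (k + 1) * r"
    by (rule scale[OF _ e1]) (use A1(1,3) in \<open>auto simp: \<Delta>_def abs_of_nonpos\<close>)
  have t': "\<bar>c (k + 1) * e (k + 1) j\<bar> \<le> kappa m u (k + 1) * r"
    by (rule scale[OF _ e1]) (use A1(2,4) in \<open>auto simp: \<Delta>_def abs_of_nonpos\<close>)
  have t'': "\<bar>a k * e (k - 1) j\<bar> \<le> kappa m u k * r"
    by (rule scale[OF _ e1]) (use A0(1,3) in \<open>auto simp: \<Delta>_def abs_of_nonpos\<close>)
  have t''': "\<bar>(- c k) * e k j\<bar> \<le> kappa m u k * r"
    by (rule scale[OF _ e1]) (use A0(2,4) in \<open>auto simp: \<Delta>_def abs_of_nonpos\<close>)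
  have D: "\<Delta> k = (step m u k + step m u (k + 1)) / 2" by (simp add: \<Delta>_def s_def mid_step(1))
  have diff: "\<bar>e k q - e k j\<bar> \<le> 2 * (\<Delta> k * r)" if "q \<in> {j - 1, j + 1}" for q
    using e2[OF that] e1[of k] by auto
  have y: "\<bar>a' * (e k (j - 1) - e k j)\<bar> \<le> - a' * (2 * (\<Delta> k * r))"
    "\<bar>c' * (e k (j + 1) - e k j)\<bar> \<le> - c' * (2 * (\<Delta> k * r))"
    unfolding abs_mult using B(3,4) diff by (auto simp: abs_of_nonpos intro!: mult_left_mono_neg)
  have "\<bar>mu m u n v g (k + 1) j - mu m u n v g k j\<bar> \<le> \<Delta> k * r + kappa m u (k + 1) * r + kappa m u (k + 1) * r
      + kappa m u k * r + kappa m u k * r + (- a' * (2 * (\<Delta> k * r))) + (- c' * (2 * (\<Delta> k * r)))"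
    unfolding eq using e1[of k] t t' t'' t''' y
    by (intro abs_triangle_ineq[THEN order_trans] add_mono) auto
  also have "\<dots> = \<Delta> k * r + (2 * kappa m u (k + 1) + 2 * kappa m u k) * r + (- a' - c') * (2 * (\<Delta> k * r))"
    by (simp add: algebra_simps)
  also have "\<dots> \<le> \<Delta> k * r + \<Delta> k * r + 1 * (2 * (\<Delta> k * r))"
  proof (intro add_mono mult_right_mono order_refl r)
    show "2 * kappa m u (k + 1) + 2 * kappa m u k \<le> \<Delta> k" unfolding D using A0(7) A1(7) by simp
    show "- a' - c' \<le> 1" by (rule B(5))
    show "0 \<le> 2 * (\<Delta> k * r)" using mid_mono[OF K(1), of k] r by (simp add: \<Delta>_def s_def)
  qed
  finally show "\<bar>mu m u n v g (k + 1) j - mu m u n v g k j\<bar> \<le> (mid m u (k + 1) - mid m u k) * (4 * r)"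
    by (simp add: \<Delta>_def s_def mult_ac)
qed

text \<open>The vertices on the column \<open>k\<close> are common to both functionals and cancel.
  There remain twice an increment between midpoints and, with weight one quarter each, two
  increments across both cells, of double length.\<close>

lemma slope_mu_star_bound:
  assumes K: "knots m u" and k: "k \<in> {0..m}"
    and g1: "\<bar>g (mid m u (k + 1), mid n v j) - g (mid m u k, mid n v j)\<bar> \<le> (mid m u (k + 1) - mid m u k) * r"
    and g2: "\<And>q. q \<in> {j - 1, j} \<Longrightarrow>
       \<bar>g (pt m u (k + 1), pt n v q) - g (pt m u (k - 1), pt n v q)\<bar> \<le> (pt m u (k + 1) - pt m u (k - 1)) * r'"
  shows "\<bar>slope m u (mu_star m u n v g) k j\<bar> \<le> 2 * r + r'"
proof (rule slope_le[OF K k])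
  define e where "e q = g (pt m u (k + 1), pt n v q) - g (pt m u (k - 1), pt n v q)" for q
  define \<Delta> where "\<Delta> = mid m u (k + 1) - mid m u k"
  have p: "pt m u (k + 1) - pt m u (k - 1) = 2 * \<Delta>" by (simp add: \<Delta>_def mid_def field_simps)
  have e: "\<bar>e q\<bar> \<le> 2 * (\<Delta> * r')" if "q \<in> {j - 1, j}" for q
    using g2[OF that] unfolding p by (simp add: e_def)
  have eq: "mu_star m u n v g (k + 1) j - mu_star m u n v g k j =
     2 * (g (mid m u (k + 1), mid n v j) - g (mid m u k, mid n v j)) - (e (j - 1) + e j) / 4"
    unfolding mu_star_def Let_def e_def by (simp add: field_simps)
  have "\<bar>mu_star m u n v g (k + 1) j - mu_star m u n v g k j\<bar> \<le> 2 * (\<Delta> * r) + (2 * (\<Delta> * r') + 2 * (\<Delta> * r')) / 4"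
  proof -
    have "\<bar>2 * a - (b + c) / 4\<bar> \<le> 2 * A + (B + B) / 4" if "\<bar>a\<bar> \<le> A" "\<bar>b\<bar> \<le> B" "\<bar>c\<bar> \<le> B" for a b c A B :: real
      using that unfolding abs_le_iff add_divide_distrib by linarith
    from this[OF g1[folded \<Delta>_def] e e] show ?thesis unfolding eq by simp
  qed
  then show "\<bar>mu_star m u n v g (k + 1) j - mu_star m u n v g k j\<bar> \<le> (mid m u (k + 1) - mid m u k) * (2 * r + r')"
    unfolding \<Delta>_def[symmetric] by (simp add: algebra_simps)
qed

section \<open>From affine approximation of the derivative to the error of the spline\<close>

lemma increment_bound:
  assumes der: "\<And>x y. (x, y) \<in> domain m u n v \<Longrightarrow> ((\<lambda>s. f (s, y)) has_field_derivative \<phi> (x, y)) (at x within {u 0..u m})"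
    and p: "p \<in> {u 0..u m}" "q \<in> {u 0..u m}" "p \<le> q" "y \<in> {v 0..v n}"
    and b: "\<And>s. s \<in> {p..q} \<Longrightarrow> \<bar>\<phi> (s, y) - (a0 + a1 * s + a2 * y)\<bar> \<le> r"
  shows "\<bar>(f (q, y) - quad a0 a1 a2 (q, y)) - (f (p, y) - quad a0 a1 a2 (p, y))\<bar> \<le> (q - p) * r"
proof -
  have "((\<lambda>s. f (s, y) - quad a0 a1 a2 (s, y)) has_field_derivative \<phi> (s, y) - (a0 + a1 * s + a2 * y)) (at s within {p..q})"
    if s: "s \<in> {p..q}" for s
  proof -
    have "((\<lambda>s. f (s, y)) has_field_derivative \<phi> (s, y)) (at s within {u 0..u m})"
      using s p by (intro der) (auto simp: domain_def)
    then have "((\<lambda>s. f (s, y)) has_field_derivative \<phi> (s, y)) (at s within {p..q})"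
      by (rule has_field_derivative_subset) (use p in auto)
    then show ?thesis unfolding quad_def prod.case
      by (auto intro!: derivative_eq_intros)
  qed
  then have "norm ((f (q, y) - quad a0 a1 a2 (q, y)) - (f (p, y) - quad a0 a1 a2 (p, y))) \<le> r * norm (q - p)"
    by (rule field_differentiable_bound[OF convex_real_interval(5)]) (use b p in auto)
  then show ?thesis using p by (simp add: mult.commute)
qed

lemma mid_distance:
  assumes K: "knots m u" and h: "\<And>i. step m u i \<le> h" and s: "s \<in> {mid m u i..mid m u j}"
  shows "\<bar>s - mid m u k\<bar> \<le> of_int (max \<bar>i - k\<bar> \<bar>j - k\<bar>) * h"
proof -
  have h0: "h \<ge> 0" using h[of 0] step_nonneg[OF K, of 0] by linarith
  have up: "\<bar>mid m u (k + int d) - mid m u k\<bar> \<le> real d * h" for k d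
  proof (induction d)
    case (Suc d)
    have "mid m u (k + int d + 1) - mid m u (k + int d) \<le> h" "mid m u (k + int d + 1) \<ge> mid m u (k + int d)"
      using mid_step(1)[of m u "k + int d"] h[of "k + int d"] h[of "k + int d + 1"] mid_mono[OF K] by auto
    then show ?case using Suc by (simp add: algebra_simps)
  qed simp
  have dist: "\<bar>mid m u i - mid m u k\<bar> \<le> of_int \<bar>i - k\<bar> * h" for i
  proof (cases "i \<ge> k")
    case True
    then show ?thesis using up[of k "nat (i - k)"] by simp
  next
    case False
    then show ?thesis using up[of i "nat (k - i)"] by (simp add: abs_minus_commute)
  qed
  have "of_int \<bar>i - k\<bar> * h \<le> of_int (max \<bar>i - k\<bar> \<bar>j - k\<bar>) * h" "of_int \<bar>j - k\<bar> * h \<le> of_int (max \<bar>i - k\<bar> \<bar>j - k\<bar>) * h"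
    using h0 by (intro mult_right_mono; simp)+
  then have "\<bar>mid m u i - mid m u k\<bar> \<le> of_int (max \<bar>i - k\<bar> \<bar>j - k\<bar>) * h"
    "\<bar>mid m u j - mid m u k\<bar> \<le> of_int (max \<bar>i - k\<bar> \<bar>j - k\<bar>) * h"
    using dist order_trans by blast+
  then show ?thesis using s unfolding abs_le_iff by auto
qed

lemma pt_distance:
  assumes K: "knots m u" and h: "\<And>i. step m u i \<le> h" and s: "s \<in> {pt m u (k - 2)..pt m u (k + 1)}"
  shows "\<bar>s - mid m u k\<bar> \<le> 3 / 2 * h"
proof -
  have "pt m u (k + 1) = pt m u k + step m u (k + 1)" "pt m u k = mid m u k + step m u k / 2"
    "pt m u (k - 2) = pt m u (k - 1) - step m u (k - 1)" "pt m u (k - 1) = mid m u k - step m u k / 2"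
    by (simp_all add: step_def mid_def field_simps)
  then show ?thesis using s h[of k] h[of "k - 1"] h[of "k + 1"]
    unfolding abs_le_iff atLeastAtMost_iff by linarith
qed

lemma pt_mono: "knots m u \<Longrightarrow> i \<le> j \<Longrightarrow> pt m u i \<le> pt m u j"
  unfolding pt_def by (rule knots_le[of m u]) (auto simp: knots_def)

lemma Dx_domain:
  assumes K: "knots m u" and xy: "(x, y) \<in> domain m u n v"
    and der: "((\<lambda>s. f (s, y)) has_field_derivative d) (at x within {u 0..u m})"
  shows "Dx (domain m u n v) f (x, y) = d"
proof -
  have "{s. (s, y) \<in> domain m u n v} = {u 0..u m}" using xy by (auto simp: domain_def)
  moreover have "u 0 < u m" using K by (auto simp: knots_def strict_mono_on_def)
  ultimately show ?thesis
    using xy der unfolding Dx_def prod.case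
    by (simp add: vector_derivative_within_closed_interval has_real_derivative_iff_has_vector_derivative domain_def)
qed

text \<open>The mean reproduces the affine function, so the slope errors enter only through a convex
  combination; \<open>r0\<close> is the error of the affine function at the point itself.\<close>

lemma quasi_error:
  assumes K: "knots m u" "knots n v" and k: "k \<in> {1..m}" and l: "l \<in> {1..n}"
    and x: "x \<in> {u (k - 1)..u k}" and y: "y \<in> {v (l - 1)..v l}"
    and slope: "\<And>i j. i \<in> {k - 1, k} \<Longrightarrow> j \<in> {l - 1, l, l + 1} \<Longrightarrow>
        \<bar>slope m u c i j - (a0 + a1 * pt m u i + a2 * mid n v j)\<bar> \<le> r"
    and \<phi>: "\<bar>\<phi> - (a0 + a1 * x + a2 * y)\<bar> \<le> r0"
  shows "\<bar>\<phi> - Dx (domain m u n v) (\<lambda>z. \<Sum>i = 0..m + 1. \<Sum>j = 0..n + 1. c i j * bspline m u n v i j z) (x, y)\<bar> \<le> r0 + r"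
proof -
  define \<xi> \<eta> where "\<xi> = loc u (k - 1) x" and "\<eta> = loc v (l - 1) y"
  have b: "\<bar>\<xi>\<bar> \<le> 1" "\<bar>\<eta>\<bar> \<le> 1"
    unfolding \<xi>_def \<eta>_def
    using x y k l knots_less[OF K(1), of "k - 1"] knots_less[OF K(2), of "l - 1"] by (auto intro!: loc_bounds)
  have xy: "(x, y) \<in> domain m u n v"
    using x y k l knots_le[OF K(1), of 0 "k - 1"] knots_le[OF K(1), of k m]
      knots_le[OF K(2), of 0 "l - 1"] knots_le[OF K(2), of l n]
    by (auto simp: domain_def)
  have Dx: "Dx (domain m u n v) (\<lambda>z. \<Sum>i = 0..m + 1. \<Sum>j = 0..n + 1. c i j * bspline m u n v i j z) (x, y) =
      cell_mean n v (slope m u c) k l \<xi> \<eta>"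
    unfolding \<xi>_def \<eta>_def
    by (rule Dx_domain[OF K(1) xy]) (rule has_field_derivative_at_within[OF quasi_has_derivative[OF K k l x y]])
  have "\<bar>cell_mean n v (\<lambda>i j. slope m u c i j - (a0 + a1 * pt m u i + a2 * mid n v j)) k l \<xi> \<eta>\<bar> \<le> r"
    by (rule cell_mean_bound[OF K(2) l b slope])
  then have "\<bar>cell_mean n v (slope m u c) k l \<xi> \<eta> - (a0 + a1 * x + a2 * y)\<bar> \<le> r"
    unfolding cell_mean_diff using cell_mean_affine[OF K k l, of a0 a1 a2 x y] by (simp add: \<xi>_def \<eta>_def)
  then show ?thesis using \<phi> unfolding Dx by linarith
qed

lemma interval_index:
  assumes K: "knots m u" and x: "x \<in> {u 0..u m}"
  obtains k where "k \<in> {1..m}" "x \<in> {u (k - 1)..u k}"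
proof -
  have "\<exists>k\<in>{1..int d}. x \<in> {u (k - 1)..u k}" if "x \<in> {u 0..u (int d)}" "d \<ge> 1" for d
    using that
  proof (induction d)
    case (Suc d)
    show ?case
    proof (cases "d \<ge> 1 \<and> x \<le> u (int d)")
      case True
      then have "\<exists>k\<in>{1..int d}. x \<in> {u (k - 1)..u k}" using Suc by auto
      then show ?thesis by force
    next
      case False
      then have "x \<in> {u (int (Suc d) - 1)..u (int (Suc d))}" using Suc.prems by (cases "d = 0") auto
      then show ?thesis by (intro bexI[of _ "int (Suc d)"]) auto
    qed
  qed simp
  moreover have "int (nat m) = m" "nat m \<ge> 1" using K by (auto simp: knots_def)
  ultimately have "\<exists>k\<in>{1..m}. x \<in> {u (k - 1)..u k}" using x by metis
  then show ?thesis using that by blast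
qed

text \<open>Local approximability of \<open>\<phi>\<close> by affine functions, with a remainder that grows quadratically
  in the \<open>l\<^sup>1\<close>-distance measured in units of \<open>h\<close>. It holds both for \<open>\<phi> \<in> C\<^sup>1\<close> with
  \<open>\<rho> = 2 h \<omega>(D\<phi>, h/2)\<close> and for \<open>\<phi> \<in> C\<^sup>2\<close> with \<open>\<rho> = h\<^sup>2 \<parallel>D\<^sup>2\<phi>\<parallel> / 2\<close>.\<close>

definition affinely_approximable ::
  "(real \<times> real) set \<Rightarrow> real \<Rightarrow> real \<Rightarrow> (real \<times> real \<Rightarrow> real) \<Rightarrow> bool" where
  "affinely_approximable X h \<rho> \<phi> \<longleftrightarrow> (\<forall>(x0, y0)\<in>X. \<exists>a0 a1 a2. \<forall>(x, y)\<in>X. \<forall>t\<in>{1, 2, 3}.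
     \<bar>x - x0\<bar> + \<bar>y - y0\<bar> \<le> t * h \<longrightarrow> \<bar>\<phi> (x, y) - (a0 + a1 * x + a2 * y)\<bar> \<le> t\<^sup>2 * \<rho>)"

text \<open>From the centre of the cell the point is within h, all increments used by
  \<open>S2\<close> within 3h, and for \<open>W2_star\<close> those between midpoints within 2h and
  those between vertices within 3h. With the weights 4, and 2 and 1, this gives 1 + 4 * 9 and 1 + 2
  * 4 + 9.\<close>

lemma local_error:
  assumes K: "knots m u" "knots n v"
    and h: "\<And>i. step m u i \<le> h" "\<And>j. step n v j \<le> h"
    and der: "\<And>x y. (x, y) \<in> domain m u n v \<Longrightarrow> ((\<lambda>s. f (s, y)) has_field_derivative \<phi> (x, y)) (at x within {u 0..u m})"
    and \<phi>: "affinely_approximable (domain m u n v) h \<rho> \<phi>" and \<rho>: "\<rho> \<ge> 0"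
    and xy: "(x, y) \<in> domain m u n v"
  shows "\<bar>\<phi> (x, y) - Dx (domain m u n v) (S2 m u n v f) (x, y)\<bar> \<le> 37 * \<rho>" (is ?S)
    and "\<bar>\<phi> (x, y) - Dx (domain m u n v) (W2_star m u n v f) (x, y)\<bar> \<le> 18 * \<rho>" (is ?W)
proof -
  have h0: "h \<ge> 0" using h(1)[of 0] step_nonneg[OF K(1), of 0] by linarith
  obtain k where k: "k \<in> {1..m}" "x \<in> {u (k - 1)..u k}"
    using xy by (auto simp: domain_def intro: interval_index[OF K(1)])
  obtain l where l: "l \<in> {1..n}" "y \<in> {v (l - 1)..v l}"
    using xy by (auto simp: domain_def intro: interval_index[OF K(2)])
  have "(mid m u k, mid n v l) \<in> domain m u n v" using mid_mem[OF K(1)] mid_mem[OF K(2)] by (auto simp: domain_def)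
  then obtain a0 a1 a2 where near': "\<forall>(x, y)\<in>domain m u n v. \<forall>t\<in>{1, 2, 3}.
     \<bar>x - mid m u k\<bar> + \<bar>y - mid n v l\<bar> \<le> t * h \<longrightarrow> \<bar>\<phi> (x, y) - (a0 + a1 * x + a2 * y)\<bar> \<le> t\<^sup>2 * \<rho>"
    using \<phi> unfolding affinely_approximable_def by fast
  have near: "\<bar>\<phi> (x, y) - (a0 + a1 * x + a2 * y)\<bar> \<le> t\<^sup>2 * \<rho>"
    if "x \<in> {u 0..u m}" "y \<in> {v 0..v n}" "t = 1 \<or> t = 2 \<or> t = 3" "\<bar>x - mid m u k\<bar> + \<bar>y - mid n v l\<bar> \<le> t * h" for x y t
    using near' that by (auto simp: domain_def)
  define g where "g z = f z - quad a0 a1 a2 z" for z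
  have inc: "\<bar>g (q, y) - g (p, y)\<bar> \<le> (q - p) * r"
    if "p \<in> {u 0..u m}" "q \<in> {u 0..u m}" "p \<le> q" "y \<in> {v 0..v n}"
      "\<And>s. s \<in> {p..q} \<Longrightarrow> \<bar>\<phi> (s, y) - (a0 + a1 * s + a2 * y)\<bar> \<le> r" for p q y r
    unfolding g_def by (rule increment_bound[OF der that]) auto
  have fg: "f = (\<lambda>z. quad a0 a1 a2 z + g z)" by (simp add: g_def)
  note mx = mid_mem[OF K(1)] and my = mid_mem[OF K(2)] and px = pt_mem[OF K(1)] and py = pt_mem[OF K(2)]
  note dx = mid_distance[OF K(1) h(1), where k = k] and dy = mid_distance[OF K(2) h(2), where k = l]
  have 0: "\<bar>\<phi> (x, y) - (a0 + a1 * x + a2 * y)\<bar> \<le> 1\<^sup>2 * \<rho>"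
  proof (rule near)
    have "\<bar>x - mid m u k\<bar> \<le> h / 2" "\<bar>y - mid n v l\<bar> \<le> h / 2"
      using k l h(1)[of k] h(2)[of l]
      by (auto simp: mid_def step_def pt_inner abs_le_iff field_simps)
    then show "\<bar>x - mid m u k\<bar> + \<bar>y - mid n v l\<bar> \<le> 1 * h" by linarith
  qed (use xy in \<open>auto simp: domain_def\<close>)
  have inc_mid: "\<bar>g (mid m u (i + 1), mid n v j) - g (mid m u i, mid n v j)\<bar> \<le> (mid m u (i + 1) - mid m u i) * ((of_int t)\<^sup>2 * \<rho>)"
    if t: "t = 1 \<or> t = 2 \<or> t = 3" and d: "max \<bar>i - k\<bar> \<bar>i + 1 - k\<bar> + \<bar>j - l\<bar> \<le> t" for i j t
  proof (rule inc[OF mx mx mid_mono[OF K(1)] my])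
    fix s assume s: "s \<in> {mid m u i..mid m u (i + 1)}"
    have "\<bar>s - mid m u k\<bar> + \<bar>mid n v j - mid n v l\<bar> \<le> of_int (max \<bar>i - k\<bar> \<bar>i + 1 - k\<bar>) * h + of_int \<bar>j - l\<bar> * h"
      using dx[OF s] dy[of "mid n v j" j j] by simp
    also have "\<dots> = of_int (max \<bar>i - k\<bar> \<bar>i + 1 - k\<bar> + \<bar>j - l\<bar>) * h"
      by (simp only: distrib_right of_int_add)
    also have "\<dots> \<le> of_int t * h" by (rule mult_right_mono[OF _ h0]) (use d in \<open>simp only: of_int_le_iff\<close>)
    finally show "\<bar>\<phi> (s, mid n v j) - (a0 + a1 * s + a2 * mid n v j)\<bar> \<le> (of_int t)\<^sup>2 * \<rho>"
      using s t mx[of i] mx[of "i + 1"] my[of j] by (intro near) auto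
  qed
  have inc_pt: "\<bar>g (pt m u (i + 1), pt n v j) - g (pt m u (i - 1), pt n v j)\<bar> \<le> (pt m u (i + 1) - pt m u (i - 1)) * (3\<^sup>2 * \<rho>)"
    if i: "i \<in> {k - 1, k}" and j: "j \<in> {l - 2, l - 1, l, l + 1}" for i j
  proof (rule inc[OF px px _ py])
    show "pt m u (i - 1) \<le> pt m u (i + 1)" by (rule pt_mono[OF K(1)]) simp
    fix s assume s: "s \<in> {pt m u (i - 1)..pt m u (i + 1)}"
    have "pt m u (k - 2) \<le> pt m u (i - 1)" "pt m u (i + 1) \<le> pt m u (k + 1)"
      "pt n v (l - 2) \<le> pt n v j" "pt n v j \<le> pt n v (l + 1)"
      using i j by (auto intro!: pt_mono K)
    then have "s \<in> {pt m u (k - 2)..pt m u (k + 1)}" "pt n v j \<in> {pt n v (l - 2)..pt n v (l + 1)}"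
      using s by auto
    then have "\<bar>s - mid m u k\<bar> \<le> 3 / 2 * h" "\<bar>pt n v j - mid n v l\<bar> \<le> 3 / 2 * h"
      using pt_distance[OF K(1) h(1)] pt_distance[OF K(2) h(2)] by blast+
    then show "\<bar>\<phi> (s, pt n v j) - (a0 + a1 * s + a2 * pt n v j)\<bar> \<le> 3\<^sup>2 * \<rho>"
      using s px[of "i - 1"] px[of "i + 1"] py[of j] by (intro near) auto
  qed
  have exact: "slope m u c i j = a0 + a1 * pt m u i + a2 * mid n v j"
    if "i \<in> {k - 1, k}"
      "\<And>i j. c i j = a0 * mid m u i + a1 * (pt m u (i - 1) * pt m u i / 2) + a2 * (mid m u i * mid n v j)" for c i j
    by (rule slope_of_exact[OF K(1)]) (use k that in auto)
  have "\<bar>slope m u (mu m u n v f) i j - (a0 + a1 * pt m u i + a2 * mid n v j)\<bar> \<le> 4 * (3\<^sup>2 * \<rho>)"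
    if ij: "i \<in> {k - 1, k}" "j \<in> {l - 1, l, l + 1}" for i j
  proof -
    have "slope m u (mu m u n v f) i j = (a0 + a1 * pt m u i + a2 * mid n v j) + slope m u (mu m u n v g) i j"
      using exact[OF ij(1), of "mu m u n v (quad a0 a1 a2)" j] mu_quad[OF K]
        slope_add[of m u "mu m u n v (quad a0 a1 a2)" "mu m u n v g" i j]
      unfolding fg mu_add[abs_def] by simp
    moreover have "\<bar>slope m u (mu m u n v g) i j\<bar> \<le> 4 * (3\<^sup>2 * \<rho>)"
    proof (rule slope_mu_bound[OF K])
      show "\<bar>g (mid m u (p + 1), mid n v j) - g (mid m u p, mid n v j)\<bar> \<le> (mid m u (p + 1) - mid m u p) * (3\<^sup>2 * \<rho>)"
        if "p \<in> {i - 1, i, i + 1}" for p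
        using inc_mid[of 3 p j] that ij by auto
      show "\<bar>g (mid m u (i + 1), mid n v q) - g (mid m u i, mid n v q)\<bar> \<le> (mid m u (i + 1) - mid m u i) * (3\<^sup>2 * \<rho>)"
        if "q \<in> {j - 1, j + 1}" for q
        using inc_mid[of 3 i q] that ij by auto
    qed (use k ij \<rho> in auto)
    ultimately show ?thesis by simp
  qed
  from quasi_error[OF K k(1) l(1) k(2) l(2) this 0] show ?S
    by (simp add: S2_def[abs_def])
  have "\<bar>slope m u (mu_star m u n v f) i j - (a0 + a1 * pt m u i + a2 * mid n v j)\<bar> \<le> 2 * (2\<^sup>2 * \<rho>) + 3\<^sup>2 * \<rho>"
    if ij: "i \<in> {k - 1, k}" "j \<in> {l - 1, l, l + 1}" for i j
  proof -
    have "slope m u (mu_star m u n v f) i j = (a0 + a1 * pt m u i + a2 * mid n v j) + slope m u (mu_star m u n v g) i j"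
      using exact[OF ij(1), of "mu_star m u n v (quad a0 a1 a2)" j] mu_star_quad
        slope_add[of m u "mu_star m u n v (quad a0 a1 a2)" "mu_star m u n v g" i j]
      unfolding fg mu_star_add[abs_def] by simp
    moreover have "\<bar>slope m u (mu_star m u n v g) i j\<bar> \<le> 2 * (2\<^sup>2 * \<rho>) + 3\<^sup>2 * \<rho>"
    proof (rule slope_mu_star_bound[OF K(1)])
      show "\<bar>g (mid m u (i + 1), mid n v j) - g (mid m u i, mid n v j)\<bar> \<le> (mid m u (i + 1) - mid m u i) * (2\<^sup>2 * \<rho>)"
        using inc_mid[of 2 i j] ij by auto
      show "\<bar>g (pt m u (i + 1), pt n v q) - g (pt m u (i - 1), pt n v q)\<bar> \<le> (pt m u (i + 1) - pt m u (i - 1)) * (3\<^sup>2 * \<rho>)"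
        if "q \<in> {j - 1, j}" for q
        by (rule inc_pt) (use that ij in auto)
    qed (use k ij in auto)
    ultimately show ?thesis by simp
  qed
  from quasi_error[OF K k(1) l(1) k(2) l(2) this 0] show ?W
    by (simp add: W2_star_def[abs_def])
qed

section \<open>Affine approximation of the gradient\<close>

lemma mvt_within:
  fixes f :: "real \<Rightarrow> real"
  assumes "a < b" and "\<And>x. x \<in> {a..b} \<Longrightarrow> (f has_field_derivative f' x) (at x within {a..b})"
  obtains x where "x \<in> {a..b}" "f b - f a = (b - a) * f' x"
proof -
  have "\<exists>x\<in>{a<..<b}. f b - f a = f' x * (b - a)"
    using assms by (intro mvt_simple[of a b f "\<lambda>x. (*) (f' x)"]) (auto simp: has_field_derivative_def)
  then obtain x where "x \<in> {a<..<b}" "f b - f a = f' x * (b - a)" by blast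
  then show ?thesis by (intro that[of x]) (auto simp: mult.commute)
qed

lemma first_order_bound:
  fixes f :: "real \<Rightarrow> real"
  assumes der: "\<And>s. s \<in> {a..b} \<Longrightarrow> (f has_field_derivative f' s) (at s within {a..b})"
    and p: "p \<in> {a..b}" "q \<in> {a..b}" and w: "\<And>s. s \<in> closed_segment p q \<Longrightarrow> \<bar>f' s - c\<bar> \<le> w"
  shows "\<bar>f q - f p - c * (q - p)\<bar> \<le> w * \<bar>q - p\<bar>"
proof -
  have sub: "closed_segment p q \<subseteq> {a..b}" using p by (auto simp: closed_segment_eq_real_ivl)
  have "norm ((f q - c * q) - (f p - c * p)) \<le> w * norm (q - p)"
  proof (rule field_differentiable_bound)
    show "((\<lambda>s. f s - c * s) has_field_derivative f' s - c) (at s within closed_segment p q)"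
      if "s \<in> closed_segment p q" for s
      using has_field_derivative_subset[OF der sub, of s] that sub
      by (auto intro!: derivative_eq_intros)
  qed (use w in auto)
  then show ?thesis by (simp add: algebra_simps)
qed

text \<open>Instead of integrating, a sign argument: \<open>w * (s - p)\<^sup>2 / 2\<close> plus or
  minus the remainder has a derivative with the sign of \<open>s - p\<close>, so it is minimal at
  \<open>p\<close>.\<close>

lemma second_order_bound:
  fixes f :: "real \<Rightarrow> real"
  assumes der: "\<And>s. s \<in> {a..b} \<Longrightarrow> (f has_field_derivative f' s) (at s within {a..b})"
    and der': "\<And>s. s \<in> {a..b} \<Longrightarrow> (f' has_field_derivative f'' s) (at s within {a..b})"
    and bound: "\<And>s. s \<in> {a..b} \<Longrightarrow> \<bar>f'' s\<bar> \<le> w"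
    and p: "p \<in> {a..b}" "q \<in> {a..b}"
  shows "\<bar>f q - f p - f' p * (q - p)\<bar> \<le> w * (q - p)\<^sup>2 / 2"
proof -
  have lin: "\<bar>f' s - f' p\<bar> \<le> w * \<bar>s - p\<bar>" if "s \<in> {a..b}" for s
  proof -
    have "\<bar>f' s - f' p - 0 * (s - p)\<bar> \<le> w * \<bar>s - p\<bar>"
      by (rule first_order_bound[OF der' p(1) that])
         (use bound p that in \<open>auto simp: closed_segment_eq_real_ivl split: if_splits\<close>)
    then show ?thesis by simp
  qed
  \<comment> \<open>The number \<open>e\<close> carries the sign, so that both halves of the
    absolute value are proved at once.\<close>
  have "0 \<le> w * (q - p)\<^sup>2 / 2 + e * (f q - f p - f' p * (q - p))" if e: "e = 1 \<or> e = -1" for e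
  proof -
    define g where "g s = w * (s - p)\<^sup>2 / 2 + e * (f s - f' p * s)" for s
    define g' where "g' s = w * (s - p) + e * (f' s - f' p)" for s
    have g: "(g has_field_derivative g' s) (at s within {a'..b'})" if "s \<in> {a'..b'}" "{a'..b'} \<subseteq> {a..b}" for s a' b'
    proof -
      have "(f has_field_derivative f' s) (at s within {a'..b'})"
        using has_field_derivative_subset[OF der that(2), of s] that by auto
      then show ?thesis unfolding g_def g'_def
        by (auto intro!: derivative_eq_intros simp: field_simps)
    qed
    have "g q \<ge> g p"
    proof (cases "q = p")
      case False
      then consider "p < q" | "q < p" by linarith
      then show ?thesis
      proof cases
        case 1
        then obtain s where s: "s \<in> {p..q}" "g q - g p = (q - p) * g' s"
          using mvt_within[of p q g g'] g[of _ p q] p by auto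
        have "g' s \<ge> 0" unfolding g'_def using lin[of s] s p e by auto
        then have "g q - g p \<ge> 0" unfolding s(2) using 1 by simp
        then show ?thesis by simp
      next
        case 2
        then obtain s where s: "s \<in> {q..p}" "g p - g q = (p - q) * g' s"
          using mvt_within[of q p g g'] g[of _ q p] p by auto
        have "w * (p - s) = - (w * (s - p))" by (simp add: algebra_simps)
        then have "g' s \<le> 0" unfolding g'_def using lin[of s] s p e by (auto simp: abs_minus_commute)
        then have "g p - g q \<le> 0" unfolding s(2) using 2 by (simp add: mult_nonneg_nonpos)
        then show ?thesis by simp
      qed
    qed simp
    then show ?thesis by (simp add: g_def algebra_simps)
  qed
  from this[of 1] this[of "-1"] show ?thesis by (intro abs_leI) auto
qed

section \<open>Partial derivatives on a closed rectangle and their symmetry\<close>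

lemma has_partial_derivatives:
  fixes a b c d :: real
  assumes f: "Ck (Suc k) ({a..b} \<times> {c..d}) f" and xy: "x \<in> {a..b}" "y \<in> {c..d}" and lt: "a < b" "c < d"
  shows "((\<lambda>s. f (s, y)) has_field_derivative Dx ({a..b} \<times> {c..d}) f (x, y)) (at x within {a..b})"
    and "((\<lambda>t. f (x, t)) has_field_derivative Dy ({a..b} \<times> {c..d}) f (x, y)) (at y within {c..d})"
proof -
  have s: "{s. (s, y) \<in> {a..b} \<times> {c..d}} = {a..b}" "{t. (x, t) \<in> {a..b} \<times> {c..d}} = {c..d}" using xy by auto
  have "(x, y) \<in> {a..b} \<times> {c..d}" using xy by auto
  with f have "(\<lambda>s. f (s, y)) differentiable (at x within {s. (s, y) \<in> {a..b} \<times> {c..d}})"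
    "(\<lambda>t. f (x, t)) differentiable (at y within {t. (x, t) \<in> {a..b} \<times> {c..d}})"
    unfolding Ck.simps by blast+
  then show "((\<lambda>s. f (s, y)) has_field_derivative Dx ({a..b} \<times> {c..d}) f (x, y)) (at x within {a..b})"
    "((\<lambda>t. f (x, t)) has_field_derivative Dy ({a..b} \<times> {c..d}) f (x, y)) (at y within {c..d})"
    unfolding Dx_def Dy_def prod.case s has_real_derivative_iff_has_vector_derivative
    by (simp_all add: vector_derivative_works[symmetric])
qed

lemma vector_derivative_cong_on:
  assumes "x \<in> S" "\<And>s. s \<in> S \<Longrightarrow> f s = g s"
  shows "vector_derivative f (at x within S) = vector_derivative g (at x within S)"
proof -
  have "(f has_vector_derivative l) (at x within S) \<longleftrightarrow> (g has_vector_derivative l) (at x within S)" for l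
    using assms has_vector_derivative_transform[of x S f g l] has_vector_derivative_transform[of x S g f l] by auto
  then show ?thesis by (simp add: vector_derivative_def)
qed

text \<open>Derivatives within \<open>X\<close> see only the values on \<open>X\<close>. Hence an
  identity known only there, such as the symmetry of mixed partials, can be differentiated
  again.\<close>

lemma D_cong:
  assumes "\<And>z. z \<in> X \<Longrightarrow> f z = g z" "z \<in> X"
  shows "Dx X f z = Dx X g z" "Dy X f z = Dy X g z"
  using assms by (auto simp: Dx_def Dy_def split: prod.splits intro!: vector_derivative_cong_on)

text \<open>The mean value theorem is applied to the difference of \<open>f\<close> on the two
  horizontal sides, and once more to \<open>Dx f\<close> on a vertical segment.\<close>

lemma rectangle_increment:
  fixes a b c d :: real
  assumes f: "Ck 2 ({a..b} \<times> {c..d}) f" and lt: "a < b" "c < d"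
    and r: "x1 < x2" "y1 < y2" "{x1..x2} \<subseteq> {a..b}" "{y1..y2} \<subseteq> {c..d}"
  obtains p q where "p \<in> {x1..x2}" "q \<in> {y1..y2}"
    "f (x2, y2) - f (x2, y1) - f (x1, y2) + f (x1, y1) =
       (x2 - x1) * ((y2 - y1) * Dy ({a..b} \<times> {c..d}) (Dx ({a..b} \<times> {c..d}) f) (p, q))"
proof -
  let ?X = "{a..b} \<times> {c..d}"
  have f1: "Ck (Suc 1) ?X f" "Ck (Suc 0) ?X (Dx ?X f)" using f by (simp_all add: numeral_2_eq_2)
  have y: "y1 \<in> {c..d}" "y2 \<in> {c..d}" using r by auto
  have "((\<lambda>s. f (s, y2) - f (s, y1)) has_field_derivative Dx ?X f (s, y2) - Dx ?X f (s, y1)) (at s within {x1..x2})"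
    if "s \<in> {x1..x2}" for s
    using that r y by (intro DERIV_diff has_field_derivative_subset[OF has_partial_derivatives(1)[OF f1(1) _ _ lt]]) auto
  then obtain p where p: "p \<in> {x1..x2}"
    "(f (x2, y2) - f (x2, y1)) - (f (x1, y2) - f (x1, y1)) = (x2 - x1) * (Dx ?X f (p, y2) - Dx ?X f (p, y1))"
    by (rule mvt_within[OF r(1)]) auto
  have "((\<lambda>t. Dx ?X f (p, t)) has_field_derivative Dy ?X (Dx ?X f) (p, t)) (at t within {y1..y2})"
    if "t \<in> {y1..y2}" for t
    using that r p by (intro has_field_derivative_subset[OF has_partial_derivatives(2)[OF f1(2) _ _ lt]]) auto
  then obtain q where q: "q \<in> {y1..y2}"
    "Dx ?X f (p, y2) - Dx ?X f (p, y1) = (y2 - y1) * Dy ?X (Dx ?X f) (p, q)"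
    by (rule mvt_within[OF r(2)]) auto
  show ?thesis by (rule that[OF p(1) q(1)]) (use p q in simp)
qed

lemma Dx_Dy_transpose:
  "Dx (B \<times> A) (\<lambda>z. f (snd z, fst z)) (y, x) = Dy (A \<times> B) f (x, y)"
  "Dy (B \<times> A) (\<lambda>z. f (snd z, fst z)) (y, x) = Dx (A \<times> B) f (x, y)"
  unfolding Dx_def Dy_def by (simp_all add: conj_commute)

lemma Dx_Dy_transpose':
  "Dx (B \<times> A) (\<lambda>z. f (snd z, fst z)) = (\<lambda>z. Dy (A \<times> B) f (snd z, fst z))"
  "Dy (B \<times> A) (\<lambda>z. f (snd z, fst z)) = (\<lambda>z. Dx (A \<times> B) f (snd z, fst z))"
  by (auto simp: Dx_Dy_transpose)

lemma continuous_on_transpose: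
  assumes "continuous_on (A \<times> B) f"
  shows "continuous_on (B \<times> A) (\<lambda>z. f (snd z, fst z))"
proof -
  have c: "continuous_on (B \<times> A) (\<lambda>z. (snd z, fst z))" by (intro continuous_intros)
  show ?thesis by (rule continuous_on_compose2[OF assms c]) auto
qed

lemma Ck_transpose:
  "Ck k (A \<times> B) f \<Longrightarrow> Ck k (B \<times> A) (\<lambda>z. f (snd z, fst z))"
proof (induction k arbitrary: f)
  case 0
  then show ?case by (simp add: continuous_on_transpose)
next
  case (Suc k)
  then show ?case
    by (auto simp: Dx_Dy_transpose' conj_commute intro: continuous_on_transpose)
qed

text \<open>\<open>D\<close> contains the mixed derivatives in one order only. On small rectangles
  near \<open>z\<close> the second difference is a value of either mixed derivative times the area,
  and continuity at \<open>z\<close> makes the two agree.\<close>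

lemma mixed_partials_commute:
  fixes a b c d :: real
  assumes f: "Ck 2 ({a..b} \<times> {c..d}) f" and lt: "a < b" "c < d" and z: "z \<in> {a..b} \<times> {c..d}"
  shows "Dy ({a..b} \<times> {c..d}) (Dx ({a..b} \<times> {c..d}) f) z = Dx ({a..b} \<times> {c..d}) (Dy ({a..b} \<times> {c..d}) f) z"
proof (rule ccontr)
  let ?X = "{a..b} \<times> {c..d}"
  let ?F = "Dy ?X (Dx ?X f)" and ?G = "Dx ?X (Dy ?X f)"
  assume ne: "?F z \<noteq> ?G z"
  define e where "e = \<bar>?F z - ?G z\<bar> / 2"
  have e: "e > 0" using ne by (simp add: e_def)
  have cont: "continuous_on ?X ?F" "continuous_on ?X ?G"
    using f by (simp_all add: numeral_2_eq_2)
  obtain r1 where r1: "r1 > 0" "\<And>w. w \<in> ?X \<Longrightarrow> dist w z < r1 \<Longrightarrow> dist (?F w) (?F z) < e"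
    using cont(1) z e unfolding continuous_on_iff by blast
  obtain r2 where r2: "r2 > 0" "\<And>w. w \<in> ?X \<Longrightarrow> dist w z < r2 \<Longrightarrow> dist (?G w) (?G z) < e"
    using cont(2) z e unfolding continuous_on_iff by blast
  define r where "r = min r1 r2"
  have r: "r > 0" using r1 r2 by (simp add: r_def)
  \<comment> \<open>Clipping to the interval keeps the small rectangle inside the domain and
    nondegenerate also when \<open>z\<close> lies on the boundary.\<close>
  have sub: "\<exists>p q. p < q \<and> {p..q} \<subseteq> {l..h} \<and> (\<forall>t\<in>{p..q}. \<bar>t - s\<bar> < r / 2)" if "l < h" "s \<in> {l..h}" for l h s :: real
  proof -
    define p q where "p = max l (s - r / 3)" and "q = min h (s + r / 3)"
    have "p < q" using that r by (auto simp: p_def q_def)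
    moreover have "{p..q} \<subseteq> {l..h}" by (auto simp: p_def q_def)
    moreover have "\<bar>t - s\<bar> < r / 2" if "t \<in> {p..q}" for t
    proof -
      have "\<bar>t - s\<bar> \<le> r / 3" using that by (intro abs_leI) (auto simp: p_def q_def)
      then show ?thesis using r by linarith
    qed
    ultimately show ?thesis by blast
  qed
  obtain x y where xy: "z = (x, y)" "x \<in> {a..b}" "y \<in> {c..d}" using z by (cases z) auto
  obtain x1 x2 where x12: "x1 < x2" "{x1..x2} \<subseteq> {a..b}" "\<forall>t\<in>{x1..x2}. \<bar>t - x\<bar> < r / 2"
    using sub[OF lt(1) xy(2)] by blast
  obtain y1 y2 where y12: "y1 < y2" "{y1..y2} \<subseteq> {c..d}" "\<forall>t\<in>{y1..y2}. \<bar>t - y\<bar> < r / 2"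
    using sub[OF lt(2) xy(3)] by blast
  have close: "(p, q) \<in> ?X \<and> dist (p, q) z < r" if "p \<in> {x1..x2}" "q \<in> {y1..y2}" for p q
  proof -
    have "dist (p, q) z \<le> \<bar>p - x\<bar> + \<bar>q - y\<bar>"
      unfolding xy(1) dist_Pair_Pair dist_real_def by (rule sqrt_sum_squares_le_sum_abs[THEN order_trans]) simp
    moreover have "\<bar>p - x\<bar> < r / 2" "\<bar>q - y\<bar> < r / 2" using x12 y12 that by blast+
    ultimately show ?thesis using that x12(2) y12(2) by auto
  qed
  obtain p q where pq: "p \<in> {x1..x2}" "q \<in> {y1..y2}"
    "f (x2, y2) - f (x2, y1) - f (x1, y2) + f (x1, y1) = (x2 - x1) * ((y2 - y1) * ?F (p, q))"
    by (rule rectangle_increment[OF f lt x12(1) y12(1) x12(2) y12(2)])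
  obtain q' p' where pq': "q' \<in> {y1..y2}" "p' \<in> {x1..x2}"
    "f (x2, y2) - f (x1, y2) - f (x2, y1) + f (x1, y1) = (y2 - y1) * ((x2 - x1) * ?G (p', q'))"
    using rectangle_increment[OF Ck_transpose[OF f] lt(2,1) y12(1) x12(1) y12(2) x12(2)]
    by (auto simp: Dx_Dy_transpose')
  have "(x2 - x1) * ((y2 - y1) * ?F (p, q)) = (y2 - y1) * ((x2 - x1) * ?G (p', q'))"
    unfolding pq(3)[symmetric] pq'(3)[symmetric] by simp
  also have "\<dots> = (x2 - x1) * ((y2 - y1) * ?G (p', q'))" by (rule mult.left_commute)
  finally have "?F (p, q) = ?G (p', q')" using x12(1) y12(1) by simp
  moreover have "dist (?F (p, q)) (?F z) < e" "dist (?G (p', q')) (?G z) < e"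
    using r1(2) r2(2) close[OF pq(1,2)] close[OF pq'(2,1)] by (auto simp: r_def)
  ultimately have "\<bar>?F z - ?G z\<bar> < 2 * e" by (simp add: dist_real_def)
  then show False by (simp add: e_def)
qed

section \<open>Moduli of continuity and Taylor remainders\<close>

lemma modulus_ge:
  assumes c: "continuous_on X \<psi>" and X: "compact X" and "M \<in> X" "P \<in> X" "dist M P \<le> t"
  shows "\<bar>\<psi> M - \<psi> P\<bar> \<le> modulus X \<psi> t"
proof -
  obtain B where B: "\<And>z. z \<in> X \<Longrightarrow> \<bar>\<psi> z\<bar> \<le> B"
    using compact_imp_bounded[OF compact_continuous_image[OF c X]] by (auto simp: bounded_iff)
  have "bdd_above {\<bar>\<psi> M - \<psi> P\<bar> | M P. M \<in> X \<and> P \<in> X \<and> dist M P \<le> t}"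
  proof (rule bdd_aboveI[of _ "2 * B"], clarify)
    fix M P assume "M \<in> X" "P \<in> X"
    then show "\<bar>\<psi> M - \<psi> P\<bar> \<le> 2 * B" using B[of M] B[of P] by linarith
  qed
  then show ?thesis
    unfolding modulus_def by (rule cSup_upper[rotated]) (use assms in blast)
qed

text \<open>The segment from \<open>M\<close> to \<open>P\<close> stays in the convex set and is cut
  into \<open>k\<close> equal parts of length at most \<open>t\<close>.\<close>

lemma modulus_multiple:
  assumes c: "continuous_on X \<psi>" and X: "compact X" "convex X" and "M \<in> X" "P \<in> X" "dist M P \<le> real k * t"
  shows "\<bar>\<psi> M - \<psi> P\<bar> \<le> real k * modulus X \<psi> t"
  using assms(4-)
proof (induction k arbitrary: M)
  case (Suc k)
  define w where "w = 1 / real (Suc k)"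
  define R where "R = (1 - w) *\<^sub>R M + w *\<^sub>R P"
  have w: "0 < w" "w \<le> 1" by (simp_all add: w_def)
  have R: "R \<in> X" unfolding R_def using Suc.prems w by (intro convexD[OF X(2)]) auto
  have "M - R = w *\<^sub>R (M - P)" "R - P = (1 - w) *\<^sub>R (M - P)" by (simp_all add: R_def algebra_simps)
  then have "dist M R = w * dist M P" "dist R P = (1 - w) * dist M P" using w by (simp_all add: dist_norm)
  moreover have "w * dist M P \<le> w * (real (Suc k) * t)" "(1 - w) * dist M P \<le> (1 - w) * (real (Suc k) * t)"
    using Suc.prems w by (auto intro: mult_left_mono)
  moreover have "w * (real (Suc k) * t) = t" "(1 - w) * (real (Suc k) * t) = real k * t"
    by (simp_all add: w_def field_simps)
  ultimately have "dist M R \<le> t" "dist R P \<le> real k * t" by linarith+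
  then have "\<bar>\<psi> M - \<psi> R\<bar> \<le> modulus X \<psi> t" "\<bar>\<psi> R - \<psi> P\<bar> \<le> real k * modulus X \<psi> t"
    using modulus_ge[OF c X(1) Suc.prems(1) R] Suc.IH[OF R Suc.prems(2)] by auto
  then show ?case by (simp add: algebra_simps)
qed simp

lemma finite_multi_indices: "finite {\<alpha> :: nat \<times> nat. fst \<alpha> + snd \<alpha> = s}"
  by (rule finite_subset[of _ "{..s} \<times> {..s}"]) auto

lemma modulus_D_ge: "fst \<alpha> + snd \<alpha> = s \<Longrightarrow> modulus X (D X \<alpha> f) t \<le> modulus_D X s f t"
  unfolding modulus_D_def by (rule Max_ge) (auto simp: finite_multi_indices)

lemma norm_D_ge:
  assumes "fst \<alpha> + snd \<alpha> = s" "continuous_on X (D X \<alpha> f)" "compact X" "z \<in> X"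
  shows "\<bar>D X \<alpha> f z\<bar> \<le> norm_D X s f"
proof -
  have "bounded (D X \<alpha> f ` X)" using compact_imp_bounded[OF compact_continuous_image[OF assms(2,3)]] .
  then obtain B where "\<And>z. z \<in> X \<Longrightarrow> \<bar>D X \<alpha> f z\<bar> \<le> B" by (auto simp: bounded_iff)
  then have "\<bar>D X \<alpha> f z\<bar> \<le> sup_norm X (D X \<alpha> f)"
    unfolding sup_norm_def by (intro cSUP_upper bdd_aboveI2[of _ _ B] assms(4))
  also have "\<dots> \<le> norm_D X s f"
    unfolding norm_D_def using assms(1) by (intro Max_ge) (auto simp: finite_multi_indices)
  finally show ?thesis .
qed

lemma dist_le_l1: "dist (p, q) (x, y) \<le> \<bar>p - x\<bar> + \<bar>q - y :: real\<bar>"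
  unfolding dist_Pair_Pair dist_real_def by (rule sqrt_sum_squares_le_sum_abs[THEN order_trans]) simp

text \<open>The affine function is the Taylor polynomial at the base point. Within distance
  \<open>t * h\<close> each partial derivative varies by at most \<open>2 * t * w\<close>, because
  2t steps of length h/2 suffice; a path with one leg per axis contributes a further factor
  \<open>t * h\<close>.\<close>

lemma affinely_approximable_C1:
  fixes a b c d :: real
  assumes \<phi>: "Ck 1 ({a..b} \<times> {c..d}) \<phi>" and lt: "a < b" "c < d" and h: "h \<ge> 0"
    and x: "modulus ({a..b} \<times> {c..d}) (Dx ({a..b} \<times> {c..d}) \<phi>) (h / 2) \<le> w"
    and y: "modulus ({a..b} \<times> {c..d}) (Dy ({a..b} \<times> {c..d}) \<phi>) (h / 2) \<le> w"
  shows "affinely_approximable ({a..b} \<times> {c..d}) h (2 * h * w) \<phi>"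
  unfolding affinely_approximable_def
proof clarify
  let ?X = "{a..b} \<times> {c..d}"
  have \<phi>1: "Ck (Suc 0) ?X \<phi>" using \<phi> by simp
  have X: "compact ?X" "convex ?X" by (auto intro: compact_Times convex_Times)
  fix x0 y0 assume x0: "x0 \<in> {a..b}" and y0: "y0 \<in> {c..d}"
  define p q where "p = Dx ?X \<phi> (x0, y0)" and "q = Dy ?X \<phi> (x0, y0)"
  have "\<bar>\<phi> (x, y) - ((\<phi> (x0, y0) - p * x0 - q * y0) + p * x + q * y)\<bar> \<le> t\<^sup>2 * (2 * h * w)"
    if xy: "x \<in> {a..b}" "y \<in> {c..d}" and t: "t \<in> {1, 2, 3}" and d: "\<bar>x - x0\<bar> + \<bar>y - y0\<bar> \<le> t * h" for x y t
  proof -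
    \<comment> \<open>For \<open>t\<close> in {1, 2, 3} the number 2t of half steps is a natural
      number, so \<open>modulus_multiple\<close> loses nothing by rounding.\<close>
    have "real (nat \<lfloor>2 * t\<rfloor>) = 2 * t" using t by auto
    then obtain k :: nat where k: "real k = 2 * t" by blast
    have near: "\<bar>Dx ?X \<phi> z - p\<bar> \<le> 2 * t * w" "\<bar>Dy ?X \<phi> z - q\<bar> \<le> 2 * t * w"
      if "z \<in> ?X" "dist z (x0, y0) \<le> t * h" for z
    proof -
      have dist: "dist z (x0, y0) \<le> real k * (h / 2)" using that(2) k by simp
      have c: "continuous_on ?X (Dx ?X \<phi>)" "continuous_on ?X (Dy ?X \<phi>)" using \<phi> by auto
      have "\<bar>Dx ?X \<phi> z - p\<bar> \<le> real k * modulus ?X (Dx ?X \<phi>) (h / 2)"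
        unfolding p_def using x0 y0 by (intro modulus_multiple[OF c(1) X that(1) _ dist]) auto
      also have "\<dots> \<le> real k * w" using x by (intro mult_left_mono) auto
      finally show "\<bar>Dx ?X \<phi> z - p\<bar> \<le> 2 * t * w" unfolding k .
      have "\<bar>Dy ?X \<phi> z - q\<bar> \<le> real k * modulus ?X (Dy ?X \<phi>) (h / 2)"
        unfolding q_def using x0 y0 by (intro modulus_multiple[OF c(2) X that(1) _ dist]) auto
      also have "\<dots> \<le> real k * w" using y by (intro mult_left_mono) auto
      finally show "\<bar>Dy ?X \<phi> z - q\<bar> \<le> 2 * t * w" unfolding k .
    qed
    have near0: "0 \<le> 2 * t * w" using near(1)[of "(x0, y0)"] x0 y0 t h by (auto simp: p_def)
    have "\<bar>\<phi> (x, y0) - \<phi> (x0, y0) - p * (x - x0)\<bar> \<le> 2 * t * w * \<bar>x - x0\<bar>"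
    proof (rule first_order_bound[OF has_partial_derivatives(1)[OF \<phi>1 _ y0 lt] x0 xy(1)])
      fix s assume s: "s \<in> closed_segment x0 x"
      then have "s \<in> {a..b}" "\<bar>s - x0\<bar> \<le> \<bar>x - x0\<bar>"
        using x0 xy by (auto simp: closed_segment_eq_real_ivl split: if_splits)
      then show "\<bar>Dx ?X \<phi> (s, y0) - p\<bar> \<le> 2 * t * w"
        using dist_le_l1[of s y0 x0 y0] y0 d by (intro near) auto
    qed
    moreover have "\<bar>\<phi> (x, y) - \<phi> (x, y0) - q * (y - y0)\<bar> \<le> 2 * t * w * \<bar>y - y0\<bar>"
    proof (rule first_order_bound[OF has_partial_derivatives(2)[OF \<phi>1 xy(1) _ lt] y0 xy(2)])
      fix s assume s: "s \<in> closed_segment y0 y"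
      then have "s \<in> {c..d}" "\<bar>s - y0\<bar> \<le> \<bar>y - y0\<bar>"
        using y0 xy by (auto simp: closed_segment_eq_real_ivl split: if_splits)
      then show "\<bar>Dy ?X \<phi> (x, s) - q\<bar> \<le> 2 * t * w"
        using dist_le_l1[of x s x0 y0] xy d by (intro near) auto
    qed
    ultimately have "\<bar>\<phi> (x, y) - ((\<phi> (x0, y0) - p * x0 - q * y0) + p * x + q * y)\<bar>
        \<le> 2 * t * w * (\<bar>x - x0\<bar> + \<bar>y - y0\<bar>)"
      by (simp add: algebra_simps abs_le_iff)
    also have "\<dots> \<le> 2 * t * w * (t * h)" by (rule mult_left_mono[OF d near0])
    finally show ?thesis by (simp add: power2_eq_square algebra_simps)
  qed
  then show "\<exists>a0 a1 a2. \<forall>(x, y)\<in>?X. \<forall>t\<in>{1, 2, 3}. \<bar>x - x0\<bar> + \<bar>y - y0\<bar> \<le> t * h \<longrightarrow>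
      \<bar>\<phi> (x, y) - (a0 + a1 * x + a2 * y)\<bar> \<le> t\<^sup>2 * (2 * h * w)"
    by - (rule exI[of _ "\<phi> (x0, y0) - p * x0 - q * y0"], rule exI[of _ p], rule exI[of _ q], clarify, blast)
qed

text \<open>The two pure remainders and the mixed term add up to w/2 times the square of the l1
  distance. This is why the distance in \<open>affinely_approximable\<close> is l1.\<close>

lemma affinely_approximable_C2:
  fixes a b c d :: real
  assumes \<phi>: "Ck 2 ({a..b} \<times> {c..d}) \<phi>" and lt: "a < b" "c < d" and h: "h \<ge> 0"
    and xx: "\<And>z. z \<in> {a..b} \<times> {c..d} \<Longrightarrow> \<bar>Dx ({a..b} \<times> {c..d}) (Dx ({a..b} \<times> {c..d}) \<phi>) z\<bar> \<le> w"
    and xy: "\<And>z. z \<in> {a..b} \<times> {c..d} \<Longrightarrow> \<bar>Dx ({a..b} \<times> {c..d}) (Dy ({a..b} \<times> {c..d}) \<phi>) z\<bar> \<le> w"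
    and yy: "\<And>z. z \<in> {a..b} \<times> {c..d} \<Longrightarrow> \<bar>Dy ({a..b} \<times> {c..d}) (Dy ({a..b} \<times> {c..d}) \<phi>) z\<bar> \<le> w"
  shows "affinely_approximable ({a..b} \<times> {c..d}) h (h\<^sup>2 * w / 2) \<phi>"
  unfolding affinely_approximable_def
proof clarify
  let ?X = "{a..b} \<times> {c..d}"
  have \<phi>1: "Ck (Suc 1) ?X \<phi>" "Ck (Suc 0) ?X (Dx ?X \<phi>)" "Ck (Suc 0) ?X (Dy ?X \<phi>)"
    using \<phi> by (simp_all add: numeral_2_eq_2)
  fix x0 y0 assume x0: "x0 \<in> {a..b}" and y0: "y0 \<in> {c..d}"
  define p q where "p = Dx ?X \<phi> (x0, y0)" and "q = Dy ?X \<phi> (x0, y0)"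
  have w: "w \<ge> 0" using xx[of "(x0, y0)"] x0 y0 by auto
  have "\<bar>\<phi> (x, y) - ((\<phi> (x0, y0) - p * x0 - q * y0) + p * x + q * y)\<bar> \<le> t\<^sup>2 * (h\<^sup>2 * w / 2)"
    if x: "x \<in> {a..b}" "y \<in> {c..d}" and d: "\<bar>x - x0\<bar> + \<bar>y - y0\<bar> \<le> t * h" for x y t
  proof -
    have A: "\<bar>\<phi> (x, y0) - \<phi> (x0, y0) - p * (x - x0)\<bar> \<le> w * (x - x0)\<^sup>2 / 2"
      unfolding p_def
      by (rule second_order_bound[OF has_partial_derivatives(1)[OF \<phi>1(1) _ y0 lt]
            has_partial_derivatives(1)[OF \<phi>1(2) _ y0 lt] _ x0 x(1)]) (use xx y0 in auto)
    have B: "\<bar>\<phi> (x, y) - \<phi> (x, y0) - Dy ?X \<phi> (x, y0) * (y - y0)\<bar> \<le> w * (y - y0)\<^sup>2 / 2"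
      by (rule second_order_bound[OF has_partial_derivatives(2)[OF \<phi>1(1) x(1) _ lt]
            has_partial_derivatives(2)[OF \<phi>1(3) x(1) _ lt] _ y0 x(2)]) (use yy x in auto)
    have "\<bar>Dy ?X \<phi> (x, y0) - Dy ?X \<phi> (x0, y0) - 0 * (x - x0)\<bar> \<le> w * \<bar>x - x0\<bar>"
      by (rule first_order_bound[OF has_partial_derivatives(1)[OF \<phi>1(3) _ y0 lt] x0 x(1)])
         (use xy y0 x0 x in \<open>auto simp: closed_segment_eq_real_ivl split: if_splits\<close>)
    then have "\<bar>(Dy ?X \<phi> (x, y0) - q) * (y - y0)\<bar> \<le> w * \<bar>x - x0\<bar> * \<bar>y - y0\<bar>"
      unfolding abs_mult q_def by (intro mult_right_mono) auto
    moreover have "\<phi> (x, y) - ((\<phi> (x0, y0) - p * x0 - q * y0) + p * x + q * y) =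
      (\<phi> (x, y0) - \<phi> (x0, y0) - p * (x - x0)) + (\<phi> (x, y) - \<phi> (x, y0) - Dy ?X \<phi> (x, y0) * (y - y0))
      + (Dy ?X \<phi> (x, y0) - q) * (y - y0)" by (simp add: algebra_simps)
    ultimately have "\<bar>\<phi> (x, y) - ((\<phi> (x0, y0) - p * x0 - q * y0) + p * x + q * y)\<bar>
        \<le> w * (x - x0)\<^sup>2 / 2 + w * (y - y0)\<^sup>2 / 2 + w * \<bar>x - x0\<bar> * \<bar>y - y0\<bar>"
      using A B by linarith
    also have "\<dots> = w / 2 * (\<bar>x - x0\<bar> + \<bar>y - y0\<bar>)\<^sup>2"
      by (simp add: power2_sum field_simps)
    also have "\<dots> \<le> w / 2 * (t * h)\<^sup>2" using d w by (intro mult_left_mono power_mono) auto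
    finally show ?thesis by (simp add: power_mult_distrib mult_ac)
  qed
  then show "\<exists>a0 a1 a2. \<forall>(x, y)\<in>?X. \<forall>t\<in>{1, 2, 3}. \<bar>x - x0\<bar> + \<bar>y - y0\<bar> \<le> t * h \<longrightarrow>
      \<bar>\<phi> (x, y) - (a0 + a1 * x + a2 * y)\<bar> \<le> t\<^sup>2 * (h\<^sup>2 * w / 2)"
    by - (rule exI[of _ "\<phi> (x0, y0) - p * x0 - q * y0"], rule exI[of _ p], rule exI[of _ q], clarify, blast)
qed

lemma affinely_approximable_transpose:
  assumes "affinely_approximable (A \<times> B) h \<rho> \<phi>"
  shows "affinely_approximable (B \<times> A) h \<rho> (\<lambda>z. \<phi> (snd z, fst z))"
  unfolding affinely_approximable_def
proof clarify
  fix y0 x0 assume "y0 \<in> B" "x0 \<in> A"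
  then have "(x0, y0) \<in> A \<times> B" by simp
  then obtain a0 a1 a2 where a: "\<forall>(x, y)\<in>A \<times> B. \<forall>t\<in>{1, 2, 3}.
     \<bar>x - x0\<bar> + \<bar>y - y0\<bar> \<le> t * h \<longrightarrow> \<bar>\<phi> (x, y) - (a0 + a1 * x + a2 * y)\<bar> \<le> t\<^sup>2 * \<rho>"
    using assms unfolding affinely_approximable_def by fast
  show "\<exists>a0 a1 a2. \<forall>(x, y)\<in>B \<times> A. \<forall>t\<in>{1, 2, 3}. \<bar>x - y0\<bar> + \<bar>y - x0\<bar> \<le> t * h \<longrightarrow>
      \<bar>\<phi> (snd (x, y), fst (x, y)) - (a0 + a1 * x + a2 * y)\<bar> \<le> t\<^sup>2 * \<rho>"
  proof (rule exI[of _ a0], rule exI[of _ a2], rule exI[of _ a1], clarify)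
    fix x y t assume "x \<in> B" "y \<in> A" "t \<in> {1, 2, 3}" "\<bar>x - y0\<bar> + \<bar>y - x0\<bar> \<le> t * h"
    then have "\<bar>\<phi> (y, x) - (a0 + a1 * y + a2 * x)\<bar> \<le> t\<^sup>2 * \<rho>"
      using a by (auto simp: add.commute)
    then show "\<bar>\<phi> (snd (x, y), fst (x, y)) - (a0 + a2 * x + a1 * y)\<bar> \<le> t\<^sup>2 * \<rho>"
      by (simp add: algebra_simps)
  qed
qed

section \<open>The error of the gradient\<close>

lemma mu_swap: "mu m u n v f i j = mu n v m u (\<lambda>z. f (snd z, fst z)) j i"
  unfolding mu_def Let_def by (simp add: algebra_simps)

lemma mu_star_swap: "mu_star m u n v f i j = mu_star n v m u (\<lambda>z. f (snd z, fst z)) j i"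
  unfolding mu_star_def Let_def by (simp add: algebra_simps)

lemma S2_swap:
  assumes "knots m u" "knots n v"
  shows "S2 n v m u (\<lambda>z. f (snd z, fst z)) = (\<lambda>z. S2 m u n v f (snd z, fst z))"
  unfolding S2_def
  by (rule ext, subst sum.swap, intro sum.cong refl)
     (simp add: mu_swap[of m u n v f] bspline_swap[OF assms])

lemma W2_star_swap:
  assumes "knots m u" "knots n v"
  shows "W2_star n v m u (\<lambda>z. f (snd z, fst z)) = (\<lambda>z. W2_star m u n v f (snd z, fst z))"
  unfolding W2_star_def
  by (rule ext, subst sum.swap, intro sum.cong refl)
     (simp add: mu_star_swap[of m u n v f] bspline_swap[OF assms])

text \<open>The bounds hold for every integer index, as steps outside the partition vanish; the
  distance estimates may thus run past the boundary.\<close>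

lemma step_le_mesh_max:
  assumes "knots m u" "knots n v"
  shows "step m u i \<le> mesh_max m u n v" "step n v j \<le> mesh_max m u n v"
    and "mesh_max m u n v > 0" "mesh_min m u n v > 0" "mesh_min m u n v \<le> mesh_max m u n v"
proof -
  let ?S = "step m u ` {1..m} \<union> step n v ` {1..n}"
  have fin: "finite ?S" by simp
  have ne: "step m u 1 \<in> ?S" using assms by (auto simp: knots_def)
  have pos: "s > 0" if "s \<in> ?S" for s using that step_inner(2) assms by auto
  have le: "s \<le> mesh_max m u n v" if "s \<in> ?S" for s
    unfolding mesh_max_def using Max_ge[OF fin that] .
  show max: "mesh_max m u n v > 0" using le[OF ne] pos[OF ne] by linarith
  show "mesh_min m u n v > 0"
    unfolding mesh_min_def using ne pos by (subst Min_gr_iff) auto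
  show "mesh_min m u n v \<le> mesh_max m u n v"
    using le[OF ne] Min_le[OF fin ne] unfolding mesh_min_def by linarith
  show "step m u i \<le> mesh_max m u n v"
    using le[of "step m u i"] max step_outer[OF assms(1), of i] by (cases "i \<in> {1..m}") auto
  show "step n v j \<le> mesh_max m u n v"
    using le[of "step n v j"] max step_outer[OF assms(2), of j] by (cases "j \<in> {1..n}") auto
qed

lemma gradient_error:
  assumes K: "knots m u" "knots n v" and f: "Ck (Suc k) (domain m u n v) f" and \<rho>: "\<rho> \<ge> 0"
    and \<alpha>: "fst \<alpha> + snd \<alpha> = 1"
    and x: "affinely_approximable (domain m u n v) (mesh_max m u n v) \<rho> (Dx (domain m u n v) f)"
    and y: "affinely_approximable (domain m u n v) (mesh_max m u n v) \<rho> (Dy (domain m u n v) f)"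
  shows "sup_norm (domain m u n v) (\<lambda>z. D (domain m u n v) \<alpha> f z - D (domain m u n v) \<alpha> (S2 m u n v f) z) \<le> 37 * \<rho>" (is ?S)
    and "sup_norm (domain m u n v) (\<lambda>z. D (domain m u n v) \<alpha> f z - D (domain m u n v) \<alpha> (W2_star m u n v f) z) \<le> 18 * \<rho>" (is ?W)
proof -
  let ?X = "domain m u n v" and ?Y = "domain n v m u"
  have lt: "u 0 < u m" "v 0 < v n" using K by (auto simp: knots_def strict_mono_on_def)
  have X: "?X = {u 0..u m} \<times> {v 0..v n}" and Y: "?Y = {v 0..v n} \<times> {u 0..u m}" by (simp_all add: domain_def)
  have ne: "?X \<noteq> {}" using lt by (auto simp: X)
  have hx: "step m u i \<le> mesh_max m u n v" "step n v j \<le> mesh_max m u n v" for i j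
    by (rule step_le_mesh_max[OF K])+
  have sup: "sup_norm ?X g \<le> r" if "\<And>x y. (x, y) \<in> ?X \<Longrightarrow> \<bar>g (x, y)\<bar> \<le> r" for g r
    unfolding sup_norm_def using ne that by (intro cSUP_least) auto
  have "\<alpha> = (1, 0) \<or> \<alpha> = (0, 1)" using \<alpha> by (cases \<alpha>) auto
  then have "?S \<and> ?W"
  proof
    assume \<alpha>: "\<alpha> = (1, 0)"
    have der: "((\<lambda>s. f (s, y)) has_field_derivative Dx ?X f (x, y)) (at x within {u 0..u m})" if "(x, y) \<in> ?X" for x y
      using that has_partial_derivatives(1)[OF f[unfolded X] _ _ lt] by (auto simp: X)
    show ?thesis
      using local_error[OF K hx der x \<rho>] unfolding \<alpha> D_def by (intro conjI sup) simp_all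
  next
    assume \<alpha>: "\<alpha> = (0, 1)"
    define f' where "f' = (\<lambda>z. f (snd z, fst z))"
    have der: "((\<lambda>s. f' (s, y)) has_field_derivative Dy ?X f (snd (x, y), fst (x, y))) (at x within {v 0..v n})"
      if "(x, y) \<in> ?Y" for x y
      using that has_partial_derivatives(2)[OF f[unfolded X] _ _ lt] by (auto simp: X Y f'_def)
    have y': "affinely_approximable ?Y (mesh_max m u n v) \<rho> (\<lambda>z. Dy ?X f (snd z, fst z))"
      using affinely_approximable_transpose y unfolding X Y by blast
    note le = local_error[OF K(2,1) hx(2,1) der y' \<rho>]
    have "Dx ?Y (S2 n v m u f') (y, x) = Dy ?X (S2 m u n v f) (x, y)"
      "Dx ?Y (W2_star n v m u f') (y, x) = Dy ?X (W2_star m u n v f) (x, y)" for x y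
      unfolding f'_def S2_swap[OF K] W2_star_swap[OF K] X Y by (rule Dx_Dy_transpose)+
    then have "\<bar>Dy ?X f (x, y) - Dy ?X (S2 m u n v f) (x, y)\<bar> \<le> 37 * \<rho>"
      "\<bar>Dy ?X f (x, y) - Dy ?X (W2_star m u n v f) (x, y)\<bar> \<le> 18 * \<rho>" if "(x, y) \<in> ?X" for x y
      using le[of y x] that by (auto simp: X Y)
    then show ?thesis unfolding \<alpha> D_def by (intro conjI sup) simp_all
  qed
  then show ?S ?W by blast+
qed

lemma modulus_cong:
  assumes "\<And>z. z \<in> X \<Longrightarrow> \<phi> z = \<psi> z"
  shows "modulus X \<phi> t = modulus X \<psi> t"
proof -
  have "a = \<bar>\<phi> M - \<phi> P\<bar> \<and> M \<in> X \<and> P \<in> X \<and> dist M P \<le> t \<longleftrightarrow>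
      a = \<bar>\<psi> M - \<psi> P\<bar> \<and> M \<in> X \<and> P \<in> X \<and> dist M P \<le> t" for a M P
    using assms[of M] assms[of P] by auto
  then have "{\<bar>\<phi> M - \<phi> P\<bar> | M P. M \<in> X \<and> P \<in> X \<and> dist M P \<le> t} =
      {\<bar>\<psi> M - \<psi> P\<bar> | M P. M \<in> X \<and> P \<in> X \<and> dist M P \<le> t}"
    by (intro Collect_cong iff_exI) blast
  then show ?thesis by (simp only: modulus_def)
qed

lemma affinely_approximable_gradient_C2:
  assumes K: "knots m u" "knots n v" and f: "Ck 2 (domain m u n v) f"
  defines "\<rho> \<equiv> 2 * mesh_max m u n v * modulus_D (domain m u n v) 2 f (mesh_max m u n v / 2)"
  shows "affinely_approximable (domain m u n v) (mesh_max m u n v) \<rho> (Dx (domain m u n v) f)"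
    and "affinely_approximable (domain m u n v) (mesh_max m u n v) \<rho> (Dy (domain m u n v) f)"
    and "modulus_D (domain m u n v) 2 f (mesh_max m u n v / 2) \<ge> 0"
proof -
  let ?X = "{u 0..u m} \<times> {v 0..v n}"
  have X: "domain m u n v = ?X" by (simp add: domain_def)
  have lt: "u 0 < u m" "v 0 < v n" using K by (auto simp: knots_def strict_mono_on_def)
  have h: "mesh_max m u n v > 0" by (rule step_le_mesh_max[OF K])
  let ?w = "modulus_D ?X 2 f (mesh_max m u n v / 2)"
  note f = f[unfolded X]
  have f1: "Ck 1 ?X (Dx ?X f)" "Ck 1 ?X (Dy ?X f)" using f by (simp_all add: numeral_2_eq_2)
  have D: "D ?X (2, 0) f = Dx ?X (Dx ?X f)" "D ?X (1, 1) f = Dx ?X (Dy ?X f)" "D ?X (0, 2) f = Dy ?X (Dy ?X f)"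
    by (simp_all add: D_def numeral_2_eq_2)
  have w: "modulus ?X (Dx ?X (Dx ?X f)) (mesh_max m u n v / 2) \<le> ?w"
    "modulus ?X (Dx ?X (Dy ?X f)) (mesh_max m u n v / 2) \<le> ?w"
    "modulus ?X (Dy ?X (Dy ?X f)) (mesh_max m u n v / 2) \<le> ?w"
    unfolding D[symmetric] by (rule modulus_D_ge; simp)+
  \<comment> \<open>\<open>modulus_D\<close> involves only \<open>Dx\<close> after
    \<open>Dy\<close>; the opposite order, which comes from the gradient of \<open>Dx f\<close>, is
    converted by symmetry.\<close>
  have w': "modulus ?X (Dy ?X (Dx ?X f)) (mesh_max m u n v / 2) \<le> ?w"
    by (rule ord_eq_le_trans[OF modulus_cong w(2)]) (rule mixed_partials_commute[OF f lt])
  show "affinely_approximable (domain m u n v) (mesh_max m u n v) \<rho> (Dx (domain m u n v) f)"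
    unfolding X \<rho>_def by (rule affinely_approximable_C1[OF f1(1) lt less_imp_le[OF h] w(1) w'])
  show "affinely_approximable (domain m u n v) (mesh_max m u n v) \<rho> (Dy (domain m u n v) f)"
    unfolding X \<rho>_def by (rule affinely_approximable_C1[OF f1(2) lt less_imp_le[OF h] w(2,3)])
  have c: "continuous_on ?X (Dx ?X (Dx ?X f))" using f1(1) by simp
  have "\<bar>Dx ?X (Dx ?X f) (u 0, v 0) - Dx ?X (Dx ?X f) (u 0, v 0)\<bar> \<le> modulus ?X (Dx ?X (Dx ?X f)) (mesh_max m u n v / 2)"
    by (rule modulus_ge[OF c]) (use lt h in \<open>auto intro: compact_Times\<close>)
  then have "0 \<le> modulus ?X (Dx ?X (Dx ?X f)) (mesh_max m u n v / 2)" by simp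
  then show "modulus_D (domain m u n v) 2 f (mesh_max m u n v / 2) \<ge> 0" using w(1) unfolding X by linarith
qed

lemma affinely_approximable_gradient_C3:
  assumes K: "knots m u" "knots n v" and f: "Ck 3 (domain m u n v) f"
  defines "\<rho> \<equiv> (mesh_max m u n v)\<^sup>2 * norm_D (domain m u n v) 3 f / 2"
  shows "affinely_approximable (domain m u n v) (mesh_max m u n v) \<rho> (Dx (domain m u n v) f)"
    and "affinely_approximable (domain m u n v) (mesh_max m u n v) \<rho> (Dy (domain m u n v) f)"
    and "norm_D (domain m u n v) 3 f \<ge> 0"
proof -
  let ?X = "{u 0..u m} \<times> {v 0..v n}"
  have X: "domain m u n v = ?X" by (simp add: domain_def)
  have lt: "u 0 < u m" "v 0 < v n" using K by (auto simp: knots_def strict_mono_on_def)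
  have h: "mesh_max m u n v > 0" by (rule step_le_mesh_max[OF K])
  let ?w = "norm_D ?X 3 f"
  note f = f[unfolded X]
  have f1: "Ck 2 ?X f" "Ck 2 ?X (Dx ?X f)" "Ck 2 ?X (Dy ?X f)" using f by (simp_all add: numeral_2_eq_2 numeral_3_eq_3)
  have D: "D ?X (3, 0) f = Dx ?X (Dx ?X (Dx ?X f))" "D ?X (2, 1) f = Dx ?X (Dx ?X (Dy ?X f))"
    "D ?X (1, 2) f = Dx ?X (Dy ?X (Dy ?X f))" "D ?X (0, 3) f = Dy ?X (Dy ?X (Dy ?X f))"
    by (simp_all add: D_def numeral_2_eq_2 numeral_3_eq_3)
  have c: "continuous_on ?X (D ?X (3, 0) f)" "continuous_on ?X (D ?X (2, 1) f)"
    "continuous_on ?X (D ?X (1, 2) f)" "continuous_on ?X (D ?X (0, 3) f)"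
    unfolding D using f by (simp_all add: numeral_3_eq_3)
  have cp: "compact ?X" by (auto intro: compact_Times)
  have w: "\<bar>Dx ?X (Dx ?X (Dx ?X f)) z\<bar> \<le> ?w" "\<bar>Dx ?X (Dx ?X (Dy ?X f)) z\<bar> \<le> ?w"
    "\<bar>Dx ?X (Dy ?X (Dy ?X f)) z\<bar> \<le> ?w" "\<bar>Dy ?X (Dy ?X (Dy ?X f)) z\<bar> \<le> ?w" if "z \<in> ?X" for z
    using norm_D_ge[of "(3, 0)" 3, OF _ c(1) cp that] norm_D_ge[of "(2, 1)" 3, OF _ c(2) cp that] norm_D_ge[of "(1, 2)" 3, OF _ c(3) cp that] norm_D_ge[of "(0, 3)" 3, OF _ c(4) cp that]
    unfolding D by simp_all
  \<comment> \<open>The symmetry of the second derivatives of \<open>f\<close>, valid on the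
    rectangle, is differentiated in x.\<close>
  have xy: "Dx ?X (Dy ?X (Dx ?X f)) z = Dx ?X (Dx ?X (Dy ?X f)) z" if "z \<in> ?X" for z
    using D_cong(1)[OF mixed_partials_commute[OF f1(1) lt] that] .
  have yy: "Dy ?X (Dy ?X (Dx ?X f)) z = Dx ?X (Dy ?X (Dy ?X f)) z" if "z \<in> ?X" for z
    using D_cong(2)[OF mixed_partials_commute[OF f1(1) lt] that] mixed_partials_commute[OF f1(3) lt that] by simp
  show "affinely_approximable (domain m u n v) (mesh_max m u n v) \<rho> (Dx (domain m u n v) f)"
    unfolding X \<rho>_def
    by (rule affinely_approximable_C2[OF f1(2) lt less_imp_le[OF h]]) (simp_all only: w xy yy)
  show "affinely_approximable (domain m u n v) (mesh_max m u n v) \<rho> (Dy (domain m u n v) f)"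
    unfolding X \<rho>_def
    by (rule affinely_approximable_C2[OF f1(3) lt less_imp_le[OF h]]) (simp_all only: w)
  have "(u 0, v 0) \<in> ?X" using lt by auto
  from w(1)[OF this] show "norm_D (domain m u n v) 3 f \<ge> 0" unfolding X by linarith
qed

theorem theorem5:
  fixes Q :: quasi_interpolant and K2 K3 :: real
  assumes "Q = S2 \<and> K2 = 122 \<and> K3 = 269 / 12 \<or> Q = W2_star \<and> K2 = 65 \<and> K3 = 65 / 6"
  shows
    "(\<exists>C2 > 0. C2 \<le> K2 \<and>
       (\<forall>m u n v f \<alpha>. knots m u \<and> knots n v \<and> Ck 2 (domain m u n v) f \<and> fst \<alpha> + snd \<alpha> = 1 \<longrightarrow>
          (let \<Omega> = domain m u n v; h = mesh_max m u n v; \<delta> = mesh_min m u n v in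
           sup_norm \<Omega> (\<lambda>z. D \<Omega> \<alpha> f z - D \<Omega> \<alpha> (Q m u n v f) z)
             \<le> (1 + C2 * (h / \<delta>)) * h * modulus_D \<Omega> 2 f (h / 2)))) \<and>
     (\<exists>C3 > 0. C3 \<le> K3 \<and>
       (\<forall>m u n v f \<alpha>. knots m u \<and> knots n v \<and> Ck 3 (domain m u n v) f \<and> fst \<alpha> + snd \<alpha> = 1 \<longrightarrow>
          (let \<Omega> = domain m u n v; h = mesh_max m u n v; \<delta> = mesh_min m u n v in
           sup_norm \<Omega> (\<lambda>z. D \<Omega> \<alpha> f z - D \<Omega> \<alpha> (Q m u n v f) z)
             \<le> C3 * (h / \<delta>) * h\<^sup>2 * norm_D \<Omega> 3 f)))"
proof -
  define r :: real where "r = (if K2 = 122 then 37 else 18)"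
  \<comment> \<open>For C2 the remainder unit is 2h times the modulus: 74 against 123 and 36 against
    66. For C3 it is half of the squared mesh times the norm: 37/2 against 269/12 and 9 against
    65/6.\<close>
  have K23: "2 * r \<le> 1 + K2" "r / 2 \<le> K3" "K2 > 0" "K3 > 0"
    using assms by (auto simp: r_def)
  have err: "sup_norm (domain m u n v) (\<lambda>z. D (domain m u n v) \<alpha> f z - D (domain m u n v) \<alpha> (Q m u n v f) z) \<le> r * \<rho>"
    if "knots m u" "knots n v" "Ck (Suc k) (domain m u n v) f" "\<rho> \<ge> 0" "fst \<alpha> + snd \<alpha> = 1"
      "affinely_approximable (domain m u n v) (mesh_max m u n v) \<rho> (Dx (domain m u n v) f)"
      "affinely_approximable (domain m u n v) (mesh_max m u n v) \<rho> (Dy (domain m u n v) f)" for m u n v f \<alpha> \<rho> k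
    using gradient_error[OF that] assms by (auto simp: r_def)
  have ratio: "1 \<le> mesh_max m u n v / mesh_min m u n v" if "knots m u" "knots n v" for m u n v
    using step_le_mesh_max[OF that] by simp
  show ?thesis
  \<comment> \<open>The admissible upper bounds themselves serve as constants. The ratio
    \<open>h / \<delta>\<close> enters only by being at least 1.\<close>
  proof (intro conjI exI[of _ K2] exI[of _ K3] K23 order_refl allI impI; unfold Let_def; elim conjE)
    fix m u n v f and \<alpha> :: "nat \<times> nat"
    assume K: "knots m u" "knots n v" and f: "Ck 2 (domain m u n v) f" and \<alpha>: "fst \<alpha> + snd \<alpha> = 1"
    let ?h = "mesh_max m u n v" and ?w = "modulus_D (domain m u n v) 2 f (mesh_max m u n v / 2)"
    note h = step_le_mesh_max(3)[OF K] and C2 = affinely_approximable_gradient_C2[OF K f]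
    have hw: "?h * ?w \<ge> 0" using h C2(3) by simp
    have "sup_norm (domain m u n v) (\<lambda>z. D (domain m u n v) \<alpha> f z - D (domain m u n v) \<alpha> (Q m u n v f) z) \<le> r * (2 * ?h * ?w)"
      by (rule err[OF K _ _ \<alpha> C2(1,2), of 1]) (use f hw in \<open>simp_all add: numeral_2_eq_2\<close>)
    also have "\<dots> = (2 * r) * (?h * ?w)" by simp
    also have "\<dots> \<le> (1 + K2 * (?h / mesh_min m u n v)) * (?h * ?w)"
    proof (rule mult_right_mono[OF _ hw])
      have "K2 * 1 \<le> K2 * (?h / mesh_min m u n v)" by (rule mult_left_mono[OF ratio[OF K]]) (use K23 in simp)
      then show "2 * r \<le> 1 + K2 * (?h / mesh_min m u n v)" using K23(1) by linarith
    qed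
    finally show "sup_norm (domain m u n v) (\<lambda>z. D (domain m u n v) \<alpha> f z - D (domain m u n v) \<alpha> (Q m u n v f) z)
        \<le> (1 + K2 * (?h / mesh_min m u n v)) * ?h * ?w" by (simp only: mult.assoc)
  next
    fix m u n v f and \<alpha> :: "nat \<times> nat"
    assume K: "knots m u" "knots n v" and f: "Ck 3 (domain m u n v) f" and \<alpha>: "fst \<alpha> + snd \<alpha> = 1"
    let ?h = "mesh_max m u n v" and ?w = "norm_D (domain m u n v) 3 f"
    note C3 = affinely_approximable_gradient_C3[OF K f]
    have hw: "?h\<^sup>2 * ?w \<ge> 0" using C3(3) by simp
    have "sup_norm (domain m u n v) (\<lambda>z. D (domain m u n v) \<alpha> f z - D (domain m u n v) \<alpha> (Q m u n v f) z) \<le> r * (?h\<^sup>2 * ?w / 2)"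
      by (rule err[OF K _ _ \<alpha> C3(1,2), of 2]) (use f hw in \<open>simp_all add: numeral_3_eq_3\<close>)
    also have "\<dots> = r / 2 * (?h\<^sup>2 * ?w)" by simp
    also have "\<dots> \<le> K3 * (?h / mesh_min m u n v) * (?h\<^sup>2 * ?w)"
    proof (rule mult_right_mono[OF _ hw])
      have "K3 * 1 \<le> K3 * (?h / mesh_min m u n v)" by (rule mult_left_mono[OF ratio[OF K]]) (use K23 in simp)
      then show "r / 2 \<le> K3 * (?h / mesh_min m u n v)" using K23(2) by linarith
    qed
    finally show "sup_norm (domain m u n v) (\<lambda>z. D (domain m u n v) \<alpha> f z - D (domain m u n v) \<alpha> (Q m u n v f) z)
        \<le> K3 * (?h / mesh_min m u n v) * ?h\<^sup>2 * ?w" by (simp only: mult.assoc)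
  qed
qed

end
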